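(* Let $w_1=\tfrac{29}{32}$. For all integers $n\ge1$ and all $A\subset\{0,1\}^n$, $$\mathbf{E}\sqrt{h_A}\ge B_{w_1}(|A|).$$
   Context: The Hamming cube is the graph with vertex set $\{0,1\}^n$ in which two points are joined by an edge if and only if they differ in exactly one coordinate. For $f:\{0,1\}^n\to\mathbb{R}$, $\mathbf{E} f = 2^{-n}\sum_{x\in\{0,1\}^n} f(x)$. For $A\subset\{0,1\}^n$, $|A|=\mathbf{E}\mathbf{1}_A$ is the normalized counting measure of $A$ (not its cardinality). For $x\in A$, $h_A(x)$ is the number of edges connecting $x$ with $\{0,1\}^n\setminus A$; for $x\notin A$, $h_A(x)=0$. The function $B_w:[0,1]\to[0,\infty)$, for a parameter $w\in(\frac12,1]$, is defined by $$B_w(x)=\begin{cases} L(x), & x\in[0,\frac14],\\ Q(x), & x\in[\frac14,\frac12],\\ J_w(x), & x\in[\frac12,1],\end{cases}$$ (the definitions agree at the common endpoints), where: - $L(x)=x\sqrt{\log_2(1/x)}$ for $x\in(0,1]$ and $L(0)=0$; - $Q(x)=\tfrac23 x(1-x)\big(2^{5/2}-3+4(3-2^{3/2})x\big)$, the unique cubic interpolating polynomial with $Q(0)=Q(1)=0$, $Q(\frac12)=\frac12$, $Q(\frac14)=2^{-3/2}$; - $J_w(x)=\tfrac12\, I(\tfrac1{2w})^{-1}\, I(\tfrac{1-x}{w})$, where $I:[0,1]\to[0,\infty)$ is the Gaussian isoperimetric profile, i.e. the function with $I(0)=I(1)=0$ and $I\cdot I''=-1$ on $(0,1)$; explicitly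 $I(t)=\varphi(\Phi^{-1}(t))$ for $t\in(0,1)$, with $\varphi(s)=\frac{1}{\sqrt{2\pi}}e^{-s^2/2}$ and $\Phi(s)=\int_{-\infty}^s\varphi$. *)

theory Defs
  imports "HOL-Probability.Probability"
begin

section \<open>The Hamming cube\<close>

text \<open>Points of the cube are Boolean lists of length \<open>n\<close>, with \<open>False\<close> for 0 and \<open>True\<close> for 1.\<close>

definition cube :: "nat \<Rightarrow> bool list set" where
  "cube n = {x. length x = n}"

definition cube_edges :: "nat \<Rightarrow> bool list set set" where
  "cube_edges n = {{x, y} | x y. x \<in> cube n \<and> y \<in> cube n \<and> card {i. i < n \<and> x ! i \<noteq> y ! i} = 1}"

definition cube_expectation :: "nat \<Rightarrow> (bool list \<Rightarrow> real) \<Rightarrow> real" where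
  "cube_expectation n f = (\<Sum>x\<in>cube n. f x) / 2 ^ n"

definition cube_measure :: "nat \<Rightarrow> bool list set \<Rightarrow> real" where
  "cube_measure n A = cube_expectation n (indicator A)"

definition boundary_degree :: "nat \<Rightarrow> bool list set \<Rightarrow> bool list \<Rightarrow> nat" where
  "boundary_degree n A x =
     (if x \<in> A then card {e \<in> cube_edges n. \<exists>y \<in> cube n - A. e = {x, y}} else 0)"

section \<open>The Gaussian isoperimetric profile\<close>

definition Phi :: "real \<Rightarrow> real" where
  "Phi s = (LBINT t:{..s}. std_normal_density t)"

text \<open>The function \<open>Phi\<close> is a bijection from the reals onto the open unit interval, so \<open>inv Phi\<close> is
  its inverse there; outside that interval \<open>inv Phi\<close> is unspecified and is not used.\<close>

definition gauss_profile :: "real \<Rightarrow> real" where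
  "gauss_profile t = (if 0 < t \<and> t < 1 then std_normal_density (inv Phi t) else 0)"

section \<open>The piecewise lower bound\<close>

definition L :: "real \<Rightarrow> real" where
  "L x = (if x = 0 then 0 else x * sqrt (log 2 (1 / x)))"

definition Q :: "real \<Rightarrow> real" where
  "Q x = 2 / 3 * x * (1 - x) * (2 powr (5 / 2) - 3 + 4 * (3 - 2 powr (3 / 2)) * x)"

definition J :: "real \<Rightarrow> real \<Rightarrow> real" where
  "J w x = 1 / 2 * inverse (gauss_profile (1 / (2 * w))) * gauss_profile ((1 - x) / w)"

text \<open>Only arguments in the closed unit interval are meaningful. The branches agree at 1/4 and 1/2,
  so it does not matter which one is used there.\<close>

definition B :: "real \<Rightarrow> real \<Rightarrow> real" where
  "B w x = (if x \<le> 1 / 4 then L x else if x \<le> 1 / 2 then Q x else J w x)"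

end

theory Submission
  imports Defs "HOL-Real_Asymp.Real_Asymp"
begin

text \<open>The proof is by induction on the dimension. Splitting a set along the first coordinate gives two
sets in the smaller cube, of measures \<open>x \<le> y\<close>. A point of the larger one that is missing from the
smaller one gains a boundary edge. Whenever \<open>c + s * sqrt k \<le> sqrt (k + 1)\<close> for all natural numbers \<open>k\<close>
(and \<open>0 \<le> c\<close>, \<open>0 \<le> s \<le> 1\<close>), these points contribute at least \<open>c\<close> plus \<open>s\<close> times their old value, so the
bound \<open>b\<close> propagates as soon as \<open>2 * b ((x + y) / 2) \<le> c * (y - x) + s * b y + b x\<close> for one such pair
(\<open>cube_two_point_induction\<close>). Two kinds of pairs are used: \<open>(c, s)\<close> in the unit disc, and
\<open>(1, sqrt 2 - 1)\<close>, which profits from \<open>k\<close> being an integer. Optimising over the disc turns the first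
kind into \<open>2 * b ((x + y) / 2) \<le> sqrt ((y - x)\<^sup>2 + (b y)\<^sup>2) + b x\<close>.

It remains to prove this two-point inequality for the function \<open>B\<close>. Its pieces meet in convex
kinks, and \<open>L\<close> and \<open>Q\<close>, continued beyond their intervals, bound their neighbours from below. Inside one
piece, or across one kink, the inequality has a structural proof. For \<open>L\<close> it reduces to an inequality
between logarithms in which the size of the sets enters monotonically (\<open>L_two_point\<close>). For \<open>Q\<close>, the
difference of squares factors, and the claim becomes a one-variable statement that holds because
\<open>Q\<close> interpolates the extremal values at \<open>1/4\<close> and \<open>1/2\<close> (\<open>Q_two_point\<close>). For \<open>J\<close>, the equation
\<open>J * J'' = - kappa\<close> with a constant \<open>kappa < 2\<close> makes \<open>(y - x)\<^sup>2 + (J y)\<^sup>2 - (2 * J ((x + y) / 2) - J x)\<^sup>2\<close> convex in \<open>(y - x) / 2\<close>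
for a fixed midpoint (\<open>Jw_two_point\<close>); the value \<open>29/32\<close> is chosen so that \<open>kappa\<close> stays just below \<open>2\<close>. Near \<open>x = y = 1/2\<close>, where \<open>Q\<close> is critical
(\<open>Q * Q'' = - 2\<close>), the gain comes from the kink (\<open>Q_J_two_point_low\<close>, \<open>Q_J_two_point_high\<close>).

All remaining points have \<open>x \<le> 1/2 \<le> y\<close> and stay away from the diagonal. There, for a fixed pair
\<open>(c, s)\<close>, the defect \<open>c * (y - x) + s * B y + B x - 2 * B ((x + y) / 2)\<close> is concave in \<open>x\<close> and in \<open>y\<close>
separately, so on a rectangle it is enough to inspect the four corners
(\<open>two_point_rectangle\<close>). A cover by finitely many rectangles, with a pair \<open>(c, s)\<close> for each, and two
strips along \<open>x = 0\<close> finish the proof.\<close>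

section \<open>The Hamming cube: reduction to a two-point inequality\<close>

text \<open>The Hamming distance, in the form in which it occurs in the definition of the edges.\<close>
definition cube_dist :: "nat \<Rightarrow> bool list \<Rightarrow> bool list \<Rightarrow> nat" where
  "cube_dist n x y = card {i. i < n \<and> x ! i \<noteq> y ! i}"

lemma cube_dist_self [simp]: "cube_dist n x x = 0"
  by (simp add: cube_dist_def)

lemma cube_dist_Cons:
  "cube_dist (Suc n) (a # x) (b # y) = (if a = b then 0 else 1) + cube_dist n x y"
proof -
  have "{i. i < Suc n \<and> (a # x) ! i \<noteq> (b # y) ! i} =
      (if a = b then {} else {0}) \<union> Suc ` {i. i < n \<and> x ! i \<noteq> y ! i}" (is "?S = ?T")
  proof (rule set_eqI)
    fix i show "i \<in> ?S \<longleftrightarrow> i \<in> ?T"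
      by (cases i) auto
  qed
  moreover have "card (Suc ` {i. i < n \<and> x ! i \<noteq> y ! i}) = cube_dist n x y"
    by (simp add: card_image cube_dist_def)
  ultimately show ?thesis
    by (auto simp: cube_dist_def card_insert_if)
qed

lemma cube_dist_eq_0:
  assumes "x \<in> cube n" "y \<in> cube n"
  shows "cube_dist n x y = 0 \<longleftrightarrow> x = y"
proof
  assume "cube_dist n x y = 0"
  then have "{i. i < n \<and> x ! i \<noteq> y ! i} = {}"
    by (simp add: cube_dist_def)
  with assms show "x = y"
    by (intro nth_equalityI) (auto simp: cube_def)
qed auto

lemma cube_0: "cube 0 = {[]}"
  by (auto simp: cube_def)

lemma cube_Suc: "cube (Suc n) = (#) True ` cube n \<union> (#) False ` cube n"
proof -
  have "x \<in> (#) True ` cube n \<union> (#) False ` cube n" if "length x = Suc n" for x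
    using that by (cases x; cases "hd x") (auto simp: cube_def)
  then show ?thesis by (auto simp: cube_def)
qed

lemma finite_cube [simp]: "finite (cube n)"
  by (induction n) (auto simp: cube_0 cube_Suc)

lemma boundary_degree_eq_card_neighbours:
  assumes "x \<in> A" "A \<subseteq> cube n"
  shows "boundary_degree n A x = card {y \<in> cube n - A. cube_dist n x y = 1}"
proof -
  have x: "x \<in> cube n" using assms by auto
  have "{e \<in> cube_edges n. \<exists>y \<in> cube n - A. e = {x, y}} =
        (\<lambda>y. {x, y}) ` {y \<in> cube n - A. cube_dist n x y = 1}" (is "?S = ?T")
  proof
    show "?S \<subseteq> ?T"
    proof
      fix e assume e: "e \<in> ?S"
      then obtain y where y: "y \<in> cube n - A" "e = {x, y}" by auto
      from e have "e \<in> cube_edges n" by simp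
      then obtain u v where "e = {u, v}" "card {i. i < n \<and> u ! i \<noteq> v ! i} = 1"
        unfolding cube_edges_def mem_Collect_eq by (elim exE conjE)
      with y have uv: "{x, y} = {u, v}" "cube_dist n u v = 1"
        by (simp_all only: cube_dist_def)
      have "x = u \<and> y = v \<or> x = v \<and> y = u"
        using uv(1) by (simp add: doubleton_eq_iff)
      moreover have "cube_dist n v u = cube_dist n u v"
        unfolding cube_dist_def by (rule arg_cong[where f = card]) blast
      ultimately have "cube_dist n x y = 1" using uv(2) by metis
      with y show "e \<in> ?T" by blast
    qed
    show "?T \<subseteq> ?S"
    proof
      fix e assume "e \<in> ?T"
      then obtain y where y: "y \<in> cube n - A" "cube_dist n x y = 1" "e = {x, y}" by auto
      then have "e \<in> cube_edges n"
        using x unfolding cube_edges_def cube_dist_def mem_Collect_eq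
        by (intro exI[of _ x] exI[of _ y] conjI) auto
      with y show "e \<in> ?S" by auto
    qed
  qed
  moreover have "inj_on (\<lambda>y. {x, y}) {y \<in> cube n - A. cube_dist n x y = 1}"
    by (intro inj_onI) (metis doubleton_eq_iff)
  ultimately show ?thesis
    unfolding boundary_degree_def using assms(1) by (simp only: if_True card_image)
qed

definition facet :: "bool \<Rightarrow> bool list set \<Rightarrow> bool list set" where
  "facet b A = {x. b # x \<in> A}"

lemma facet_subset: "A \<subseteq> cube (Suc n) \<Longrightarrow> facet b A \<subseteq> cube n"
  by (auto simp: facet_def cube_def)

text \<open>Inside the facet the degree is that of the facet; the only other neighbour is the reflection in
  the first coordinate.\<close>
lemma boundary_degree_Cons:
  assumes A: "A \<subseteq> cube (Suc n)" and x: "x \<in> facet b A"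
  shows "boundary_degree (Suc n) A (b # x) =
    boundary_degree n (facet b A) x + (if x \<in> facet (\<not> b) A then 0 else 1)"
proof -
  have xn: "x \<in> cube n" using facet_subset[OF A] x by auto
  have "{y \<in> cube (Suc n) - A. cube_dist (Suc n) (b # x) y = 1} =
      (#) b ` {y \<in> cube n - facet b A. cube_dist n x y = 1} \<union>
      (#) (\<not> b) ` (if x \<in> facet (\<not> b) A then {} else {x})" (is "?S = ?T")
  proof (rule set_eqI)
    fix y show "y \<in> ?S \<longleftrightarrow> y \<in> ?T"
    proof (cases y)
      case Nil then show ?thesis by (auto simp: cube_def)
    next
      case (Cons a z)
      show ?thesis
      proof (cases "z \<in> cube n")
        case True
        have y: "y \<in> cube (Suc n)" using True Cons by (simp add: cube_def)
        show ?thesis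
        proof (cases "a = b")
          case True
          then show ?thesis
            using y \<open>z \<in> cube n\<close> by (auto simp: Cons cube_dist_Cons facet_def)
        next
          case False
          then have a: "a = (\<not> b)" by auto
          have "y \<in> ?S \<longleftrightarrow> (\<not> b) # z \<notin> A \<and> z = x"
            using y False cube_dist_eq_0[OF xn True] by (auto simp: Cons cube_dist_Cons a)
          also have "\<dots> \<longleftrightarrow> y \<in> ?T"
            by (auto simp: Cons a facet_def)
          finally show ?thesis .
        qed
      next
        case False
        then have "y \<notin> ?S" by (auto simp: Cons cube_def)
        moreover have "y \<notin> ?T" using False xn by (auto simp: Cons)
        ultimately show ?thesis by blast
      qed
    qed
  qed
  moreover have "card ((#) b ` {y \<in> cube n - facet b A. cube_dist n x y = 1}) =
      card {y \<in> cube n - facet b A. cube_dist n x y = 1}"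
    by (intro card_image) auto
  moreover have "card ((#) b ` {y \<in> cube n - facet b A. cube_dist n x y = 1} \<union>
      (#) (\<not> b) ` (if x \<in> facet (\<not> b) A then {} else {x})) =
      card ((#) b ` {y \<in> cube n - facet b A. cube_dist n x y = 1}) +
      (if x \<in> facet (\<not> b) A then 0 else 1)"
    by (subst card_Un_disjoint) auto
  moreover have "b # x \<in> A" using x by (simp add: facet_def)
  ultimately show ?thesis
    unfolding boundary_degree_eq_card_neighbours[OF x facet_subset[OF A]]
      boundary_degree_eq_card_neighbours[OF \<open>b # x \<in> A\<close> A] by simp
qed

lemma cube_expectation_Suc:
  "cube_expectation (Suc n) f =
    (cube_expectation n (\<lambda>x. f (b # x)) + cube_expectation n (\<lambda>x. f ((\<not> b) # x))) / 2"
proof -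
  have "(\<Sum>x\<in>cube (Suc n). f x) = (\<Sum>x\<in>cube n. f (True # x)) + (\<Sum>x\<in>cube n. f (False # x))"
    unfolding cube_Suc by (subst sum.union_disjoint) (auto simp: sum.reindex inj_on_def)
  then show ?thesis
    by (cases b) (auto simp: cube_expectation_def field_simps)
qed

lemma cube_expectation_mono:
  "(\<And>x. x \<in> cube n \<Longrightarrow> f x \<le> g x) \<Longrightarrow> cube_expectation n f \<le> cube_expectation n g"
  by (auto simp: cube_expectation_def intro!: divide_right_mono sum_mono)

lemma cube_expectation_add:
  "cube_expectation n (\<lambda>x. f x + g x) = cube_expectation n f + cube_expectation n g"
  by (simp add: cube_expectation_def sum.distrib add_divide_distrib)

lemma cube_expectation_cmult:
  "cube_expectation n (\<lambda>x. c * f x) = c * cube_expectation n f"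
  by (simp add: cube_expectation_def sum_distrib_left)

lemma cube_measure_Suc:
  "cube_measure (Suc n) A = (cube_measure n (facet b A) + cube_measure n (facet (\<not> b) A)) / 2"
proof -
  have "(\<lambda>x. indicator A (a # x)) = (indicator (facet a A) :: _ \<Rightarrow> real)" for a
    by (auto simp: facet_def indicator_def)
  then show ?thesis
    by (simp add: cube_measure_def cube_expectation_Suc[where b = b])
qed

lemma cube_measure_bounds: "0 \<le> cube_measure n A" "cube_measure n A \<le> 1"
proof -
  show "0 \<le> cube_measure n A"
    by (simp add: cube_measure_def cube_expectation_def sum_nonneg)
  have card: "card (cube n) = 2 ^ n"
  proof (induction n)
    case (Suc n)
    have "card (cube (Suc n)) = card ((#) True ` cube n) + card ((#) False ` cube n)"
      unfolding cube_Suc by (rule card_Un_disjoint) auto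
    with Suc show ?case by (simp add: card_image)
  qed (simp add: cube_0)
  have "(\<Sum>x\<in>cube n. indicator A x) \<le> (\<Sum>x\<in>cube n. 1 :: real)"
    by (intro sum_mono) (auto simp: indicator_def)
  then show "cube_measure n A \<le> 1"
    by (simp add: cube_measure_def cube_expectation_def card)
qed

text \<open>The pairs \<open>(c, s)\<close> for which the line with height \<open>c\<close> and slope
  \<open>s\<close> stays below \<open>sqrt (k + 1)\<close> as a function of \<open>sqrt k\<close>,
  at all natural numbers \<open>k\<close>. Restricting \<open>k\<close> to integers admits pairs
  outside the unit disc.\<close>
definition supporting :: "real \<Rightarrow> real \<Rightarrow> bool" where
  "supporting c s \<longleftrightarrow> 0 \<le> c \<and> 0 \<le> s \<and> s \<le> 1 \<and> (\<forall>k::nat. c + s * sqrt k \<le> sqrt (k + 1))"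

lemma supporting_unit_disc:
  assumes "0 \<le> c" "0 \<le> s" "c\<^sup>2 + s\<^sup>2 \<le> 1"
  shows "supporting c s"
proof -
  have "s\<^sup>2 \<le> 1" using assms zero_le_power2[of c] by linarith
  then have "s \<le> 1" by (intro power2_le_imp_le[of s 1]) auto
  moreover have "c + s * sqrt k \<le> sqrt (k + 1)" for k :: nat
  proof (rule real_le_rsqrt)
    have "0 \<le> (s - c * sqrt k)\<^sup>2" by simp
    then have "(c + s * sqrt k)\<^sup>2 \<le> (c\<^sup>2 + s\<^sup>2) * (1 + real k)"
      by (simp add: power2_eq_square algebra_simps)
    also have "\<dots> \<le> 1 * (1 + real k)" by (intro mult_right_mono assms) auto
    finally show "(c + s * sqrt k)\<^sup>2 \<le> real (k + 1)" by simp
  qed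
  ultimately show ?thesis using assms by (auto simp: supporting_def add.commute)
qed

text \<open>The line through the points of \<open>sqrt (k + 1)\<close> over \<open>k = 0\<close> and \<open>k
  = 1\<close>. It exceeds \<open>sqrt (k + 1)\<close> strictly between them, where there is no
  integer.\<close>
lemma supporting_one: "supporting 1 (sqrt 2 - 1)"
proof -
  have "1 + (sqrt 2 - 1) * sqrt k \<le> sqrt (k + 1)" for k :: nat
  proof (cases "k = 0")
    case False
    then have k: "1 \<le> sqrt k" by simp
    have "(1 + (sqrt 2 - 1) * sqrt k)\<^sup>2 = 1 + 2 * (sqrt 2 - 1) * sqrt k + (3 - 2 * sqrt 2) * k"
      by (simp add: power2_sum power2_diff power_mult_distrib)
    also have "\<dots> \<le> 1 + 2 * (sqrt 2 - 1) * k + (3 - 2 * sqrt 2) * k"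
    proof -
      have "sqrt k \<le> real k" using mult_left_mono[OF k, of "sqrt k"] by simp
      moreover have "2 * sqrt 2 \<le> 3"
        by (rule power2_le_imp_le) (auto simp: power_mult_distrib)
      ultimately show ?thesis by (intro add_mono mult_left_mono) auto
    qed
    also have "\<dots> = k + 1" by (simp add: algebra_simps)
    finally show ?thesis by (intro real_le_rsqrt) simp
  qed auto
  moreover have "sqrt 2 \<le> 2" by (intro real_le_lsqrt) auto
  ultimately show ?thesis by (auto simp: supporting_def add.commute)
qed

text \<open>The larger facet pays for the points that are missing from the smaller one; their measure is at
  least \<open>y - x\<close>. The smaller facet just uses that degrees do not decrease.\<close>
theorem cube_two_point_induction:
  fixes b :: "real \<Rightarrow> real"
  assumes b0: "b 0 = 0" and b1: "b 1 = 0"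
    and step: "\<And>x y. 0 \<le> x \<Longrightarrow> x \<le> y \<Longrightarrow> y \<le> 1 \<Longrightarrow>
      \<exists>c s. supporting c s \<and> 2 * b ((x + y) / 2) \<le> c * (y - x) + s * b y + b x"
  shows "A \<subseteq> cube n \<Longrightarrow>
    b (cube_measure n A) \<le> cube_expectation n (\<lambda>x. sqrt (real (boundary_degree n A x)))"
proof (induction n arbitrary: A)
  case 0
  then have "A = {} \<or> A = {[]}" unfolding cube_0 by blast
  then show ?case using b0 b1
    by (auto simp: cube_measure_def cube_expectation_def cube_0 sum_nonneg)
next
  case (Suc n)
  define E where "E A' = cube_expectation n (\<lambda>x. sqrt (real (boundary_degree n A' x)))" for A'
  obtain a where a: "cube_measure n (facet (\<not> a) A) \<le> cube_measure n (facet a A)"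
    using linear[of "cube_measure n (facet False A)" "cube_measure n (facet True A)"]
    by (metis (full_types))
  define U V where "U = facet a A" and "V = facet (\<not> a) A"
  define x y where "x = cube_measure n V" and "y = cube_measure n U"
  have UV: "U \<subseteq> cube n" "V \<subseteq> cube n"
    using facet_subset[OF Suc.prems] by (auto simp: U_def V_def)
  have xy: "0 \<le> x" "x \<le> y" "y \<le> 1"
    using a cube_measure_bounds by (auto simp: x_def y_def U_def V_def)
  obtain c s where cs: "supporting c s" and two: "2 * b ((x + y) / 2) \<le> c * (y - x) + s * b y + b x"
    using step[OF xy] by blast
  have deg: "boundary_degree (Suc n) A (d # z) =
      (if z \<in> facet d A then boundary_degree n (facet d A) z + (if z \<in> facet (\<not> d) A then 0 else 1) else 0)"
    for d z
    using boundary_degree_Cons[OF Suc.prems] by (auto simp: boundary_degree_def facet_def)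
  have off: "boundary_degree n S z = 0" if "z \<notin> S" for S z
    using that by (simp add: boundary_degree_def)
  have "s * b y + c * (y - x) \<le> s * E U + c * (y - x)"
    using Suc.IH[OF UV(1)] cs by (auto simp: E_def y_def supporting_def intro!: mult_left_mono)
  also have "\<dots> = cube_expectation n
      (\<lambda>z. s * sqrt (real (boundary_degree n U z)) + c * (indicator U z + (- 1) * indicator V z))"
    by (simp only: cube_expectation_add cube_expectation_cmult E_def x_def y_def cube_measure_def) simp
  also have "\<dots> \<le> cube_expectation n (\<lambda>z. sqrt (real (boundary_degree (Suc n) A (a # z))))"
  proof (rule cube_expectation_mono)
    fix z assume "z \<in> cube n"
    have "s * sqrt k \<le> sqrt k" for k :: nat
      using cs by (auto simp: supporting_def intro!: mult_left_le_one_le)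
    moreover have "s * sqrt k + c \<le> sqrt (real k + 1)" for k :: nat
      using cs by (auto simp: supporting_def add.commute)
    ultimately show "s * sqrt (real (boundary_degree n U z)) + c * (indicator U z + (- 1) * indicator V z)
        \<le> sqrt (real (boundary_degree (Suc n) A (a # z)))"
      using cs unfolding deg by (auto simp: U_def V_def off indicator_def supporting_def add.commute)
  qed
  finally have 1: "s * b y + c * (y - x) \<le> \<dots>" .
  have "b x \<le> E V" using Suc.IH[OF UV(2)] by (simp add: E_def x_def)
  also have "\<dots> \<le> cube_expectation n (\<lambda>z. sqrt (real (boundary_degree (Suc n) A ((\<not> a) # z))))"
    unfolding E_def deg by (rule cube_expectation_mono) (auto simp: V_def off)
  finally have 2: "b x \<le> \<dots>" .
  have "2 * b (cube_measure (Suc n) A) = 2 * b ((x + y) / 2)"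
    by (simp add: cube_measure_Suc[where b = a] x_def y_def U_def V_def add.commute)
  with 1 2 two show ?case
    by (simp add: cube_expectation_Suc[where b = a])
qed

section \<open>The Gaussian isoperimetric profile\<close>

lemma std_normal_density_pos: "0 < std_normal_density s"
  by (simp add: normal_density_pos)

lemma continuous_std_normal_density: "continuous_on A std_normal_density"
  unfolding std_normal_density_def by (intro continuous_intros) auto

lemma DERIV_std_normal_density:
  "(std_normal_density has_real_derivative - s * std_normal_density s) (at s)"
  unfolding std_normal_density_def by (auto intro!: derivative_eq_intros simp: field_simps)

lemma integrable_std_normal_density: "integrable lborel std_normal_density"
  using integrable_std_normal_moment[of 0] by simp

text \<open>This makes the limits of distribution functions available for \<open>Phi\<close>.\<close>
lemma Phi_eq_cdf: "Phi s = cdf std_normal_distribution s"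
proof -
  interpret real_distribution std_normal_distribution by (rule real_dist_normal_dist)
  have "cdf std_normal_distribution s = (\<integral>x. indicator {..s} x \<partial>std_normal_distribution)"
    by (simp add: cdf_def)
  also have "\<dots> = (\<integral>x. std_normal_density x *\<^sub>R indicator {..s} x \<partial>lborel)"
    by (subst integral_density) (auto simp: normal_density_nonneg)
  also have "\<dots> = Phi s"
    by (simp add: Phi_def set_lebesgue_integral_def mult.commute)
  finally show ?thesis by simp
qed

lemma Phi_diff:
  assumes "a \<le> b"
  shows "Phi b - Phi a = integral {a..b} std_normal_density"
proof -
  have int: "set_integrable lborel A std_normal_density" if "A \<in> sets borel" for A
    unfolding set_integrable_def
    by (rule integrable_mult_indicator[OF _ integrable_std_normal_density]) (use that in simp)
  have "{..b} = {..a} \<union> {a<..b}" using assms by (simp add: ivl_disj_un)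
  then have "Phi b = (LBINT t:{..a} \<union> {a<..b}. std_normal_density t)"
    unfolding Phi_def by simp
  also have "\<dots> = Phi a + (LBINT t:{a<..b}. std_normal_density t)"
    unfolding Phi_def by (intro set_integral_Un int) auto
  also have "(LBINT t:{a<..b}. std_normal_density t) = integral {a<..b} std_normal_density"
    by (rule set_borel_integral_eq_integral(2)[OF int]) simp
  also have "\<dots> = integral {a..b} std_normal_density"
    by (rule integral_spike_set; rule negligible_subset[OF negligible_sing[of a]]) auto
  finally show ?thesis by (simp only: add_diff_cancel_left')
qed

lemma DERIV_Phi: "(Phi has_real_derivative std_normal_density s) (at s)"
proof -
  have "((\<lambda>x. integral {s - 1..x} std_normal_density) has_real_derivative std_normal_density s)
      (at s within {s - 1..s + 1})"
    by (intro integral_has_real_derivative continuous_std_normal_density) auto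
  then have "((\<lambda>x. integral {s - 1..x} std_normal_density) has_real_derivative std_normal_density s) (at s)"
    by (simp only: at_within_Icc_at[of "s - 1" s "s + 1"] less_add_one diff_less zero_less_one)
  from DERIV_add[OF this DERIV_const[of "Phi (s - 1)"]]
  have *: "((\<lambda>x. integral {s - 1..x} std_normal_density + Phi (s - 1)) has_real_derivative
      std_normal_density s) (at s within {s - 1<..})"
    by (simp only: add_0_right has_field_derivative_at_within)
  have "(Phi has_real_derivative std_normal_density s) (at s within {s - 1<..})"
  proof (rule has_field_derivative_transform_within[OF *, of 1])
    fix x assume "x \<in> {s - 1<..}" "dist x s < 1"
    then show "integral {s - 1..x} std_normal_density + Phi (s - 1) = Phi x"
      using Phi_diff[of "s - 1" x] by (simp only: greaterThan_iff less_imp_le diff_add_cancel flip: Phi_diff)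
  qed simp_all
  moreover have "at s within {s - 1<..} = at s"
    by (rule at_within_open) auto
  ultimately show ?thesis by simp
qed

lemma isCont_Phi: "isCont Phi s"
  using DERIV_Phi by (rule DERIV_isCont)

lemma Phi_strict_mono: "a < b \<Longrightarrow> Phi a < Phi b"
  by (rule DERIV_pos_imp_increasing[of a b Phi]) (use DERIV_Phi std_normal_density_pos in blast)+

lemma Phi_less_iff [simp]: "Phi a < Phi b \<longleftrightarrow> a < b"
  using Phi_strict_mono by (metis less_asym linorder_less_linear)

lemma Phi_le_iff [simp]: "Phi a \<le> Phi b \<longleftrightarrow> a \<le> b"
  using Phi_less_iff by (metis linorder_not_less)

lemma Phi_at_top: "(Phi \<longlongrightarrow> 1) at_top" and Phi_at_bot: "(Phi \<longlongrightarrow> 0) at_bot"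
proof -
  interpret real_distribution std_normal_distribution by (rule real_dist_normal_dist)
  have eq: "Phi = cdf std_normal_distribution" by (rule ext) (rule Phi_eq_cdf)
  show "(Phi \<longlongrightarrow> 1) at_top" unfolding eq by (rule cdf_lim_at_top_prob)
  show "(Phi \<longlongrightarrow> 0) at_bot" unfolding eq by (rule cdf_lim_at_bot)
qed

lemma Phi_minus: "Phi (- s) = 1 - Phi s"
proof -
  have const: "Phi (- s) + Phi s = Phi (- t) + Phi t" for s t
  proof (rule DERIV_isconst_all[where f = "\<lambda>s. Phi (- s) + Phi s"], rule allI)
    fix x :: real
    have "((\<lambda>s. Phi (- s)) has_real_derivative std_normal_density (- x) * (- 1)) (at x)"
      by (rule DERIV_chain2[OF DERIV_Phi]) (auto intro!: derivative_eq_intros)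
    then have "((\<lambda>s. Phi (- s) + Phi s) has_real_derivative
        std_normal_density (- x) * (- 1) + std_normal_density x) (at x)"
      by (intro DERIV_add DERIV_Phi)
    then show "((\<lambda>s. Phi (- s) + Phi s) has_real_derivative 0) (at x)"
      by (simp add: std_normal_density_def)
  qed
  have "((\<lambda>t. Phi (- t) + Phi t) \<longlongrightarrow> 0 + 1) at_top"
    by (intro tendsto_add Phi_at_top filterlim_compose[OF Phi_at_bot] filterlim_uminus_at_bot_at_top)
  moreover have "(\<lambda>t. Phi (- t) + Phi t) = (\<lambda>t. Phi (- s) + Phi s)"
    using const by auto
  ultimately show ?thesis
    by (simp add: tendsto_const_iff)
qed

lemma Phi_0: "Phi 0 = 1 / 2"
  using Phi_minus[of 0] by simp

definition quantile :: "real \<Rightarrow> real" where "quantile t = inv Phi t"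

lemma Phi_surj:
  assumes "0 < t" "t < 1" shows "\<exists>s. Phi s = t"
proof -
  obtain a where a: "Phi a < t"
    using order_tendstoD(2)[OF Phi_at_bot assms(1)] by (auto simp: eventually_at_bot_linorder)
  obtain b where b: "t < Phi b"
    using order_tendstoD(1)[OF Phi_at_top assms(2)] by (auto simp: eventually_at_top_linorder)
  have "a \<le> b" using a b Phi_le_iff by (meson less_le_trans less_imp_le)
  then show ?thesis
    using IVT[of Phi a t b] a b isCont_Phi by fastforce
qed

lemma Phi_quantile: "0 < t \<Longrightarrow> t < 1 \<Longrightarrow> Phi (quantile t) = t"
  unfolding quantile_def using Phi_surj by (metis f_inv_into_f rangeI)

lemma quantile_Phi [simp]: "quantile (Phi s) = s"
proof -
  have "inj Phi" by (rule injI) (metis Phi_less_iff linorder_neqE less_irrefl)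
  then show ?thesis by (simp add: quantile_def)
qed

lemma Phi_bounds: "0 < Phi s" "Phi s < 1"
proof -
  interpret real_distribution std_normal_distribution by (rule real_dist_normal_dist)
  have "0 \<le> Phi (s - 1)" "Phi (s + 1) \<le> 1"
    using cdf_bounded_prob cdf_nonneg by (auto simp: Phi_eq_cdf)
  then show "0 < Phi s" "Phi s < 1"
    using Phi_strict_mono[of "s - 1" s] Phi_strict_mono[of s "s + 1"] by linarith+
qed

lemma quantile_le_iff: "0 < t \<Longrightarrow> t < 1 \<Longrightarrow> quantile t \<le> s \<longleftrightarrow> t \<le> Phi s"
  by (metis Phi_le_iff Phi_quantile)

lemma le_quantile_iff: "0 < t \<Longrightarrow> t < 1 \<Longrightarrow> s \<le> quantile t \<longleftrightarrow> Phi s \<le> t"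
  by (metis Phi_le_iff Phi_quantile)

lemma gauss_profile_quantile:
  "0 < t \<Longrightarrow> t < 1 \<Longrightarrow> gauss_profile t = std_normal_density (quantile t)"
  by (simp add: gauss_profile_def quantile_def)

lemma DERIV_quantile:
  assumes "0 < t" "t < 1"
  shows "(quantile has_real_derivative inverse (gauss_profile t)) (at t)"
proof -
  define s where "s = quantile t"
  have t: "Phi s = t" using assms by (simp add: s_def Phi_quantile)
  have cont: "isCont quantile t"
    unfolding t[symmetric]
    by (rule isCont_inverse_function2[of "s - 1" s "s + 1"]) (auto simp: isCont_Phi)
  show ?thesis
    unfolding gauss_profile_quantile[OF assms]
    by (rule DERIV_inverse_function[where f = Phi and a = 0 and b = 1])
      (use assms cont in \<open>auto simp: Phi_quantile DERIV_Phi std_normal_density_pos less_imp_neq[symmetric]\<close>)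
qed

lemma gauss_profile_pos: "0 < t \<Longrightarrow> t < 1 \<Longrightarrow> 0 < gauss_profile t"
  by (simp add: gauss_profile_quantile std_normal_density_pos)

text \<open>The chain rule gives \<open>I' = - quantile\<close>, and with the derivative of the quantile this
  is the equation \<open>I * I'' = - 1\<close>.\<close>
lemma DERIV_gauss_profile:
  assumes "0 < t" "t < 1"
  shows "(gauss_profile has_real_derivative - quantile t) (at t)"
proof -
  have "((\<lambda>t. std_normal_density (quantile t)) has_real_derivative
      (- quantile t * std_normal_density (quantile t)) * inverse (gauss_profile t)) (at t)"
    by (rule DERIV_chain2[OF DERIV_std_normal_density DERIV_quantile[OF assms]])
  also have "(- quantile t * std_normal_density (quantile t)) * inverse (gauss_profile t) = - quantile t"
    using gauss_profile_pos[OF assms] by (simp add: gauss_profile_quantile[OF assms])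
  finally have *: "((\<lambda>t. std_normal_density (quantile t)) has_real_derivative - quantile t) (at t)" .
  have ev: "\<forall>\<^sub>F u in nhds t. u \<in> {0<..<1}"
    by (rule eventually_nhds_in_open) (use assms in auto)
  show ?thesis
    by (rule DERIV_cong_ev[THEN iffD1, OF refl _ refl *])
      (use ev in eventually_elim, auto simp: gauss_profile_quantile)
qed

lemma tendsto_gauss_profile_0: "(gauss_profile \<longlongrightarrow> 0) (at_right 0)"
proof -
  have "filterlim quantile at_bot (at_right 0)"
    unfolding filterlim_at_bot
  proof
    fix Z :: real
    have "\<forall>\<^sub>F t in at_right 0. t \<in> {0<..<Phi Z}"
      by (rule eventually_at_right_real) (rule Phi_bounds)
    then show "\<forall>\<^sub>F t in at_right 0. quantile t \<le> Z"
      by eventually_elim (use Phi_bounds(2)[of Z] in \<open>auto simp: quantile_le_iff\<close>)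
  qed
  moreover have "((\<lambda>s. std_normal_density s) \<longlongrightarrow> 0) at_bot"
    unfolding std_normal_density_def by real_asymp
  ultimately have *: "((\<lambda>t. std_normal_density (quantile t)) \<longlongrightarrow> 0) (at_right 0)"
    using filterlim_compose by blast
  have "\<forall>\<^sub>F t in at_right 0. t \<in> {0<..<1::real}"
    by (rule eventually_at_right_real) simp
  then have "\<forall>\<^sub>F t in at_right 0. std_normal_density (quantile t) = gauss_profile t"
    by eventually_elim (simp add: gauss_profile_quantile)
  then show ?thesis by (rule Lim_transform_eventually[OF *])
qed

section \<open>The within_branch J: derivatives and numerical values\<close>

lemma exp_minus_ge:
  assumes "0 \<le> (v::real)"
  shows "1 - v + v^2/2 - v^3/6 + v^4/24 - v^5/120 \<le> exp (- v)"
proof -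
  obtain t where "exp (- v) = (\<Sum>m<6. (- v) ^ m / fact m) + exp t / fact 6 * (- v) ^ 6"
    using Maclaurin_exp_le[of "- v" 6] by blast
  moreover have "0 \<le> exp t / fact 6 * (- v) ^ 6" by simp
  ultimately show ?thesis by (simp add: eval_nat_numeral lessThan_Suc algebra_simps)
qed

lemma exp_minus_le:
  assumes "0 \<le> (v::real)"
  shows "exp (- v) \<le> 1 - v + v^2/2"
proof -
  obtain t where "exp (- v) = (\<Sum>m<3. (- v) ^ m / fact m) + exp t / fact 3 * (- v) ^ 3"
    using Maclaurin_exp_le[of "- v" 3] by blast
  moreover have "exp t / fact 3 * (- v) ^ 3 \<le> 0"
    using assms by (intro mult_nonneg_nonpos) auto
  ultimately show ?thesis by (simp add: eval_nat_numeral lessThan_Suc algebra_simps)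
qed

text \<open>The monotonicity argument behind all elementary bounds below.\<close>
lemma le_of_deriv_le:
  fixes f g f' g' :: "real \<Rightarrow> real"
  assumes "c \<le> a" "f c \<le> g c"
    and f: "\<And>x. c \<le> x \<Longrightarrow> x \<le> a \<Longrightarrow> (f has_real_derivative f' x) (at x)"
    and g: "\<And>x. c \<le> x \<Longrightarrow> x \<le> a \<Longrightarrow> (g has_real_derivative g' x) (at x)"
    and le: "\<And>x. c \<le> x \<Longrightarrow> x \<le> a \<Longrightarrow> f' x \<le> g' x"
  shows "f a \<le> g a"
proof -
  have "g c - f c \<le> g a - f a"
  proof (rule DERIV_nonneg_imp_nondecreasing[OF assms(1)])
    fix x assume "c \<le> x" "x \<le> a"
    then show "\<exists>y. ((\<lambda>x. g x - f x) has_real_derivative y) (at x) \<and> 0 \<le> y"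
      using DERIV_diff[OF g f, of x] le[of x] by (intro exI[of _ "g' x - f' x"]) simp
  qed
  with assms(2) show ?thesis by simp
qed

lemma arctan_bounds:
  assumes "0 \<le> (x::real)"
  shows "arctan x \<le> x - x^3/3 + x^5/5" "x - x^3/3 + x^5/5 - x^7/7 \<le> arctan x"
    "x - x^3/3 \<le> arctan x" "arctan x \<le> x"
proof -
  have geo: "1 - x^2 \<le> inverse (1 + x^2)" "inverse (1 + x^2) \<le> 1"
      "inverse (1 + x^2) \<le> 1 - x^2 + x^4" "1 - x^2 + x^4 - x^6 \<le> inverse (1 + x^2)" for x :: real
  proof -
    have p: "0 < 1 + x^2" by (rule add_pos_nonneg) auto
    have "(1 - x^2) * (1 + x^2) \<le> 1" by (simp add: algebra_simps flip: power_add)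
    moreover have "(1 - x^2 + x^4) * (1 + x^2) = 1 + x^6" by (simp add: algebra_simps flip: power_add)
    moreover have "(1 - x^2 + x^4 - x^6) * (1 + x^2) = 1 - x^8" by (simp add: algebra_simps flip: power_add)
    ultimately show "1 - x^2 \<le> inverse (1 + x^2)" "inverse (1 + x^2) \<le> 1"
      "inverse (1 + x^2) \<le> 1 - x^2 + x^4" "1 - x^2 + x^4 - x^6 \<le> inverse (1 + x^2)"
      using p by (simp_all add: inverse_eq_divide pos_le_divide_eq pos_divide_le_eq)
  qed
  show "arctan x \<le> x - x^3/3 + x^5/5"
    by (rule le_of_deriv_le[where c = 0 and f = "arctan" and g = "\<lambda>x. x - x^3/3 + x^5/5" and f' = "\<lambda>x. inverse (1 + x^2)" and g' = "\<lambda>x. 1 - x^2 + x^4"])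
      (use assms geo in \<open>auto intro!: derivative_eq_intros\<close>)
  show "x - x^3/3 + x^5/5 - x^7/7 \<le> arctan x"
    by (rule le_of_deriv_le[where c = 0 and f = "\<lambda>x. x - x^3/3 + x^5/5 - x^7/7" and g = "arctan" and f' = "\<lambda>x. 1 - x^2 + x^4 - x^6" and g' = "\<lambda>x. inverse (1 + x^2)"])
      (use assms geo in \<open>auto intro!: derivative_eq_intros\<close>)
  show "x - x^3/3 \<le> arctan x"
    by (rule le_of_deriv_le[where c = 0 and f = "\<lambda>x. x - x^3/3" and g = "arctan" and f' = "\<lambda>x. 1 - x^2" and g' = "\<lambda>x. inverse (1 + x^2)"])
      (use assms geo in \<open>auto intro!: derivative_eq_intros\<close>)
  show "arctan x \<le> x"
    by (rule le_of_deriv_le[where c = 0 and f = "arctan" and g = "\<lambda>x. x" and f' = "\<lambda>x. inverse (1 + x^2)" and g' = "\<lambda>x. 1"])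
      (use assms geo in \<open>auto intro!: derivative_eq_intros\<close>)
qed

lemma pi_bounds: "(314159/100000) \<le> pi" "pi \<le> (314163/100000)"
  using machin arctan_bounds[of "1/5"] arctan_bounds[of "1/239"]
  by (simp_all add: power_divide)

lemma sqrt_2pi_bounds: "(25066/10000) \<le> sqrt (2 * pi)" "sqrt (2 * pi) \<le> (250665/100000)"
  using pi_bounds by (intro real_le_rsqrt real_le_lsqrt; simp add: power2_eq_square)+

text \<open>Integrate the Taylor polynomial of degree five of \<open>exp (- v)\<close> at \<open>v = t\<^sup>2
  / 2\<close>, which is a lower bound because the next term is positive.\<close>
lemma Phi_ge:
  assumes "0 \<le> a"
  shows "1/2 + (a - a^3/6 + a^5/40 - a^7/336 + a^9/3456 - a^11/42240) / sqrt (2 * pi) \<le> Phi a"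
proof -
  let ?p = "\<lambda>x::real. x - x^3/6 + x^5/40 - x^7/336 + x^9/3456 - x^11/42240"
  let ?p' = "\<lambda>x::real. 1 - x^2/2 + x^4/8 - x^6/48 + x^8/384 - x^10/3840"
  have p: "(?p has_real_derivative ?p' x) (at x)" for x
    by (auto intro!: derivative_eq_intros)
  have P: "((\<lambda>x. 1/2 + ?p x / sqrt (2 * pi)) has_real_derivative 0 + ?p' x / sqrt (2 * pi)) (at x)" for x
    by (intro DERIV_add DERIV_const DERIV_cdivide p)
  have le: "?p' x \<le> exp (- (x^2/2))" for x
    using exp_minus_ge[of "x^2/2"] by (simp add: power_divide flip: power_mult)
  show ?thesis
    by (rule le_of_deriv_le[where c = 0 and f = "\<lambda>x. 1/2 + ?p x / sqrt (2 * pi)" and g = "Phi" and f' = "\<lambda>x. 0 + ?p' x / sqrt (2 * pi)" and g' = "std_normal_density"])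
      (use assms P DERIV_Phi le in \<open>auto simp: Phi_0 std_normal_density_def divide_right_mono\<close>)
qed

lemma Phi_le:
  assumes "0 \<le> a"
  shows "Phi a \<le> 1/2 + (a - a^3/6 + a^5/40) / sqrt (2 * pi)"
proof -
  let ?p = "\<lambda>x::real. x - x^3/6 + x^5/40"
  let ?p' = "\<lambda>x::real. 1 - x^2/2 + x^4/8"
  have p: "(?p has_real_derivative ?p' x) (at x)" for x
    by (auto intro!: derivative_eq_intros)
  have P: "((\<lambda>x. 1/2 + ?p x / sqrt (2 * pi)) has_real_derivative 0 + ?p' x / sqrt (2 * pi)) (at x)" for x
    by (intro DERIV_add DERIV_const DERIV_cdivide p)
  have le: "exp (- (x^2/2)) \<le> ?p' x" for x
    using exp_minus_le[of "x^2/2"] by (simp add: power_divide flip: power_mult)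
  show ?thesis
    by (rule le_of_deriv_le[where c = 0 and f = "Phi" and g = "\<lambda>x. 1/2 + ?p x / sqrt (2 * pi)" and f' = "std_normal_density" and g' = "\<lambda>x. 0 + ?p' x / sqrt (2 * pi)"])
      (use assms P DERIV_Phi le in \<open>auto simp: Phi_0 std_normal_density_def divide_right_mono\<close>)
qed

abbreviation Jw :: "real \<Rightarrow> real" where "Jw \<equiv> J (29/32)"

text \<open>The point at which \<open>Phi\<close> takes the value \<open>1 / (2 * w)\<close> for \<open>w =
  29/32\<close>; it is about \<open>0.13002\<close>.\<close>
definition z0 :: real where "z0 = quantile (16/29)"

text \<open>The factor between the derivative of \<open>J\<close> and the quantile, namely \<open>1 / (2 * w *
  I (1 / (2 * w)))\<close>. Its square \<open>kappa\<close> is the constant in \<open>J * J'' = -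
  kappa\<close>.\<close>
definition r0 :: real where "r0 = 16 / (29 * gauss_profile (16/29))"

definition dJ :: "real \<Rightarrow> real" where "dJ x = r0 * quantile ((1 - x) * 32/29)"

abbreviation kappa :: real where "kappa \<equiv> r0\<^sup>2"

lemma z0_bounds: "(13/100) \<le> z0" "z0 \<le> (1301/10000)"
proof -
  have "Phi (13/100) \<le> 1/2 + ((13/100) - (13/100)^3/6 + (13/100)^5/40) / sqrt (2 * pi)" by (rule Phi_le) simp
  also have "((13/100) - (13/100)^3/6 + (13/100)^5/40) / sqrt (2 * pi) \<le> 3/58"
    using sqrt_2pi_bounds by (subst pos_divide_le_eq) (auto simp: power_divide)
  finally show "(13/100) \<le> z0" unfolding z0_def by (subst le_quantile_iff) simp_all
  have "3/58 \<le> ((1301/10000) - (1301/10000)^3/6 + (1301/10000)^5/40 - (1301/10000)^7/336 + (1301/10000)^9/3456 - (1301/10000)^11/42240) / sqrt (2 * pi)"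
    using sqrt_2pi_bounds by (subst pos_le_divide_eq) (auto simp: power_divide)
  moreover have "1/2 + ((1301/10000) - (1301/10000)^3/6 + (1301/10000)^5/40 - (1301/10000)^7/336 + (1301/10000)^9/3456 - (1301/10000)^11/42240) / sqrt (2 * pi) \<le> Phi (1301/10000)"
    by (rule Phi_ge) simp
  ultimately have "16/29 \<le> Phi (1301/10000)" by linarith
  then show "z0 \<le> (1301/10000)" unfolding z0_def by (subst quantile_le_iff) simp_all
qed

lemma exp_z0_bounds: "(100848/100000) \<le> exp (z0\<^sup>2 / 2)" "exp (z0\<^sup>2 / 2) \<le> (10085/10000)"
proof -
  have "(13/100)\<^sup>2 \<le> z0\<^sup>2" "z0\<^sup>2 \<le> (1301/10000)\<^sup>2"
    using z0_bounds by (auto intro!: power_mono)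
  then have z: "(845/100000) \<le> z0\<^sup>2 / 2" "z0\<^sup>2 / 2 \<le> (84631/10000000)" by (auto simp: power2_eq_square)
  have "(100848/100000) \<le> 1 + (845/100000) + (845/100000)\<^sup>2 / (2::real)" by (simp add: power2_eq_square)
  also have "\<dots> \<le> exp (845/100000)" by (rule exp_lower_Taylor_quadratic) simp
  also have "\<dots> \<le> exp (z0\<^sup>2 / 2)" using z by simp
  finally show "(100848/100000) \<le> exp (z0\<^sup>2 / 2)" .
  have "1 / (10085/10000) \<le> (1::real) - (84631/10000000) + (84631/10000000)^2/2 - (84631/10000000)^3/6 + (84631/10000000)^4/24 - (84631/10000000)^5/120"
    by (simp add: power_divide)
  also have "\<dots> \<le> exp (- (84631/10000000))" by (rule exp_minus_ge) simp
  finally have "exp (84631/10000000) \<le> ((10085/10000)::real)" by (simp add: exp_minus field_simps)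
  moreover have "exp (z0\<^sup>2 / 2) \<le> exp (84631/10000000)" using z by simp
  ultimately show "exp (z0\<^sup>2 / 2) \<le> (10085/10000)" by linarith
qed

lemma gauss_profile_z0: "gauss_profile (16/29) = 1 / (sqrt (2 * pi) * exp (z0\<^sup>2 / 2))"
  by (simp add: gauss_profile_quantile std_normal_density_def z0_def exp_minus field_simps)

lemma r0_bounds: "(13946/10000) \<le> r0" "r0 \<le> (13948/10000)"
proof -
  have r: "r0 = 16/29 * (sqrt (2 * pi) * exp (z0\<^sup>2 / 2))"
    by (simp add: r0_def gauss_profile_z0)
  have "(25066/10000) * (100848/100000) \<le> sqrt (2 * pi) * exp (z0\<^sup>2 / 2)"
    by (intro mult_mono sqrt_2pi_bounds exp_z0_bounds) auto
  then show "(13946/10000) \<le> r0" by (simp add: r)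
  have "sqrt (2 * pi) * exp (z0\<^sup>2 / 2) \<le> (250665/100000) * (10085/10000)"
    by (intro mult_mono sqrt_2pi_bounds exp_z0_bounds) auto
  then show "r0 \<le> (13948/10000)" by (simp add: r)
qed

text \<open>That \<open>kappa < 2\<close> is the second order condition for the two-point inequality at
  \<open>x = y\<close>.\<close>
lemma kappa_bounds: "(19449/10000) \<le> kappa" "kappa \<le> (19455/10000)"
proof -
  have "(13946/10000)\<^sup>2 \<le> kappa" "kappa \<le> (13948/10000)\<^sup>2"
    using r0_bounds by (auto intro!: power_mono)
  then show "(19449/10000) \<le> kappa" "kappa \<le> (19455/10000)" by (auto simp: power2_eq_square)
qed

lemma dJ_half_bounds: "(1812/10000) \<le> dJ (1/2)" "dJ (1/2) \<le> (1815/10000)"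
proof -
  have d: "dJ (1/2) = r0 * z0" by (simp add: dJ_def z0_def)
  have "(13946/10000) * (13/100) \<le> r0 * z0" "r0 * z0 \<le> (13948/10000) * (1301/10000)"
    using r0_bounds z0_bounds by (intro mult_mono; simp)+
  then show "(1812/10000) \<le> dJ (1/2)" "dJ (1/2) \<le> (1815/10000)" by (auto simp: d)
qed

lemma Jw_eq: "Jw x = r0 * (29/32) * gauss_profile ((1 - x) * 32/29)"
  by (simp add: J_def r0_def field_simps)

text \<open>In terms of the quantile, \<open>J\<close> is an explicit exponential; numerical bounds for
  \<open>J\<close> are bounds for quantiles.\<close>
lemma Jw_eq_exp:
  assumes "3/32 < x" "x < 1"
  shows "Jw x = exp (z0\<^sup>2 / 2 - (quantile ((1 - x) * 32/29))\<^sup>2 / 2) / 2"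
proof -
  let ?q = "quantile ((1 - x) * 32/29)"
  have "Jw x = 1/2 * (exp (z0\<^sup>2 / 2) * exp (- ?q\<^sup>2 / 2))"
    using assms
    by (simp add: J_def gauss_profile_z0 gauss_profile_quantile std_normal_density_def)
  also have "exp (z0\<^sup>2 / 2) * exp (- ?q\<^sup>2 / 2) = exp (z0\<^sup>2 / 2 - ?q\<^sup>2 / 2)"
    by (simp add: mult_exp_exp)
  finally show ?thesis by simp
qed

lemma Jw_half: "Jw (1/2) = 1/2"
  using gauss_profile_pos[of "16/29"] by (simp add: J_def)

lemma Jw_one: "Jw 1 = 0"
  by (simp add: J_def gauss_profile_def)

lemma Jw_pos: "3/32 < x \<Longrightarrow> x < 1 \<Longrightarrow> 0 < Jw x"
  by (simp add: Jw_eq_exp)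

lemma DERIV_Jw:
  assumes "3/32 < x" "x < 1"
  shows "(Jw has_real_derivative dJ x) (at x)"
proof -
  have "((\<lambda>x. r0 * (29/32) * gauss_profile ((1 - x) * 32/29)) has_real_derivative
      r0 * (29/32) * (- quantile ((1 - x) * 32/29) * (- (32/29)))) (at x)"
    by (intro DERIV_cmult DERIV_chain2[OF DERIV_gauss_profile])
      (use assms in \<open>auto intro!: derivative_eq_intros\<close>)
  then show ?thesis by (simp add: Jw_eq[abs_def] dJ_def)
qed

lemma DERIV_dJ:
  assumes "3/32 < x" "x < 1"
  shows "(dJ has_real_derivative - kappa / Jw x) (at x)"
proof -
  have pos: "0 < gauss_profile ((1 - x) * 32/29)" using assms by (intro gauss_profile_pos) auto
  have r: "0 < r0" using r0_bounds by linarith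
  have "((\<lambda>x. r0 * quantile ((1 - x) * 32/29)) has_real_derivative
      r0 * (inverse (gauss_profile ((1 - x) * 32/29)) * (- (32/29)))) (at x)"
    by (intro DERIV_cmult DERIV_chain2[OF DERIV_quantile])
      (use assms in \<open>auto intro!: derivative_eq_intros\<close>)
  also have "r0 * (inverse (gauss_profile ((1 - x) * 32/29)) * (- (32/29))) = - kappa / Jw x"
    using pos r by (simp add: Jw_eq field_simps power2_eq_square)
  finally show ?thesis by (simp add: dJ_def[abs_def])
qed

lemma Jw_le: "3/32 < x \<Longrightarrow> x < 1 \<Longrightarrow> Jw x \<le> (50425/100000)"
proof -
  assume x: "3/32 < x" "x < 1"
  have "exp (z0\<^sup>2 / 2 - (quantile ((1 - x) * 32/29))\<^sup>2 / 2) \<le> exp (z0\<^sup>2 / 2)" by simp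
  with exp_z0_bounds(2) have "exp (z0\<^sup>2 / 2 - (quantile ((1 - x) * 32/29))\<^sup>2 / 2) \<le> (10085/10000)"
    by (rule order.trans[rotated])
  then show ?thesis by (simp add: Jw_eq_exp[OF x])
qed

lemma dJ_strict_antimono:
  assumes "3/32 < x" "x < y" "y < 1"
  shows "dJ y < dJ x"
proof -
  have "0 < (1 - y) * 32/29" "(1 - x) * 32/29 < 1" "(1 - y) * 32/29 < (1 - x) * 32/29"
    using assms by auto
  then have "quantile ((1 - y) * 32/29) < quantile ((1 - x) * 32/29)"
    by (subst not_le[symmetric], subst quantile_le_iff) (auto simp: Phi_quantile)
  then show ?thesis using r0_bounds by (simp add: dJ_def)
qed

lemma continuous_Jw: "continuous_on {1/4..1} Jw"
  unfolding continuous_on_eq_continuous_within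
proof
  fix x :: real assume x: "x \<in> {1/4..1}"
  show "continuous (at x within {1/4..1}) Jw"
  proof (cases "x = 1")
    case False
    with x have "isCont Jw x" by (intro DERIV_isCont[OF DERIV_Jw]) auto
    then show ?thesis by (rule continuous_at_imp_continuous_at_within)
  next
    case True
    have "filterlim (\<lambda>x::real. (1 - x) * 32/29) (at_right 0) (at_left 1)"
      by real_asymp
    then have "((\<lambda>x. gauss_profile ((1 - x) * 32/29)) \<longlongrightarrow> 0) (at_left 1)"
      by (rule filterlim_compose[OF tendsto_gauss_profile_0])
    then have "((\<lambda>x. r0 * (29/32) * gauss_profile ((1 - x) * 32/29)) \<longlongrightarrow> r0 * (29/32) * 0) (at_left 1)"
      by (intro tendsto_intros)
    then have "(Jw \<longlongrightarrow> 0) (at_left 1)" by (simp add: Jw_eq[abs_def])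
    then have "(Jw \<longlongrightarrow> 0) (at 1 within {1/4..1})"
      by (simp add: at_within_Icc_at_left)
    then show ?thesis by (simp add: True continuous_within Jw_one)
  qed
qed

text \<open>A number \<open>a\<close> with \<open>Phi (- a) \<le> t\<close> bounds the quantile of \<open>t
  \<le> 1/2\<close> in absolute value.\<close>
lemma Jw_ge:
  assumes x: "1/2 \<le> x" "x < 1" "(1 - x) * 32/29 \<le> 1/2"
    and a: "0 \<le> a" "Phi (- a) \<le> (1 - x) * 32/29"
    and c: "0 \<le> v" "a\<^sup>2 / 2 - (845/100000) \<le> v"
      "2 * c \<le> 1 - v + v^2/2 - v^3/6 + v^4/24 - v^5/120"
  shows "c \<le> Jw x"
proof -
  let ?s = "quantile ((1 - x) * 32/29)"
  have "- a \<le> ?s" using a x by (subst le_quantile_iff) auto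
  moreover have "?s \<le> 0" using x by (subst quantile_le_iff) (auto simp: Phi_0)
  ultimately have "?s\<^sup>2 \<le> a\<^sup>2" by (intro power2_le_iff_abs_le[THEN iffD2]) (use a in auto)
  moreover have "(13/100)\<^sup>2 \<le> z0\<^sup>2" using z0_bounds by (intro power_mono) auto
  ultimately have "- v \<le> z0\<^sup>2 / 2 - ?s\<^sup>2 / 2" using c by (simp add: power2_eq_square)
  then have "exp (- v) \<le> exp (z0\<^sup>2 / 2 - ?s\<^sup>2 / 2)" by simp
  with exp_minus_ge[OF c(1)] c(3) have "2 * c \<le> exp (z0\<^sup>2 / 2 - ?s\<^sup>2 / 2)" by linarith
  then show ?thesis using x by (simp add: Jw_eq_exp)
qed

lemma Phi_minus_le:
  assumes "0 \<le> a" "t < 1/2" "(1/2 - t) * (250665/100000) \<le> a - a^3/6 + a^5/40 - a^7/336 + a^9/3456 - a^11/42240"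
  shows "Phi (- a) \<le> t"
proof -
  have "(1/2 - t) * sqrt (2 * pi) \<le> (1/2 - t) * (250665/100000)"
    using assms sqrt_2pi_bounds by (intro mult_left_mono) auto
  with assms(3) have "1/2 - t \<le> (a - a^3/6 + a^5/40 - a^7/336 + a^9/3456 - a^11/42240) / sqrt (2 * pi)"
    by (subst pos_le_divide_eq) auto
  with Phi_ge[OF assms(1)] show ?thesis by (simp add: Phi_minus)
qed

lemma Jw_values:
  "(4655/10000) \<le> Jw (11/16)" "(4223/10000) \<le> Jw (3/4)" "(3609/10000) \<le> Jw (13/16)" "(2783/10000) \<le> Jw (7/8)"
proof -
  have 1: "Phi (- (3994/10000)) \<le> 10/29" "Phi (- (5953/10000)) \<le> 8/29"
    "Phi (- (8173/10000)) \<le> 6/29" "Phi (- (10898/10000)) \<le> 4/29"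
    by (rule Phi_minus_le; simp add: power_divide)+
  show "(4655/10000) \<le> Jw (11/16)"
    by (rule Jw_ge[where a = "(3994/10000)" and v = "(714/10000)"]) (use 1 in \<open>simp_all add: power2_eq_square power_divide\<close>)
  show "(4223/10000) \<le> Jw (3/4)"
    by (rule Jw_ge[where a = "(5953/10000)" and v = "(1688/10000)"]) (use 1 in \<open>simp_all add: power2_eq_square power_divide\<close>)
  show "(3609/10000) \<le> Jw (13/16)"
    by (rule Jw_ge[where a = "(8173/10000)" and v = "(3256/10000)"]) (use 1 in \<open>simp_all add: power2_eq_square power_divide\<close>)
  show "(2783/10000) \<le> Jw (7/8)"
    by (rule Jw_ge[where a = "(10898/10000)" and v = "(5855/10000)"]) (use 1 in \<open>simp_all add: power2_eq_square power_divide\<close>)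
qed

text \<open>As \<open>J\<close> is at most \<open>0.50425\<close>, its second derivative \<open>- kappa /
  J\<close> is at most \<open>- 482/125\<close>.\<close>
lemma dJ_le_line:
  assumes "1/2 \<le> x" "x < 1"
  shows "dJ x \<le> dJ (1/2) - 482/125 * (x - 1/2)"
proof (rule le_of_deriv_le[where c = "1/2" and f = dJ and g = "\<lambda>x. dJ (1/2) - 482/125 * (x - 1/2)"
      and f' = "\<lambda>x. - kappa / Jw x" and g' = "\<lambda>x. - 482/125"])
  fix t assume "1/2 \<le> t" "t \<le> x"
  then have t: "3/32 < t" "t < 1" using assms by auto
  then show "(dJ has_real_derivative - kappa / Jw t) (at t)" by (rule DERIV_dJ)
  have "482/125 * Jw t \<le> kappa" using Jw_le[OF t] kappa_bounds by linarith
  then show "- kappa / Jw t \<le> - 482/125" using Jw_pos[OF t] by (simp add: field_simps)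
  show "((\<lambda>x. dJ (1/2) - 482/125 * (x - 1/2)) has_real_derivative - 482/125) (at t)"
    by (auto intro!: derivative_eq_intros)
qed (use assms in auto)

lemma Jw_le_parabola:
  assumes "1/2 \<le> x" "x < 1"
  shows "Jw x \<le> 1/2 + dJ (1/2) * (x - 1/2) - 241/125 * (x - 1/2)\<^sup>2"
proof (rule le_of_deriv_le[where c = "1/2" and f = Jw
      and g = "\<lambda>x. 1/2 + dJ (1/2) * (x - 1/2) - 241/125 * (x - 1/2)\<^sup>2" and f' = dJ and g' = "\<lambda>x. dJ (1/2) - 482/125 * (x - 1/2)"])
  fix t assume t: "1/2 \<le> t" "t \<le> x"
  then show "(Jw has_real_derivative dJ t) (at t)" using assms by (intro DERIV_Jw) auto
  show "dJ t \<le> dJ (1/2) - 482/125 * (t - 1/2)" using t assms by (intro dJ_le_line) auto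
  show "((\<lambda>x. 1/2 + dJ (1/2) * (x - 1/2) - 241/125 * (x - 1/2)\<^sup>2) has_real_derivative
      dJ (1/2) - 482/125 * (t - 1/2)) (at t)"
    by (auto intro!: derivative_eq_intros)
qed (use assms in \<open>auto simp: Jw_half\<close>)

text \<open>The difference starts with value and slope zero and is convex while \<open>J\<close> is above a
  threshold and concave afterwards. So its minimum on the interval is at one of the ends, and the
  right end is a numerical fact. If the difference were negative somewhere, two applications of the
  mean value theorem would give a point where it is concave to the left of a point where it is
  convex, which contradicts the unimodality of \<open>J\<close>.\<close>
lemma Jw_ge_parabola:
  assumes "1/2 \<le> x" "x \<le> 11/16"
  shows "1/2 + dJ (1/2) * (x - 1/2) - 39/20 * (x - 1/2)\<^sup>2 \<le> Jw x"
proof (rule ccontr)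
  define D where "D x = Jw x - (1/2 + dJ (1/2) * (x - 1/2) - 39/20 * (x - 1/2)\<^sup>2)" for x
  define D' where "D' x = dJ x - (dJ (1/2) - 39/10 * (x - 1/2))" for x
  have D: "(D has_real_derivative D' t) (at t)" if "1/2 \<le> t" "t \<le> 11/16" for t
    unfolding D_def[abs_def] D'_def using that
    by (auto intro!: derivative_eq_intros DERIV_Jw)
  have D': "(D' has_real_derivative 39/10 - kappa / Jw t) (at t)" if "1/2 \<le> t" "t \<le> 11/16" for t
    unfolding D'_def[abs_def] using that
    by (auto intro!: derivative_eq_intros DERIV_dJ)
  assume "\<not> ?thesis"
  then have neg: "D x < 0" by (simp add: D_def)
  have D0: "D (1/2) = 0" by (simp add: D_def Jw_half)
  have D1: "0 \<le> D (11/16)"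
    using Jw_values(1) dJ_half_bounds(2) by (simp add: D_def power2_eq_square)
  have x: "1/2 < x" "x < 11/16"
    using neg D0 D1 assms by (metis less_irrefl not_less order_le_less)+
  obtain u where u: "1/2 < u" "u < x" "D x - D (1/2) = (x - 1/2) * D' u"
    using MVT2[of "1/2" x D D'] D x by auto
  obtain v where v: "x < v" "v < 11/16" "D (11/16) - D x = (11/16 - x) * D' v"
    using MVT2[of x "11/16" D D'] D x by auto
  have "D' u < 0" using u neg D0 x by (simp add: mult_less_0_iff)
  moreover have "0 < D' v"
  proof -
    have "0 < (11/16 - x) * D' v" using v(3) neg D1 by linarith
    then show ?thesis using x by (simp add: zero_less_mult_iff)
  qed
  moreover have "D' (1/2) = 0" by (simp add: D'_def)
  moreover obtain p where p: "1/2 < p" "p < u" "D' u - D' (1/2) = (u - 1/2) * (39/10 - kappa / Jw p)"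
    using MVT2[of "1/2" u D' "\<lambda>t. 39/10 - kappa / Jw t"] D' u x by auto
  moreover obtain q where q: "u < q" "q < v" "D' v - D' u = (v - u) * (39/10 - kappa / Jw q)"
    using MVT2[of u v D' "\<lambda>t. 39/10 - kappa / Jw t"] D' u v x by auto
  ultimately have "(u - 1/2) * (39/10 - kappa / Jw p) < 0" "0 < (v - u) * (39/10 - kappa / Jw q)"
    by linarith+
  then have sg: "39/10 < kappa / Jw p" "kappa / Jw q < 39/10"
    using u v by (auto simp: mult_less_0_iff zero_less_mult_iff)
  have pos: "0 < Jw p" "0 < Jw q" using p q u v x by (auto intro!: Jw_pos)
  have Jp: "Jw p < 1/2" and Jq: "Jw p < Jw q"
    using sg pos kappa_bounds by (auto simp: field_simps)
  obtain w where w: "1/2 < w" "w < p" "Jw p - Jw (1/2) = (p - 1/2) * dJ w"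
    using MVT2[of "1/2" p Jw dJ] DERIV_Jw p u x by auto
  obtain w' where w': "p < w'" "w' < q" "Jw q - Jw p = (q - p) * dJ w'"
    using MVT2[of p q Jw dJ] DERIV_Jw p q u v x by auto
  have "(p - 1/2) * dJ w < 0" using w Jp by (simp add: Jw_half)
  then have "dJ w < 0" using p by (simp add: mult_less_0_iff)
  moreover have "0 < (q - p) * dJ w'" using w' Jq by simp
  then have "0 < dJ w'" using p q by (simp add: zero_less_mult_iff)
  moreover have "dJ w' < dJ w" using w w' q v by (intro dJ_strict_antimono) auto
  ultimately show False by simp
qed

section \<open>The branches L and Q\<close>

lemma sqrt2_bounds: "141421/100000 \<le> sqrt 2" "sqrt 2 \<le> 141422/100000"
  by (intro real_le_rsqrt real_le_lsqrt; simp add: power_divide)+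

lemma sqrt2_mult: "sqrt 2 * (sqrt 2 * x) = 2 * x"
  by (simp flip: mult.assoc)

text \<open>Minus a quarter of the third derivative of \<open>Q\<close>. The identity \<open>q3 = (1 - q3 /
  4)\<^sup>2\<close> makes the two-point inequality an equality at \<open>x = 0\<close>, \<open>y =
  1/2\<close>.\<close>
definition q3 :: real where "q3 = 12 - 8 * sqrt 2"

lemma q3_bounds: "6862/10000 \<le> q3" "q3 \<le> 6864/10000"
  using sqrt2_bounds by (simp_all add: q3_def)

lemma q3_eq: "(1 - q3 / 4)\<^sup>2 = q3"
  by (simp add: q3_def power2_eq_square field_simps sqrt2_mult)

lemma Q_eq: "Q x = 2/3 * x * (1 - x) * (12 * x - 3 + sqrt 2 * (4 - 8 * x))"
proof -
  have "(2::real) powr (5/2) = 2 powr (2 + 1/2)" by simp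
  then have 1: "(2::real) powr (5/2) = 4 * sqrt 2" by (simp only: powr_add powr_half_sqrt) simp
  have "(2::real) powr (3/2) = 2 powr (1 + 1/2)" by simp
  then have 2: "(2::real) powr (3/2) = 2 * sqrt 2" by (simp only: powr_add powr_half_sqrt) simp
  show ?thesis unfolding Q_def 1 2 by (simp add: algebra_simps)
qed

lemma Q_centered: "Q (1/2 - u) = 1/2 - q3/6 * u - 2 * u^2 + 2/3 * q3 * u^3"
  unfolding Q_eq q3_def by (simp add: field_simps power2_eq_square power3_eq_cube)

lemma Q_half: "Q (1/2) = 1/2"
  using Q_centered[of 0] by simp

lemma Q_quarter: "Q (1/4) = sqrt 2 / 4"
  by (simp add: Q_eq)

text \<open>Half of the sum of \<open>2 * Q m - Q (m - h)\<close> and \<open>Q (m + h)\<close> at \<open>m =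
  1/2 - d\<close>; the terms quadratic in \<open>h\<close> cancel.\<close>
definition Q_secant :: "real \<Rightarrow> real \<Rightarrow> real" where
  "Q_secant d h = 1/2 - q3/6 * d - 2 * d^2 + 2/3 * q3 * d^3 + (q3/6 + 4 * d - 2 * q3 * d^2) * h - 2/3 * q3 * h^3"

text \<open>A difference of squares: with \<open>N = 2 * Q m - Q (m - h)\<close> and \<open>X = Q (m +
  h)\<close>, the difference \<open>N - X\<close> keeps only the even part in \<open>h\<close> of a
  cubic, that is a multiple of \<open>h\<^sup>2\<close>.\<close>
lemma Q_gap:
  "(2 * Q (1/2 - d) - Q (1/2 - (d + h)))\<^sup>2 = (Q (1/2 - (d - h)))\<^sup>2 + 8 * (1 - q3 * d) * h\<^sup>2 * Q_secant d h"
proof -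
  let ?N = "2 * Q (1/2 - d) - Q (1/2 - (d + h))" and ?X = "Q (1/2 - (d - h))"
  have "?N - ?X = 4 * (1 - q3 * d) * h\<^sup>2" "?N + ?X = 2 * Q_secant d h"
    unfolding Q_centered Q_secant_def by (simp_all add: field_simps power2_eq_square power3_eq_cube)
  moreover have "?N\<^sup>2 = ?X\<^sup>2 + (?N - ?X) * (?N + ?X)"
    by (simp add: algebra_simps power2_eq_square)
  ultimately show ?thesis by simp
qed

text \<open>The case \<open>y = 1/2\<close>. It amounts to \<open>4 * d * (1 - q3 * d)\<^sup>2 \<le>
  q3\<close>, with equality at \<open>d = 1/4\<close>, that is at \<open>x = 0\<close>: there both
  sides of the two-point inequality are attained by subcubes.\<close>
lemma Q_secant_diagonal:
  assumes "0 \<le> d" "d \<le> 1/4"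
  shows "2 * (1 - q3 * d) * Q_secant d d \<le> 1"
proof -
  define e c where "e = 1/4 - d" and "c = 1 - q3 / 4"
  have e: "0 \<le> e" "e \<le> 1/4" "d = 1/4 - e" using assms by (auto simp: e_def)
  have c: "0 \<le> c" "c \<le> 1" "q3 = c\<^sup>2" using q3_bounds q3_eq by (auto simp: c_def)
  have "2 * (1 - q3 * d) * Q_secant d d = 1 - d * (q3 - 4 * d * (1 - q3 * d)\<^sup>2)"
    unfolding Q_secant_def by (simp add: field_simps power2_eq_square power3_eq_cube)
  moreover have "4 * d * (1 - q3 * d)\<^sup>2 \<le> q3"
  proof -
    have "1 - q3 * d = c + q3 * e" by (simp add: e(3) c_def algebra_simps)
    then have eq: "1 - q3 * d = c * (1 + c * e)"
      by (simp add: c(3) algebra_simps power2_eq_square)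
    have "(1 + c * e)\<^sup>2 * (1 - 4 * e) \<le> 1"
    proof -
      have "c * e \<le> e" using c e by (simp add: mult_left_le_one_le)
      then have "(1 + c * e)\<^sup>2 \<le> (1 + e)\<^sup>2" using c e by (intro power_mono) auto
      then have "(1 + c * e)\<^sup>2 * (1 - 4 * e) \<le> (1 + e)\<^sup>2 * (1 - 4 * e)"
        using e by (intro mult_right_mono) auto
      also have "\<dots> = 1 - 2 * e - 7 * e\<^sup>2 - 4 * e\<^sup>2 * e" by (simp add: algebra_simps power2_eq_square)
      also have "\<dots> \<le> 1"
        using e mult_nonneg_nonneg[of "4 * e\<^sup>2" e] zero_le_power2[of e] by linarith
      finally show ?thesis .
    qed
    then have "c\<^sup>2 * ((1 + c * e)\<^sup>2 * (1 - 4 * e)) \<le> c\<^sup>2 * 1" by (intro mult_left_mono) auto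
    moreover have "4 * d * (1 - q3 * d)\<^sup>2 = c\<^sup>2 * ((1 + c * e)\<^sup>2 * (1 - 4 * e))"
      unfolding eq power_mult_distrib[of c] by (simp add: e(3) algebra_simps)
    ultimately show ?thesis using c(3) by simp
  qed
  then have "0 \<le> d * (q3 - 4 * d * (1 - q3 * d)\<^sup>2)" using assms by simp
  ultimately show ?thesis by simp
qed

lemma Q_secant_mono:
  assumes "0 \<le> h" "h \<le> d" "d \<le> 1/4"
  shows "Q_secant d h \<le> Q_secant d d"
proof -
  have "q3 * (d * d) \<le> 1 * (d * (1/4))" using q3_bounds assms by (intro mult_mono) auto
  moreover have "q3 * (d * h) \<le> q3 * (d * d)" "q3 * (h * h) \<le> q3 * (d * d)"
    using q3_bounds assms by (auto intro!: mult_left_mono mult_mono)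
  ultimately have "0 \<le> q3/6 + 4 * d - 2 * (q3 * (d * d)) - 2/3 * (q3 * (d * d) + q3 * (d * h) + q3 * (h * h))"
    using q3_bounds assms unfolding distrib_left by linarith
  then have "0 \<le> (d - h) * (q3/6 + 4 * d - 2 * (q3 * (d * d)) - 2/3 * (q3 * (d * d) + q3 * (d * h) + q3 * (h * h)))"
    using assms by simp
  also have "\<dots> = Q_secant d d - Q_secant d h"
    unfolding Q_secant_def by (simp add: field_simps power2_eq_square power3_eq_cube)
  finally show ?thesis by simp
qed

text \<open>Here \<open>x = 1/2 - (d + h)\<close> may go down to zero, so this also covers points with
  \<open>x \<le> 1/4\<close>, where \<open>L\<close> is above \<open>Q\<close>.\<close>
lemma Q_two_point:
  assumes "0 \<le> h" "h \<le> d" "d \<le> 1/4"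
  shows "(2 * Q (1/2 - d) - Q (1/2 - (d + h)))\<^sup>2 \<le> (Q (1/2 - (d - h)))\<^sup>2 + 4 * h\<^sup>2"
proof -
  have pos: "0 \<le> 1 - q3 * d"
    using mult_mono[of q3 1 d "1/4"] q3_bounds assms by simp
  have "2 * (1 - q3 * d) * Q_secant d h \<le> 2 * (1 - q3 * d) * Q_secant d d"
    using Q_secant_mono[OF assms] pos by (intro mult_left_mono) auto
  also have "\<dots> \<le> 1" using assms by (intro Q_secant_diagonal) auto
  finally have "4 * h\<^sup>2 * (2 * (1 - q3 * d) * Q_secant d h) \<le> 4 * h\<^sup>2 * 1"
    by (intro mult_left_mono) auto
  then show ?thesis unfolding Q_gap by (simp add: algebra_simps)
qed

lemma ln2_bounds: "2/3 \<le> ln (2::real)" "ln (2::real) \<le> 25/36" "0 < ln (2::real)"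
  using ln2_ge_two_thirds ln2_le_25_over_36 by auto

lemma L_0 [simp]: "L 0 = 0" by (simp add: L_def)

lemma L_eq: "0 < x \<Longrightarrow> L x = x * sqrt (log 2 (1 / x))" by (simp add: L_def)

lemma L_power: "L (1 / 2 ^ k) = sqrt k / 2 ^ k"
proof -
  have "log 2 (2 ^ k) = real k" by (simp add: log_nat_power)
  then show ?thesis by (simp add: L_def)
qed

text \<open>Rationalising, \<open>sqrt M - sqrt (M - a) \<le> a * sqrt M / (2 * M - a)\<close> and \<open>sqrt
  (M + g) - sqrt M \<ge> 2 * g * sqrt M / (4 * M + g)\<close>; the hypothesis compares these two
  bounds. It gets weaker as \<open>M\<close> grows.\<close>
lemma sqrt_weighted_mean_le:
  fixes M a g t :: real
  assumes M: "0 < M" "a \<le> M" and g: "0 \<le> g" and t: "0 \<le> t"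
    and le: "0 < a \<Longrightarrow> a * g * (t + 1/2) \<le> 2 * (t * g - a) * M"
  shows "(1 + t) * sqrt M \<le> sqrt (M - a) + t * sqrt (M + g)"
proof (cases "0 < a")
  case False
  then have "sqrt M \<le> sqrt (M - a)" "t * sqrt M \<le> t * sqrt (M + g)"
    using g t by (auto intro!: mult_left_mono)
  then show ?thesis unfolding distrib_right by linarith
next
  case True
  have p: "0 < 2 * M - a" "0 < 4 * M + g" using M True g by auto
  have A: "sqrt M * (2 * (M - a) / (2 * M - a)) \<le> sqrt (M - a)"
  proof (rule real_le_rsqrt)
    have "(sqrt M * (2 * (M - a) / (2 * M - a)))\<^sup>2 = 4 * M * (M - a) * (M - a) / (2 * M - a)\<^sup>2"
      using M by (simp add: power_mult_distrib power_divide) (simp add: power2_eq_square algebra_simps)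
    also have "\<dots> \<le> (2 * M - a)\<^sup>2 * (M - a) / (2 * M - a)\<^sup>2"
    proof -
      have "4 * M * (M - a) \<le> (2 * M - a)\<^sup>2" by (simp add: power2_eq_square algebra_simps)
      then show ?thesis using M by (intro divide_right_mono mult_right_mono) auto
    qed
    also have "\<dots> = M - a" using p by simp
    finally show "(sqrt M * (2 * (M - a) / (2 * M - a)))\<^sup>2 \<le> M - a" .
  qed
  have C: "sqrt M * ((4 * M + 3 * g) / (4 * M + g)) \<le> sqrt (M + g)"
  proof (rule real_le_rsqrt)
    have "(sqrt M * ((4 * M + 3 * g) / (4 * M + g)))\<^sup>2 = M * (4 * M + 3 * g)\<^sup>2 / (4 * M + g)\<^sup>2"
      using M by (simp add: power_mult_distrib power_divide)
    also have "\<dots> \<le> (4 * M + g)\<^sup>2 * (M + g) / (4 * M + g)\<^sup>2"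
    proof -
      have "(4 * M + g)\<^sup>2 * (M + g) = M * (4 * M + 3 * g)\<^sup>2 + g^3"
        by (simp add: power2_eq_square power3_eq_cube algebra_simps)
      then show ?thesis using g by (intro divide_right_mono) auto
    qed
    also have "\<dots> = M + g" using p by simp
    finally show "(sqrt M * ((4 * M + 3 * g) / (4 * M + g)))\<^sup>2 \<le> M + g" .
  qed
  have "1 + t \<le> 2 * (M - a) / (2 * M - a) + t * ((4 * M + 3 * g) / (4 * M + g))"
  proof -
    have "a * (4 * M + g) \<le> t * (2 * g) * (2 * M - a)" using le[OF True] by (simp add: algebra_simps)
    then have "a / (2 * M - a) \<le> t * (2 * g) / (4 * M + g)" using p by (simp add: divide_simps mult.commute)
    moreover have "2 * (M - a) / (2 * M - a) = 1 - a / (2 * M - a)"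
      "(4 * M + 3 * g) / (4 * M + g) = 1 + 2 * g / (4 * M + g)"
      using p by (simp_all add: field_simps)
    ultimately show ?thesis by (simp add: algebra_simps)
  qed
  then have "(1 + t) * sqrt M \<le> sqrt M * (2 * (M - a) / (2 * M - a)) + t * (sqrt M * ((4 * M + 3 * g) / (4 * M + g)))"
    using mult_right_mono[of "1 + t" "2 * (M - a) / (2 * M - a) + t * ((4 * M + 3 * g) / (4 * M + g))" "sqrt M"] M
    by (simp add: algebra_simps)
  also have "\<dots> \<le> sqrt (M - a) + t * sqrt (M + g)"
    using A C t by (intro add_mono mult_left_mono) auto
  finally show ?thesis .
qed

lemma ln_one_plus_ge:
  assumes "0 \<le> (t::real)" shows "2 * t / (2 + t) \<le> ln (1 + t)"
proof (rule le_of_deriv_le[where c = 0 and f = "\<lambda>t. 2 * t / (2 + t)" and g = "\<lambda>t. ln (1 + t)"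
      and f' = "\<lambda>t. 4 / (2 + t)\<^sup>2" and g' = "\<lambda>t. 1 / (1 + t)"])
  fix x :: real assume x: "0 \<le> x"
  then show "((\<lambda>t. 2 * t / (2 + t)) has_real_derivative 4 / (2 + x)\<^sup>2) (at x)"
    by (auto intro!: derivative_eq_intros simp: power2_eq_square)
  show "((\<lambda>t. ln (1 + t)) has_real_derivative 1 / (1 + x)) (at x)"
    using x by (auto intro!: derivative_eq_intros)
  have "4 * (1 + x) \<le> (2 + x)\<^sup>2" by (simp add: power2_eq_square algebra_simps)
  then show "4 / (2 + x)\<^sup>2 \<le> 1 / (1 + x)" using x by (simp add: divide_simps)
qed (use assms in auto)

lemma ln_one_plus_le:
  assumes "0 \<le> (z::real)" shows "ln (1 + z) \<le> z - z^2/2 + z^3/3"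
proof (rule le_of_deriv_le[where c = 0 and g = "\<lambda>z. z - z^2/2 + z^3/3" and f = "\<lambda>t. ln (1 + t)"
      and g' = "\<lambda>z. 1 - z + z^2" and f' = "\<lambda>t. 1 / (1 + t)"])
  fix x :: real assume x: "0 \<le> x"
  show "((\<lambda>z. z - z^2/2 + z^3/3) has_real_derivative 1 - x + x^2) (at x)"
    by (auto intro!: derivative_eq_intros)
  show "((\<lambda>t. ln (1 + t)) has_real_derivative 1 / (1 + x)) (at x)"
    using x by (auto intro!: derivative_eq_intros)
  have "(1 - x + x^2) * (1 + x) = 1 + x^3" by (simp add: power2_eq_square power3_eq_cube algebra_simps)
  then show "1 / (1 + x) \<le> 1 - x + x^2" using x by (simp add: pos_divide_le_eq)
qed (use assms in auto)

lemma ln_one_minus_le: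
  assumes "0 \<le> (z::real)" "z < 1" shows "z + z^2/2 \<le> - ln (1 - z)"
proof (rule le_of_deriv_le[where c = 0 and f = "\<lambda>z. z + z^2/2" and g = "\<lambda>t. - ln (1 - t)"
      and f' = "\<lambda>z. 1 + z" and g' = "\<lambda>t. 1 / (1 - t)"])
  fix x :: real assume x: "0 \<le> x" "x \<le> z"
  show "((\<lambda>z. z + z^2/2) has_real_derivative 1 + x) (at x)"
    by (auto intro!: derivative_eq_intros)
  show "((\<lambda>t. - ln (1 - t)) has_real_derivative 1 / (1 - x)) (at x)"
    using x assms by (auto intro!: derivative_eq_intros)
  have "(1 + x) * (1 - x) \<le> 1" by (simp add: algebra_simps)
  then show "1 + x \<le> 1 / (1 - x)" using x assms by (simp add: pos_le_divide_eq)
qed (use assms in auto)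

text \<open>What remains for \<open>t \<ge> 1/2\<close> after the logarithms are replaced by rational bounds,
  where \<open>z = (1 - t) / (1 + t)\<close> is the small parameter and \<open>k\<close> stands for
  \<open>1 / ln 2\<close>. Both sides vanish to second order at \<open>z = 0\<close>.\<close>
lemma L_two_point_algebra:
  fixes z k t A G :: real
  assumes z: "0 \<le> z" "z \<le> 1/3" and k: "36/25 \<le> k" "k \<le> 3/2" and t: "t = (1 - z) / (1 + z)"
    and A: "0 < A" "A \<le> k * (z - z^2/2 + z^3/3) - (1 - t)\<^sup>2" and G: "k * (z + z^2/2) \<le> G"
  shows "A * G * (t + 1/2) \<le> 2 * (t * G - A)"
proof -
  define al where "al = k * (1 - z/2 + z^2/3) - 4 * z * (1 - 2 * z + 2 * z^2)"
  have one: "1 - t = 2 * z / (1 + z)" "t * (1 + z) = 1 - z" "(t + 1/2) * (1 + z) = (3 - z) / 2"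
    using z by (simp_all add: t field_simps)
  have z2: "z * z \<le> z * (1/3)" using z by (intro mult_left_mono) auto
  have zz: "0 \<le> z^2" "z^2 \<le> z/3" "z^2 \<le> 1/9" using z2 z by (auto simp: power2_eq_square)
  have inv: "1 - 2 * z + 2 * z^2 \<le> 1 / (1 + z)\<^sup>2"
  proof -
    have "(1 - 2 * z + 2 * z^2) * (1 + z)\<^sup>2 = 1 - z^2 * (1 - 2 * z - 2 * z^2)"
      by (simp add: algebra_simps power2_eq_square)
    moreover have "0 \<le> z^2 * (1 - 2 * z - 2 * z^2)" using zz z by (intro mult_nonneg_nonneg) auto
    ultimately show ?thesis using z by (subst pos_le_divide_eq) auto
  qed
  have Aal: "A \<le> z * al"
  proof -
    have "4 * z^2 * (1 - 2 * z + 2 * z^2) \<le> 4 * z^2 * (1 / (1 + z)\<^sup>2)"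
      using inv by (intro mult_left_mono) auto
    moreover have "(1 - t)\<^sup>2 = 4 * z^2 * (1 / (1 + z)\<^sup>2)"
      unfolding one(1) by (simp add: power_divide power_mult_distrib)
    moreover have "z - z^2/2 + z^3/3 = z * (1 - z/2 + z^2/3)"
      "z * al = k * (z * (1 - z/2 + z^2/3)) - 4 * z^2 * (1 - 2 * z + 2 * z^2)"
      by (simp_all add: al_def algebra_simps power2_eq_square power3_eq_cube)
    moreover have "k * (z - z^2/2 + z^3/3) = k * (z * (1 - z/2 + z^2/3))" using calculation by simp
    ultimately show ?thesis using A(2) by linarith
  qed
  have "0 < z * al" using A(1) Aal by linarith
  then have al: "0 < al" using z by (simp add: zero_less_mult_iff)
  have al1: "al \<le> 3/2 - 19/4 * z + 17/2 * z^2 - 8 * z^3"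
  proof -
    have "k * (1 - z/2 + z^2/3) \<le> 3/2 * (1 - z/2 + z^2/3)"
      using z zz k by (intro mult_right_mono) auto
    then show ?thesis by (simp add: al_def algebra_simps power2_eq_square power3_eq_cube)
  qed
  have al_le: "al \<le> 3/2"
  proof -
    have "0 \<le> z^3" using z by simp
    then show ?thesis using al1 zz z by linarith
  qed
  have tpos: "1/2 \<le> t" "t \<le> 1" using z by (auto simp: t field_simps)
  have coef: "0 \<le> 2 * t - A * (t + 1/2)"
  proof -
    have "A \<le> 1/3 * (3/2)" using Aal mult_mono[of z "1/3" al "3/2"] z al_le al by linarith
    then have "A * (t + 1/2) \<le> 1/2 * (t + 1/2)" using tpos by (intro mult_right_mono) auto
    then show ?thesis using tpos unfolding distrib_left by linarith
  qed
  define ga where "ga = k * (1 + z/2)"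
  have ga: "0 \<le> ga" using k z by (simp add: ga_def)
  have Gz: "z * ga \<le> G" using G by (simp add: ga_def algebra_simps power2_eq_square)
  have main: "2 * al * (1 + z) \<le> ga * (2 * (1 - z) - z * al * ((3 - z) / 2))"
  proof -
    have "ga * (3 - z) / 2 \<le> 19/8"
    proof -
      have "ga * (3 - z) = k * (3 + z/2 - z^2/2)"
        by (simp add: ga_def field_simps power2_eq_square)
      also have "\<dots> \<le> 3/2 * (19/6)"
        by (intro mult_mono; use z zz k in linarith)
      finally show ?thesis by simp
    qed
    then have "ga * (3 - z) / 2 * al \<le> 19/8 * al" using al by (intro mult_right_mono) auto
    also have "\<dots> \<le> 19/8 * (3/2 - 19/4 * z + 17/2 * z^2 - 8 * z^3)"
      using al1 by simp
    also have "\<dots> \<le> 8 - 8 * z + 16 * z^3 - 3 * (1 + z/3 + z^2/3)"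
    proof -
      \<comment> \<open>A square that almost touches the critical point of the cubic to be bounded.\<close>
      have "0 \<le> 35 * z * (z - 41/200)\<^sup>2" using z by (intro mult_nonneg_nonneg) auto
      then have "0 \<le> 35 * z^3 - 287/20 * z^2 + 11767/8000 * z"
        by (simp add: algebra_simps power2_eq_square power3_eq_cube)
      then show ?thesis using z zz by (simp add: algebra_simps)
    qed
    also have "\<dots> \<le> 8 - 8 * z + 16 * z^3 - 2 * k * (1 + z/3 + z^2/3)"
    proof -
      have "2 * k * (1 + z/3 + z^2/3) \<le> 3 * (1 + z/3 + z^2/3)"
        by (intro mult_right_mono; use z zz k in linarith)
      then show ?thesis by simp
    qed
    finally have "z * (ga * (3 - z) / 2 * al) \<le> z * (8 - 8 * z + 16 * z^3 - 2 * k * (1 + z/3 + z^2/3))"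
      using z by (intro mult_left_mono) auto
    also have "\<dots> = 2 * ga * (1 - z) - 2 * al * (1 + z)"
      by (simp add: ga_def al_def field_simps power2_eq_square power3_eq_cube)
    finally show ?thesis by (simp add: algebra_simps)
  qed
  have "2 * A * (1 + z) \<le> z * (2 * al * (1 + z))" using Aal z mult_right_mono[OF Aal, of "2 * (1 + z)"] by (simp add: algebra_simps)
  also have "\<dots> \<le> z * (ga * (2 * (1 - z) - z * al * ((3 - z) / 2)))"
    using main z by (intro mult_left_mono) auto
  also have "\<dots> \<le> z * (ga * (2 * (1 - z) - A * ((3 - z) / 2)))"
    using Aal z ga by (intro mult_left_mono diff_left_mono mult_right_mono) auto
  also have "\<dots> = z * ga * ((2 * t - A * (t + 1/2)) * (1 + z))"
  proof -
    have "(2 * t - A * (t + 1/2)) * (1 + z) = 2 * (t * (1 + z)) - A * ((t + 1/2) * (1 + z))"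
      by (simp add: algebra_simps)
    then show ?thesis unfolding one by simp
  qed
  also have "\<dots> \<le> G * ((2 * t - A * (t + 1/2)) * (1 + z))"
    using Gz coef z by (intro mult_right_mono) auto
  finally have "2 * A * (1 + z) \<le> (G * (2 * t - A * (t + 1/2))) * (1 + z)" by (simp add: mult.assoc)
  then have "2 * A \<le> G * (2 * t - A * (t + 1/2))" using z by (simp add: mult_le_cancel_right)
  then show ?thesis by (simp add: algebra_simps)
qed

text \<open>The hypothesis of \<open>sqrt_weighted_mean_le\<close> for the smallest possible value \<open>2 -
  p\<close> of \<open>M\<close>, which belongs to \<open>y = 1/2\<close>. Only for \<open>t\<close>
  near 1 do the bounds for the logarithms have to be of third order.\<close>
lemma L_two_point_log:
  fixes t p q :: real
  assumes t: "0 < t" "t < 1"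
  defines "q \<equiv> log 2 (1 / t)" and "p \<equiv> log 2 (1 + t)"
  defines "a \<equiv> 2 * t - t^2 - p"
  assumes a: "0 < a"
  shows "a * (q + p - 1) * (t + 1/2) \<le> 2 * (t * (q + p - 1) - a) * (2 - p)"
proof -
  define k where "k = 1 / ln (2::real)"
  have k: "36/25 \<le> k" "k \<le> 3/2" "k * ln 2 = 1" "0 < k"
    using ln2_bounds by (auto simp: k_def field_simps)
  have q: "q = - k * ln t" using t by (simp add: q_def k_def log_def ln_div)
  have p: "p = k * ln (1 + t)" by (simp add: p_def k_def log_def)
  show ?thesis
  proof (cases "t \<le> 1/2")
    case True
    have "ln t - ln (1/2) = ln (2 * t)" using t by (simp add: ln_mult ln_div)
    also have "\<dots> \<le> 2 * t - 1" using t by (intro ln_le_minus_one) auto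
    finally have "k * (ln t + ln 2) \<le> k * (2 * t - 1)" using k(4) by (intro mult_left_mono) (auto simp: ln_div)
    then have q1: "1 + k * (1 - 2 * t) \<le> q" using k(3) by (simp add: q algebra_simps)
    have "36/25 * (1 - 2 * t) \<le> k * (1 - 2 * t)" using True k by (intro mult_right_mono) auto
    with q1 have q2: "1 + 36/25 * (1 - 2 * t) \<le> q" by linarith
    have "4/5 * t \<le> 2 * t / (2 + t)" using t True by (simp add: field_simps)
    also have "\<dots> \<le> ln (1 + t)" using t by (intro ln_one_plus_ge) auto
    finally have "36/25 * (4/5 * t) \<le> k * ln (1 + t)" using k t by (intro mult_mono) auto
    then have p1: "144/125 * t \<le> p" by (simp add: p)
    have "k * ln (1 + t) \<le> 3/2 * t" using k t by (intro mult_mono ln_add_one_self_le_self) auto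
    then have p2: "p \<le> 3/4" using True by (simp add: p)
    have a1: "a \<le> t * (106/125 - t)" using p1 by (simp add: a_def algebra_simps power2_eq_square)
    define g0 where "g0 = 36/25 - 216/125 * t"
    have g: "g0 \<le> q + p - 1" using q2 p1 by (simp add: g0_def field_simps)
    have g0: "0 \<le> g0" using True by (simp add: g0_def)
    have tg: "0 \<le> 74/125 - 91/125 * t" using True by simp
    have coef: "0 \<le> 2 * t * (2 - p) - a * (t + 1/2)"
    proof -
      have "a * (t + 1/2) \<le> t * (106/125 - t) * (t + 1/2)" using a1 t by (intro mult_right_mono) auto
      also have "\<dots> \<le> t * (106/125) * 1" using t True by (intro mult_mono) auto
      also have "\<dots> \<le> 2 * t * (2 - 3/4)" using t by simp
      also have "\<dots> \<le> 2 * t * (2 - p)" using t p2 by (intro mult_left_mono) auto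
      finally show ?thesis by simp
    qed
    have "a * (g0 * (t + 1/2) + 2 * (2 - p)) \<le> (t * (106/125 - t)) * (g0 * (t + 1/2) + 2 * (2 - p))"
      using a1 g0 t p2 by (intro mult_right_mono) auto
    also have "\<dots> \<le> g0 * (2 * t * (2 - p))"
    proof -
      have "(106/125 - t) * (g0 * (t + 1/2)) \<le> 2 * (74/125 - 91/125 * t) * (5/4)"
      proof -
        have "4/5 - g0 * (t + 1/2) = 216/125 * (t - 1/6)\<^sup>2 + 4/125"
          by (simp add: g0_def field_simps power2_eq_square)
        moreover have "0 \<le> 216/125 * (t - 1/6)\<^sup>2" by simp
        ultimately have "g0 * (t + 1/2) \<le> 4/5" by linarith
        then have "(106/125 - t) * (g0 * (t + 1/2)) \<le> (106/125 - t) * (4/5)"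
          using True by (intro mult_left_mono) auto
        also have "\<dots> \<le> 2 * (74/125 - 91/125 * t) * (5/4)" using True by simp
        finally show ?thesis .
      qed
      also have "\<dots> \<le> 2 * (74/125 - 91/125 * t) * (2 - p)" using tg p2 by (intro mult_left_mono) auto
      finally have "t * ((106/125 - t) * (g0 * (t + 1/2))) \<le> t * (2 * (74/125 - 91/125 * t) * (2 - p))"
        using t by (intro mult_left_mono) auto
      moreover have "(t * (106/125 - t)) * (g0 * (t + 1/2) + 2 * (2 - p)) =
          t * ((106/125 - t) * (g0 * (t + 1/2))) + 2 * t * (106/125 - t) * (2 - p)"
        by (simp add: field_simps)
      moreover have "g0 = (106/125 - t) + (74/125 - 91/125 * t)" by (simp add: g0_def)
      then have "g0 * (2 * t * (2 - p)) = t * (2 * (74/125 - 91/125 * t) * (2 - p)) + 2 * t * (106/125 - t) * (2 - p)"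
        by (simp only: distrib_right) (simp only: ac_simps)
      ultimately show ?thesis by linarith
    qed
    finally have "2 * a * (2 - p) \<le> g0 * (2 * t * (2 - p) - a * (t + 1/2))" by (simp add: algebra_simps)
    also have "\<dots> \<le> (q + p - 1) * (2 * t * (2 - p) - a * (t + 1/2))"
      using g coef by (intro mult_right_mono)
    finally have "2 * a * (2 - p) \<le> (q + p - 1) * (2 * t * (2 - p) - a * (t + 1/2))" .
    moreover have "a * G * (t + 1/2) \<le> 2 * (t * G - a) * M"
      if "2 * a * M \<le> G * (2 * t * M - a * (t + 1/2))" for G M
      using that by (simp add: algebra_simps)
    ultimately show ?thesis by blast
  next
    case False
    define z where "z = (1 - t) / (1 + t)"
    have z: "0 \<le> z" "z \<le> 1/3" "z < 1" using t False by (auto simp: z_def field_simps)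
    have tz: "t = (1 - z) / (1 + z)" "1 + t = 2 / (1 + z)" using t by (auto simp: z_def field_simps)
    have p': "p = 1 - k * ln (1 + z)"
      using k(3) z unfolding p tz(2) by (simp add: ln_div algebra_simps)
    have q': "q = k * ln (1 + z) - k * ln (1 - z)"
      using z unfolding q by (subst tz(1)) (simp add: ln_div algebra_simps)
    have "k * ln (1 + z) \<le> k * (z - z^2/2 + z^3/3)"
      using ln_one_plus_le[OF z(1)] k by (intro mult_left_mono) auto
    then have A: "a \<le> k * (z - z^2/2 + z^3/3) - (1 - t)\<^sup>2"
      by (simp add: a_def p' power2_eq_square algebra_simps)
    have G: "k * (z + z^2/2) \<le> q + p - 1"
      using mult_left_mono[OF ln_one_minus_le[OF z(1,3)], of k] k by (simp add: q' p')
    have fin: "a * (q + p - 1) * (t + 1/2) \<le> 2 * (t * (q + p - 1) - a)"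
      by (rule L_two_point_algebra[OF z(1,2) k(1,2) tz(1) a A G])
    have "0 \<le> k * (z + z^2/2)" using z k by simp
    with G have G0: "0 \<le> q + p - 1" by linarith
    have "0 \<le> a * (q + p - 1) * (t + 1/2)" using a G0 t by simp
    with fin have T: "0 \<le> 2 * (t * (q + p - 1) - a)" by linarith
    have "1 \<le> 2 - p" using z k by (simp add: p')
    then have "2 * (t * (q + p - 1) - a) * 1 \<le> 2 * (t * (q + p - 1) - a) * (2 - p)"
      using T by (rule mult_left_mono)
    with fin show ?thesis by simp
  qed
qed

text \<open>With \<open>t = x / y\<close> and \<open>l = log 2 (1 / y)\<close>, everything is \<open>y\<close>
  times a square root of \<open>l\<close> plus a function of \<open>t\<close>. For \<open>x =
  0\<close> there is equality, which is the recursion for subcubes.\<close>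
lemma L_two_point:
  assumes "0 \<le> x" "x \<le> y" "y \<le> 1/2"
  shows "2 * L ((x + y) / 2) \<le> sqrt ((y - x)\<^sup>2 + (L y)\<^sup>2) + L x"
proof -
  consider "x = y" | "x = 0" "0 < y" | "0 < x" "x < y" using assms by fastforce
  then show ?thesis
  proof cases
    case 1
    then show ?thesis by simp
  next
    case 2
    have l: "0 \<le> log 2 (1 / y)" using 2 assms by (subst zero_le_log_cancel_iff) auto
    have "log 2 (2 / y) = 1 + log 2 (1 / y)" using 2 by (simp add: log_divide)
    then have "2 * L ((x + y) / 2) = y * sqrt (1 + log 2 (1 / y))" using 2 by (simp add: L_eq)
    also have "\<dots> = sqrt (y\<^sup>2 * (1 + log 2 (1 / y)))" using 2 by (simp add: real_sqrt_mult)
    also have "y\<^sup>2 * (1 + log 2 (1 / y)) = (y - x)\<^sup>2 + (L y)\<^sup>2"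
      using 2 l by (simp add: L_eq power_mult_distrib algebra_simps)
    finally show ?thesis using 2 by simp
  next
    case 3
    define t l where "t = x / y" and "l = log 2 (1 / y)"
    define q p where "q = log 2 (1 / t)" and "p = log 2 (1 + t)"
    define a where "a = 2 * t - t^2 - p"
    have t: "0 < t" "t < 1" "x = t * y" "0 < y" using 3 by (auto simp: t_def)
    have l: "1 \<le> l" unfolding l_def using t assms by (subst le_log_iff) (auto simp: field_simps)
    have p1: "0 \<le> p" "p \<le> 1" using t by (auto simp: p_def le_log_iff log_le_iff)
    have g: "0 \<le> q + p - 1"
    proof -
      have "q + p - 1 = log 2 ((1 + t) / (2 * t))"
        using t by (simp add: q_def p_def log_divide log_mult)
      also have "0 \<le> \<dots>" using t by (subst zero_le_log_cancel_iff) (auto simp: field_simps)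
      finally show ?thesis .
    qed
    have Lx: "L x = y * (t * sqrt ((l + 1 - p) + (q + p - 1)))"
      using t by (simp add: L_eq q_def l_def log_divide log_mult)
    have sq: "sqrt ((y - x)\<^sup>2 + (L y)\<^sup>2) = y * sqrt ((l + 1 - p) - a)"
    proof -
      have "(y - x)\<^sup>2 + (L y)\<^sup>2 = y\<^sup>2 * ((l + 1 - p) - a)"
        using t l by (simp add: L_eq l_def[symmetric] a_def power_mult_distrib algebra_simps power2_eq_square)
      then show ?thesis using t by (simp add: real_sqrt_mult)
    qed
    have Lm: "2 * L ((x + y) / 2) = y * ((1 + t) * sqrt (l + 1 - p))"
    proof -
      have e: "(x + y) / 2 = y * ((1 + t) / 2)" using t by (simp add: algebra_simps)
      have "log 2 (1 / (y * ((1 + t) / 2))) = l + 1 - p"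
        using t by (simp add: l_def p_def log_divide log_mult)
      moreover have "L (y * ((1 + t) / 2)) = y * ((1 + t) / 2) * sqrt (log 2 (1 / (y * ((1 + t) / 2))))"
        using t by (intro L_eq) auto
      ultimately show ?thesis unfolding e by simp
    qed
    have "(1 + t) * sqrt (l + 1 - p) \<le> sqrt ((l + 1 - p) - a) + t * sqrt ((l + 1 - p) + (q + p - 1))"
    proof (rule sqrt_weighted_mean_le)
      have "a = l + 1 - p - (l + (1 - t)\<^sup>2)" by (simp add: a_def power2_eq_square algebra_simps)
      moreover have "0 \<le> l + (1 - t)\<^sup>2" using l by simp
      ultimately show "a \<le> l + 1 - p" by linarith
      assume a: "0 < a"
      have le: "a * (q + p - 1) * (t + 1/2) \<le> 2 * (t * (q + p - 1) - a) * (2 - p)"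
        using L_two_point_log[OF t(1,2)] a by (simp only: a_def p_def q_def)
      have "0 \<le> a * (q + p - 1) * (t + 1/2)" using a g t by simp
      with le have "0 \<le> 2 * (t * (q + p - 1) - a) * (2 - p)" by linarith
      then have "0 \<le> 2 * (t * (q + p - 1) - a)" using p1 by (simp add: zero_le_mult_iff)
      then have "2 * (t * (q + p - 1) - a) * (2 - p) \<le> 2 * (t * (q + p - 1) - a) * (l + 1 - p)"
        using l by (intro mult_left_mono) auto
      with le show "a * (q + p - 1) * (t + 1/2) \<le> 2 * (t * (q + p - 1) - a) * (l + 1 - p)" by linarith
    qed (use l p1 g t in auto)
    from mult_left_mono[OF this, of y] show ?thesis
      unfolding Lx sq Lm using t by (simp add: algebra_simps)
  qed
qed

text \<open>The square of \<open>L x / x\<close> minus the square of \<open>Q x / x\<close>. It vanishes at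
  \<open>1/4\<close> and \<open>1/2\<close>, so convexity determines its sign.\<close>
lemma convex_log_minus_Q_ratio_sq:
  fixes lo :: real
  assumes lo: "0 < lo"
  shows "convex_on {lo..1/2} (\<lambda>x. - ln x / ln 2 - (2/3 * (1 - x) * (12 * x - 3 + sqrt 2 * (4 - 8 * x)))\<^sup>2)"
proof -
  define r r' where "r x = 2/3 * (1 - x) * (12 * x - 3 + sqrt 2 * (4 - 8 * x))"
    and "r' x = 2/3 * (15 - 12 * sqrt 2 - 2 * q3 * x)" for x
  have "convex_on {lo..1/2} (\<lambda>x. - ln x / ln 2 - (r x)\<^sup>2)"
  proof (rule f''_ge0_imp_convex)
  fix x assume x: "x \<in> {lo..1/2}"
  have r: "(r has_real_derivative r' x) (at x)"
    unfolding r_def[abs_def] r'_def by (auto intro!: derivative_eq_intros simp: q3_def field_simps)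
  have r': "(r' has_real_derivative - 4/3 * q3) (at x)"
    unfolding r'_def[abs_def] by (auto intro!: derivative_eq_intros)
  have D: "((\<lambda>x. (r x)\<^sup>2) has_real_derivative 2 * r x * r' x) (at x)"
    using DERIV_power[OF r, of 2] by (simp add: algebra_simps)
  have Ln: "((\<lambda>x. - ln x / ln 2) has_real_derivative - (1 / x) / ln 2) (at x)"
    using x lo by (auto intro!: derivative_eq_intros simp: field_simps)
  show "((\<lambda>x. - ln x / ln 2 - (r x)\<^sup>2) has_real_derivative - (1 / x) / ln 2 - 2 * r x * r' x) (at x)"
    by (rule DERIV_diff[OF Ln D])
  have "((\<lambda>x. r x * r' x) has_real_derivative r' x * r' x + (- 4/3 * q3) * r x) (at x)"
    by (rule DERIV_mult[OF r r'])
  then have D2: "((\<lambda>x. 2 * r x * r' x) has_real_derivative 2 * (r' x * r' x + (- 4/3 * q3) * r x)) (at x)"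
    using DERIV_cmult[of _ _ x UNIV 2] by (simp only: mult.assoc)
  have Ln2: "((\<lambda>x. - (1 / x) / ln 2) has_real_derivative (1 / x\<^sup>2) / ln 2) (at x)"
    using x lo by (auto intro!: derivative_eq_intros simp: field_simps power2_eq_square)
  show "((\<lambda>x. - (1 / x) / ln 2 - 2 * r x * r' x) has_real_derivative
      (1 / x\<^sup>2) / ln 2 - 2 * (r' x * r' x + (- 4/3 * q3) * r x)) (at x)"
    by (rule DERIV_diff[OF Ln2 D2])
  show "0 \<le> (1 / x\<^sup>2) / ln 2 - 2 * (r' x * r' x + (- 4/3 * q3) * r x)"
  proof -
    have x2: "0 < x\<^sup>2" "x\<^sup>2 \<le> 1/4" using x lo power_mono[of x "1/2" 2] by (auto simp: power_divide)
    have q3x: "0 \<le> q3 * x" using x lo q3_bounds by (intro mult_nonneg_nonneg) auto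
    have "(1 / x\<^sup>2) / ln 2 \<ge> 4 / (25/36)"
      using x2 ln2_bounds by (intro frac_le) (auto simp: field_simps)
    moreover have "- r' x = 8 * sqrt 2 - 10 + 4/3 * (q3 * x)" by (simp add: r'_def field_simps)
    moreover have "q3 * x \<le> 6864/10000 * (1/2)" using q3_bounds x lo by (intro mult_mono) auto
    ultimately have r'_bounds: "- r' x \<le> 178/100" "0 \<le> - r' x" "4 / (25/36) \<le> (1 / x\<^sup>2) / ln 2"
      using sqrt2_bounds q3x by linarith+
    then have "(- r' x) * (- r' x) \<le> 178/100 * (178/100)" by (intro mult_mono) auto
    moreover note r'_bounds(3)
    moreover have "1 \<le> r x"
    proof -
      have "r x - 1 = (1/2 - x) * (2/3) * (q3 * x + 12 * sqrt 2 - 15 + q3/2)"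
        by (simp add: r_def q3_def field_simps)
      moreover have "0 \<le> (1/2 - x) * (2/3) * (q3 * x + 12 * sqrt 2 - 15 + q3/2)"
      proof (rule mult_nonneg_nonneg)
        show "0 \<le> q3 * x + 12 * sqrt 2 - 15 + q3/2" using sqrt2_bounds q3_bounds q3x by linarith
      qed (use x in auto)
      ultimately show ?thesis by linarith
    qed
    then have "4/3 * q3 * 1 \<le> 4/3 * q3 * r x" using q3_bounds by (intro mult_left_mono) auto
    moreover have "0 \<le> X - 2 * R + 2 * T"
      if "R \<le> 178/100 * (178/100)" "4 / (25/36) \<le> X" "4/3 * q3 * 1 \<le> T" for X R T :: real
      using that q3_bounds by simp
    ultimately have "0 \<le> (1 / x\<^sup>2) / ln 2 - 2 * ((- r' x) * (- r' x)) + 2 * (4/3 * q3 * r x)" by blast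
    then show ?thesis by simp
  qed
  qed auto
  then show ?thesis by (simp add: r_def)
qed

lemma L_vs_Q:
  assumes "0 \<le> x" "x \<le> 1/2"
  shows "x \<le> 1/4 \<Longrightarrow> Q x \<le> L x" "1/4 \<le> x \<Longrightarrow> L x \<le> Q x"
proof -
  define r where "r x = 2/3 * (1 - x) * (12 * x - 3 + sqrt 2 * (4 - 8 * x))" for x
  define f where "f x = - ln x / ln 2 - (r x)\<^sup>2" for x :: real
  have Qr: "Q x = x * r x" for x by (simp add: Q_eq r_def)
  have r0: "0 \<le> r x"
  proof -
    have "0 \<le> 12 * x - 3 + sqrt 2 * (4 - 8 * x)"
      using mult_right_mono[OF sqrt2_bounds(1), of "4 - 8 * x"] assms by simp
    then show ?thesis using assms by (simp add: r_def)
  qed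
  have conv: "convex_on {lo..1/2} f" if "0 < lo" for lo
    using convex_log_minus_Q_ratio_sq[OF that] by (simp add: f_def[abs_def] r_def)
  have f1: "f (1/4) = 0" "f (1/2) = 0"
  proof -
    have "r (1/4) = sqrt 2" "r (1/2) = 1" by (simp_all add: r_def)
    moreover have "ln 4 = 2 * ln (2::real)" using ln_realpow[of 2 2] by simp
    ultimately show "f (1/4) = 0" "f (1/2) = 0" by (simp_all add: f_def ln_div)
  qed
  have Lf: "L x = x * sqrt (f x + (r x)\<^sup>2)" if "0 < x"
    using that by (simp add: L_eq f_def log_def ln_div)
  {
    assume x: "1/4 \<le> x"
    define u where "u = 2 - 4 * x"
    have u: "0 \<le> u" "u \<le> 1" using x assms by (auto simp: u_def)
    have "x = (1 - u) *\<^sub>R (1/2) + u *\<^sub>R (1/4)" by (simp add: u_def algebra_simps)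
    then have "f x \<le> (1 - u) * f (1/2) + u * f (1/4)"
      using convex_onD[OF conv[of "1/4"] u, of "1/2" "1/4"] by simp
    then have "sqrt (f x + (r x)\<^sup>2) \<le> r x" using r0 f1 by (intro real_le_lsqrt) auto
    then show "L x \<le> Q x" using x by (simp add: Lf Qr mult_left_mono)
  }
  {
    assume x: "x \<le> 1/4"
    show "Q x \<le> L x"
    proof (cases "x = 0")
      case True then show ?thesis by (simp add: Qr)
    next
      case False
      with assms have x0: "0 < x" by simp
      define u where "u = (1/4 - x) / (1/2 - x)"
      have u: "0 \<le> u" "u < 1" using x by (auto simp: u_def field_simps)
      have "u * (1/2 - x) = 1/4 - x" using x by (simp add: u_def)
      then have e: "(1 - u) *\<^sub>R x + u *\<^sub>R (1/2) = 1/4" by (simp add: algebra_simps)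
      have "f ((1 - u) *\<^sub>R x + u *\<^sub>R (1/2)) \<le> (1 - u) * f x + u * f (1/2)"
        by (rule convex_onD[OF conv[OF x0]]) (use u x in auto)
      then have "f (1/4) \<le> (1 - u) * f x + u * f (1/2)" unfolding e .
      then have "0 \<le> f x" using u f1 by (simp add: zero_le_mult_iff)
      then have "r x \<le> sqrt (f x + (r x)\<^sup>2)" by (intro real_le_rsqrt) auto
      then show ?thesis using x0 by (simp add: Lf Qr)
    qed
  }
qed

section \<open>Two-point inequalities involving the within_branch J\<close>

text \<open>The norm of \<open>(d, u)\<close> is attained by the unit vector in its direction.\<close>
lemma supporting_of_sqrt:
  assumes "0 \<le> d" "0 \<le> u" "N \<le> sqrt (d\<^sup>2 + u\<^sup>2)"
  shows "\<exists>c s. supporting c s \<and> N \<le> c * d + s * u"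
proof (cases "d\<^sup>2 + u\<^sup>2 = 0")
  case True
  then show ?thesis using assms supporting_unit_disc[of 0 0] by (intro exI[of _ 0]) auto
next
  case False
  define r where "r = sqrt (d\<^sup>2 + u\<^sup>2)"
  have "0 \<le> d\<^sup>2 + u\<^sup>2" by simp
  with False have "0 < d\<^sup>2 + u\<^sup>2" by linarith
  then have r: "0 < r" "r\<^sup>2 = d\<^sup>2 + u\<^sup>2" unfolding r_def by (simp_all only: real_sqrt_gt_0_iff real_sqrt_pow2 less_imp_le)
  have "(d / r)\<^sup>2 + (u / r)\<^sup>2 = (d\<^sup>2 + u\<^sup>2) / r\<^sup>2" by (simp add: power_divide add_divide_distrib)
  also have "\<dots> = 1" using r by (simp flip: r(2))
  finally have sup: "supporting (d / r) (u / r)" using assms r by (intro supporting_unit_disc) auto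
  have "d / r * d + u / r * u = r\<^sup>2 / r"
    using r(2) by (simp add: power2_eq_square add_divide_distrib)
  moreover have "r\<^sup>2 / r = r" using r(1) by (simp add: power2_eq_square)
  moreover have "N \<le> r" using assms(3) unfolding r_def .
  ultimately have "N \<le> d / r * d + u / r * u" by simp
  with sup show ?thesis by blast
qed

text \<open>As a function of \<open>h\<close>, the difference of the two sides vanishes to second order at
  \<open>h = 0\<close>; half of its second derivative is \<open>J'(m + h)\<^sup>2 - J'(m -
  h)\<^sup>2 + 4 - 2 * kappa * J m / J (m - h)\<close> by the equation \<open>J * J'' = -
  kappa\<close>. Where \<open>J\<close> decreases on the right of \<open>m - h\<close> this is at
  least \<open>4 - 2 * kappa\<close>. On the short increasing stretch after \<open>1/2\<close>,
  \<open>J\<close> is nearly constant, and numerical bounds suffice.\<close>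
lemma Jw_two_point_open:
  assumes m: "0 \<le> a" "1/2 \<le> m - a" "m + a < 1"
  shows "(2 * Jw m - Jw (m - a))\<^sup>2 \<le> (Jw (m + a))\<^sup>2 + 4 * a\<^sup>2"
proof -
  define R where "R h = Jw (m + h) * dJ (m + h) + 4 * h - (2 * Jw m - Jw (m - h)) * dJ (m - h)" for h
  define R' where "R' h = (dJ (m + h))\<^sup>2 - (dJ (m - h))\<^sup>2 + 4 - 2 * (kappa * Jw m / Jw (m - h))" for h
  have dom: "3/32 < m + h" "m + h < 1" "3/32 < m - h" "m - h < 1" "1/2 \<le> m - h" if "0 \<le> h" "h \<le> a" for h
    using that m by auto
  have Jp: "((\<lambda>h. Jw (m + h)) has_real_derivative dJ (m + h)) (at h)"
    and dJp: "((\<lambda>h. dJ (m + h)) has_real_derivative - kappa / Jw (m + h)) (at h)"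
    and Jm: "((\<lambda>h. Jw (m - h)) has_real_derivative - dJ (m - h)) (at h)"
    and dJm: "((\<lambda>h. dJ (m - h)) has_real_derivative kappa / Jw (m - h)) (at h)"
    if h: "0 \<le> h" "h \<le> a" for h
  proof -
    have p: "((\<lambda>h. m + h) has_real_derivative 1) (at h)" and n: "((\<lambda>h. m - h) has_real_derivative - 1) (at h)"
      by (auto intro!: derivative_eq_intros)
    show "((\<lambda>h. Jw (m + h)) has_real_derivative dJ (m + h)) (at h)"
      using DERIV_chain2[OF DERIV_Jw p] dom[OF h] by simp
    show "((\<lambda>h. dJ (m + h)) has_real_derivative - kappa / Jw (m + h)) (at h)"
      using DERIV_chain2[OF DERIV_dJ p] dom[OF h] by simp
    show "((\<lambda>h. Jw (m - h)) has_real_derivative - dJ (m - h)) (at h)"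
      using DERIV_chain2[OF DERIV_Jw n] dom[OF h] by simp
    show "((\<lambda>h. dJ (m - h)) has_real_derivative kappa / Jw (m - h)) (at h)"
      using DERIV_chain2[OF DERIV_dJ n] dom[OF h] by simp
  qed
  have R: "(R has_real_derivative R' h) (at h)" if h: "0 \<le> h" "h \<le> a" for h
  proof -
    have pos: "0 < Jw (m + h)" "0 < Jw (m - h)" using dom[OF h] by (auto intro: Jw_pos)
    show ?thesis
      unfolding R_def[abs_def]
      by (rule derivative_eq_intros Jp[OF h] dJp[OF h] Jm[OF h] dJm[OF h] refl)+
        (use pos in \<open>simp add: R'_def field_simps power2_eq_square\<close>)
  qed
  have R'_nonneg: "0 \<le> R' h" if h: "0 \<le> h" "h \<le> a" for h
  proof (cases "dJ (m - h) \<le> 0")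
    case True
    have d: "dJ (m + h) \<le> dJ (m - h)"
      using dJ_strict_antimono[of "m - h" "m + h"] dom[OF h] h by (cases "h = 0") auto
    have "Jw m \<le> Jw (m - h)"
    proof (rule DERIV_nonpos_imp_nonincreasing[where f = Jw])
      fix t assume t: "m - h \<le> t" "t \<le> m"
      have "dJ t \<le> dJ (m - h)"
        using dJ_strict_antimono[of "m - h" t] dom[OF h] h t by (cases "t = m - h") auto
      then show "\<exists>y. (Jw has_real_derivative y) (at t) \<and> y \<le> 0"
        using t dom[OF h] h True by (intro exI[of _ "dJ t"] conjI DERIV_Jw) auto
    qed (use h in auto)
    moreover have pos: "0 < Jw (m - h)" using dom[OF h] by (auto intro: Jw_pos)
    ultimately have "kappa * Jw m / Jw (m - h) \<le> kappa"
      by (simp add: pos_divide_le_eq mult_left_mono)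
    moreover have "(dJ (m - h))\<^sup>2 \<le> (dJ (m + h))\<^sup>2"
      using d True by (simp add: abs_le_square_iff[symmetric])
    ultimately show ?thesis using kappa_bounds by (simp add: R'_def)
  next
    case False
    have up: "dJ (m - h) \<le> dJ t" if "1/2 \<le> t" "t \<le> m - h" for t
      using dJ_strict_antimono[of t "m - h"] dom[OF h] that by (cases "t = m - h") auto
    have "dJ (m - h) \<le> 1815/10000" using up[of "1/2"] dom[OF h] dJ_half_bounds by auto
    then have "(dJ (m - h))\<^sup>2 \<le> (1815/10000)\<^sup>2" using False by (intro power_mono) auto
    then have 1: "(dJ (m - h))\<^sup>2 \<le> 33/1000" by (simp add: power2_eq_square)
    have "Jw (1/2) \<le> Jw (m - h)"
    proof (rule DERIV_nonneg_imp_nondecreasing[where f = Jw])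
      fix t assume t: "1/2 \<le> t" "t \<le> m - h"
      then show "\<exists>y. (Jw has_real_derivative y) (at t) \<and> 0 \<le> y"
        using up[OF t] dom[OF h] False by (intro exI[of _ "dJ t"] conjI DERIV_Jw) auto
    qed (use dom[OF h] in auto)
    then have J: "1/2 \<le> Jw (m - h)" by (simp add: Jw_half)
    have "kappa * Jw m \<le> (19455/10000) * (50425/100000)"
      using kappa_bounds m by (intro mult_mono Jw_le) (auto intro!: less_imp_le[OF Jw_pos])
    then have "kappa * Jw m \<le> 1963/1000 * (1/2)" by simp
    also have "\<dots> \<le> 1963/1000 * Jw (m - h)" using J by simp
    finally have "kappa * Jw m / Jw (m - h) \<le> 1963/1000" using J by (subst pos_divide_le_eq) auto
    with 1 show ?thesis using zero_le_power2[of "dJ (m + h)"] unfolding R'_def by linarith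
  qed
  have Rpos: "0 \<le> R h" if h: "0 \<le> h" "h \<le> a" for h
    by (rule le_of_deriv_le[where c = 0 and a = h and f = "\<lambda>_. 0" and g = R and f' = "\<lambda>_. 0" and g' = R'])
      (use h R R'_nonneg in \<open>auto simp: R_def\<close>)
  have "(\<lambda>_. 0) a \<le> (\<lambda>h. (Jw (m + h))\<^sup>2 + 4 * h\<^sup>2 - (2 * Jw m - Jw (m - h))\<^sup>2) a"
  proof (rule le_of_deriv_le[where c = 0 and f = "\<lambda>_. 0" and f' = "\<lambda>_. 0" and g' = "\<lambda>h. 2 * R h"
        and g = "\<lambda>h. (Jw (m + h))\<^sup>2 + 4 * h\<^sup>2 - (2 * Jw m - Jw (m - h))\<^sup>2"])
    fix h assume h: "0 \<le> h" "h \<le> a"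
    show "((\<lambda>h. (Jw (m + h))\<^sup>2 + 4 * h\<^sup>2 - (2 * Jw m - Jw (m - h))\<^sup>2) has_real_derivative 2 * R h) (at h)"
      by (rule derivative_eq_intros Jp[OF h] Jm[OF h] refl)+
        (simp add: R_def algebra_simps)
    show "0 \<le> 2 * R h" using Rpos[OF h] by simp
  qed (use m in \<open>auto simp: power2_eq_square\<close>)
  then show ?thesis by simp
qed

lemma Jw_two_point:
  assumes "1/2 \<le> x" "x \<le> y" "y \<le> 1"
  shows "(2 * Jw ((x + y) / 2) - Jw x)\<^sup>2 \<le> (y - x)\<^sup>2 + (Jw y)\<^sup>2"
proof -
  define f where "f t = (t - x)\<^sup>2 + (Jw t)\<^sup>2 - (2 * Jw ((x + t) / 2) - Jw x)\<^sup>2" for t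
  have below: "0 \<le> f t" if "x \<le> t" "t < 1" for t
  proof -
    have e: "(x + t) / 2 - (t - x) / 2 = x" "(x + t) / 2 + (t - x) / 2 = t" by (simp_all add: field_simps)
    show ?thesis
      using Jw_two_point_open[of "(t - x) / 2" "(x + t) / 2"] that assms
      unfolding e by (simp add: f_def power_divide)
  qed
  have "0 \<le> f y"
  proof (cases "y < 1 \<or> x = 1")
    case True
    then show ?thesis using assms below by (cases "y < 1") (auto simp: f_def)
  next
    case False
    then have y: "y = 1" "x < 1" using assms by auto
    have "continuous_on {x..1} f"
      unfolding f_def
      by (intro continuous_intros continuous_on_subset[OF continuous_Jw]
          continuous_on_compose2[OF continuous_Jw]) (use assms in auto)
    then have "(f \<longlongrightarrow> f 1) (at_left 1)"
      using y(2) unfolding at_within_Icc_at_left[OF y(2), symmetric] by (simp add: continuous_on_def)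
    moreover have "\<forall>\<^sub>F t in at_left 1. 0 \<le> f t"
      using eventually_at_left_real[OF y(2)] by eventually_elim (use below in auto)
    ultimately show ?thesis using y tendsto_lowerbound by fastforce
  qed
  then show ?thesis by (simp add: f_def)
qed

text \<open>The numerical core of \<open>Q_J_two_point_low\<close>: the left-hand side is the amount by which
  \<open>Q\<close>, continued beyond \<open>1/2\<close>, may violate the two-point inequality; the
  right-hand side is a lower bound for \<open>J\<^sup>2 - Q\<^sup>2\<close>, whose leading term is
  the kink at \<open>1/2\<close>.\<close>
lemma Q_J_polynomial_bound:
  fixes e :: real
  assumes e: "0 \<le> e" "e \<le> 3/16" and h: "0 \<le> d" "2 * d + e \<le> 1/4"
    and K: "K \<le> 2288/10000 * e + d * (8 * e + 4 * d - 6862/10000)"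
  shows "4 * (d + e)\<^sup>2 * K \<le>
    (668/10000 * e + 5/100 * e^2 + 4574/10000 * e^3) * (1 + 2956/10000 * e - 395/100 * e^2 - 4574/10000 * e^3)"
    (is "_ \<le> ?A * ?C")
proof -
  have e2: "e^2 \<le> 3/16 * e" "e^2 \<le> 9/256" "0 \<le> e^2"
    using mult_mono[of e "3/16" e e] mult_mono[of e "3/16" e "3/16"] e by (auto simp: power2_eq_square)
  have e3: "e^3 \<le> 9/256 * e" "0 \<le> e^3"
    using mult_right_mono[OF e2(2), of e] e by (auto simp: power2_eq_square power3_eq_cube)
  have A: "668/10000 * e \<le> ?A" using e2 e3 by simp
  have C: "9/10 \<le> ?C" using e2 e3 e by simp
  have W0: "668/10000 * e * (9/10) \<le> ?A * ?C" using A C e by (intro mult_mono) auto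
  have hq: "4 * (d + e)\<^sup>2 \<le> (1/4 + e)\<^sup>2"
  proof -
    have "(2 * (d + e))\<^sup>2 \<le> (1/4 + e)\<^sup>2" using h e by (intro power_mono) auto
    moreover have "(2 * (d + e))\<^sup>2 = 4 * (d + e)\<^sup>2" unfolding power_mult_distrib by simp
    ultimately show ?thesis by simp
  qed
  show ?thesis
  proof (cases "K \<le> 2288/10000 * e")
    case True
    have "4 * (d + e)\<^sup>2 * K \<le> 4 * (d + e)\<^sup>2 * (2288/10000 * e)" using True by (intro mult_left_mono) auto
    also have "\<dots> \<le> (1/4 + e)\<^sup>2 * (2288/10000 * e)" using hq e by (intro mult_right_mono) auto
    also have "\<dots> \<le> (7/16)\<^sup>2 * (2288/10000 * e)" using e by (intro mult_right_mono power_mono) auto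
    also have "\<dots> \<le> 668/10000 * e * (9/10)" using e by (simp add: power2_eq_square)
    also note W0
    finally show ?thesis .
  next
    case False
    then have "0 < d * (8 * e + 4 * d - 6862/10000)" using K by linarith
    then have pos: "0 \<le> 8 * e + 4 * d - 6862/10000" using h by (simp add: zero_less_mult_iff)
    have "d * (8 * e + 4 * d - 6862/10000) \<le> (1/8 - e/2) * (6 * e - 1862/10000)"
      using h pos e by (intro mult_mono) auto
    also have "\<dots> = 8431/10000 * e - 3 * e^2 - 23275/1000000"
      by (simp add: field_simps power2_eq_square)
    finally have K2: "K \<le> 10719/10000 * e - 3 * e^2 - 232/10000" using K by simp
    have Kp: "0 \<le> 10719/10000 * e - 3 * e^2 - 232/10000" using K2 False e by linarith
    have "4 * (d + e)\<^sup>2 * K \<le> 4 * (d + e)\<^sup>2 * (10719/10000 * e - 3 * e^2 - 232/10000)"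
      using K2 by (intro mult_left_mono) auto
    also have "\<dots> \<le> (1/4 + e)\<^sup>2 * (10719/10000 * e - 3 * e^2 - 232/10000)"
      using hq Kp by (intro mult_right_mono) auto
    also have "\<dots> \<le> ?A * ?C"
    proof -
      \<comment> \<open>The difference of the two sides is about 0.0007 at its smallest, near e = 0.13; these squares, with their nearly critical points, certify that it is positive.\<close>
      have st: "0 \<le> e * (e - 12/100)\<^sup>2" "0 \<le> e^2 * (e - 14/100)\<^sup>2" "0 \<le> (e - 22/100)\<^sup>2"
        using e by auto
      have ex: "e * (e - 12/100)\<^sup>2 = e^3 - 24/100 * e^2 + 144/10000 * e"
        "e^2 * (e - 14/100)\<^sup>2 = e^4 - 28/100 * e^3 + 196/10000 * e^2"
        "(e - 22/100)\<^sup>2 = e^2 - 44/100 * e + 484/10000"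
        by (simp_all add: field_simps eval_nat_numeral)
      have e4: "0 \<le> e^4" by simp
      have e5: "e^5 \<le> 3/16 * e^4"
        using mult_right_mono[OF e(2) e4] by (simp add: eval_nat_numeral)
      have e6: "e^6 \<le> 9/256 * e^4"
        using mult_right_mono[OF e2(2) e4] by (simp add: eval_nat_numeral)
      have "?A * ?C - (1/4 + e)\<^sup>2 * (10719/10000 * e - 3 * e^2 - 232/10000) =
        29/20000 + 73/6400 * e - 3193799/12500000 * e^2 + 31821/50000 * e^3
          + 18169707/6250000 * e^4 - 2287/1250 * e^5 - 5230369/25000000 * e^6"
        by (simp add: field_simps eval_nat_numeral)
      moreover have "0 \<le> 29/20000 + 73/6400 * e - 3193799/12500000 * e^2 + 31821/50000 * e^3
          + 18169707/6250000 * e^4 - 2287/1250 * e^5 - 5230369/25000000 * e^6"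
        using st unfolding ex using e5 e6 e e2 e3 by linarith
      ultimately show ?thesis by linarith
    qed
    finally show ?thesis .
  qed
qed

text \<open>The case where the midpoint \<open>1/2 - d\<close> is at most \<open>1/2\<close>, and \<open>y =
  1/2 + e\<close>. Apply \<open>Q_gap\<close> to the continuation of \<open>Q\<close>; the error is
  absorbed by \<open>J\<^sup>2 - Q\<^sup>2\<close>.\<close>
lemma Q_J_two_point_low:
  assumes d: "0 \<le> d" "2 * d + e \<le> 1/4" and e: "0 \<le> e" "e \<le> 3/16"
  shows "(2 * Q (1/2 - d) - Q (1/2 - (2 * d + e)))\<^sup>2 \<le> (2 * (d + e))\<^sup>2 + (Jw (1/2 + e))\<^sup>2"
proof -
  define K where "K = 2 * (1 - q3 * d) * Q_secant d (d + e) - 1"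
  define p where "p = 1/2 + 1812/10000 * e - 39/20 * e^2"
  define q where "q = 1/2 + 1144/10000 * e - 2 * e^2 - 4574/10000 * e^3"
  have c0: "0 \<le> q3" using q3_bounds by simp
  have cd: "0 \<le> q3 * d" "q3 * d \<le> 1" using mult_mono[of q3 1 d 1] q3_bounds d e by auto
  have nn: "0 \<le> q3 * (d * (d * e))" "0 \<le> q3 * (d * (e * e))" "0 \<le> q3 * (e * (e * e))" "0 \<le> q3 * (d * d)"
    using c0 d e by auto
  have "Q_secant d (d + e) = Q_secant d d + (q3/6 + 4 * d) * e - 4 * (q3 * (d * (d * e)))
      - 2 * (q3 * (d * (e * e))) - 2/3 * (q3 * (e * (e * e)))"
    unfolding Q_secant_def by (simp add: field_simps power2_eq_square power3_eq_cube)
  with nn have "Q_secant d (d + e) \<le> Q_secant d d + (q3/6 + 4 * d) * e" by linarith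
  then have "2 * (1 - q3 * d) * Q_secant d (d + e) \<le> 2 * (1 - q3 * d) * (Q_secant d d + (q3/6 + 4 * d) * e)"
    using cd by (intro mult_left_mono) auto
  also have "\<dots> = 2 * (1 - q3 * d) * Q_secant d d + (1 - q3 * d) * ((q3/3 + 8 * d) * e)"
    by (simp add: field_simps)
  also have "2 * (1 - q3 * d) * Q_secant d d = 1 - d * (q3 - 4 * d * (1 - q3 * d)\<^sup>2)"
    unfolding Q_secant_def by (simp add: field_simps power2_eq_square power3_eq_cube)
  finally have 1: "K \<le> (1 - q3 * d) * ((q3/3 + 8 * d) * e) - d * (q3 - 4 * d * (1 - q3 * d)\<^sup>2)"
    by (simp add: K_def)
  have "(1 - q3 * d) * ((q3/3 + 8 * d) * e) \<le> (q3/3 + 8 * d) * e"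
    using cd c0 d e by (intro mult_left_le_one_le) auto
  also have "\<dots> \<le> (2288/10000 + 8 * d) * e"
    using q3_bounds e by (intro mult_right_mono) auto
  finally have 2: "(1 - q3 * d) * ((q3/3 + 8 * d) * e) \<le> (2288/10000 + 8 * d) * e" .
  have "(1 - q3 * d)\<^sup>2 \<le> 1" using cd by (intro power_le_one) auto
  then have "4 * d * (1 - q3 * d)\<^sup>2 \<le> 4 * d * 1" using d by (intro mult_left_mono) auto
  then have "d * (6862/10000 - 4 * d) \<le> d * (q3 - 4 * d * (1 - q3 * d)\<^sup>2)"
    using q3_bounds d by (intro mult_left_mono) auto
  with 1 2 have "K \<le> (2288/10000 + 8 * d) * e - d * (6862/10000 - 4 * d)" by linarith
  also have "\<dots> = 2288/10000 * e + d * (8 * e + 4 * d - 6862/10000)" by (simp add: field_simps)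
  finally have K: "K \<le> \<dots>" .
  have main: "4 * (d + e)\<^sup>2 * K \<le> p\<^sup>2 - q\<^sup>2"
  proof -
    have "p\<^sup>2 - q\<^sup>2 = (p - q) * (p + q)" by (simp add: power2_eq_square algebra_simps)
    moreover have "p - q = 668/10000 * e + 5/100 * e^2 + 4574/10000 * e^3"
      "p + q = 1 + 2956/10000 * e - 395/100 * e^2 - 4574/10000 * e^3"
      by (simp_all add: p_def q_def)
    ultimately show ?thesis using Q_J_polynomial_bound[OF e d K] by simp
  qed
  have e2: "e^2 \<le> 9/256" "0 \<le> e^2" using power_mono[of e "3/16" 2] e by (auto simp: power_divide)
  have e3: "0 \<le> e^3" "e^3 \<le> 27/4096" using power_mono[of e "3/16" 3] e by (auto simp: power_divide)
  have p0: "0 \<le> p" using e2 e by (simp add: p_def)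
  have "1812/10000 * e \<le> dJ (1/2) * e" using dJ_half_bounds e by (intro mult_right_mono) auto
  then have "p \<le> Jw (1/2 + e)" using Jw_ge_parabola[of "1/2 + e"] e by (simp add: p_def)
  then have J: "p\<^sup>2 \<le> (Jw (1/2 + e))\<^sup>2" using p0 by (intro power_mono) auto
  have Qe: "Q (1/2 - (d - (d + e))) = 1/2 + q3/6 * e - 2 * e^2 - 2/3 * (q3 * e^3)"
    unfolding Q_centered by simp
  have q3e: "q3 * e \<le> 6864/10000 * e" "6862/10000 * e^3 \<le> q3 * e^3" "q3 * e^3 \<le> 1 * e^3"
    by (rule mult_right_mono; use q3_bounds e e3 in simp)+
  have "0 \<le> q3 * e" using c0 e by simp
  note q3e = q3e this
  have "0 \<le> Q (1/2 - (d - (d + e)))" "Q (1/2 - (d - (d + e))) \<le> q"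
    unfolding Qe q_def using q3e e2 e3 e by linarith+
  then have Qq: "(Q (1/2 - (d - (d + e))))\<^sup>2 \<le> q\<^sup>2" by (intro power_mono)
  have "2 * d + e = d + (d + e)" by simp
  then have "(2 * Q (1/2 - d) - Q (1/2 - (2 * d + e)))\<^sup>2
      = (Q (1/2 - (d - (d + e))))\<^sup>2 + 4 * (d + e)\<^sup>2 + 4 * (d + e)\<^sup>2 * K"
    unfolding K_def by (simp only: Q_gap) (simp add: field_simps)
  also have "\<dots> \<le> (2 * (d + e))\<^sup>2 + (Jw (1/2 + e))\<^sup>2"
    using Qq J main unfolding power_mult_distrib by simp
  finally show ?thesis .
qed

text \<open>The midpoint is at least \<open>1/2\<close>. With the two parabolas that enclose \<open>J\<close>,
  the excess of the bound \<open>N\<close> for \<open>2 * J m - Q x\<close> over the bound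
  \<open>p\<close> for \<open>J y\<close> is at most \<open>T\<close>, which is \<open>0.986\<close>
  times the squared distance \<open>D\<close> minus a multiple of \<open>x\<close> that comes from
  the kink. Then \<open>N\<^sup>2 - p\<^sup>2\<close> is at most \<open>T * (2 * p + T)\<close>, and
  this is at most \<open>D\<close>.\<close>
lemma Q_J_two_point_high:
  assumes x: "0 \<le> x" "x \<le> y" "y \<le> 3/16"
  shows "2 * Jw (1/2 + (y - x) / 2) - Q (1/2 - x) \<le> sqrt ((x + y)\<^sup>2 + (Jw (1/2 + y))\<^sup>2)"
proof -
  define \<beta> where "\<beta> = dJ (1/2)"
  have \<beta>: "1812/10000 \<le> \<beta>" "\<beta> \<le> 1815/10000" using dJ_half_bounds by (auto simp: \<beta>_def)
  define p where "p = 1/2 + \<beta> * y - 39/20 * y^2"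
  define N where "N = 2 * (1/2 + \<beta> * ((y - x) / 2) - 241/125 * ((y - x) / 2)\<^sup>2) - Q (1/2 - x)"
  define D where "D = (x + y)\<^sup>2"
  define T where "T = 986/1000 * D - 65/1000 * x"
  have y2: "y^2 \<le> 9/256" using power_mono[of y "3/16" 2] x by (auto simp: power_divide)
  have pJ: "p \<le> Jw (1/2 + y)" using Jw_ge_parabola[of "1/2 + y"] x by (simp add: p_def \<beta>_def)
  have "0 \<le> \<beta> * y" using \<beta> x by simp
  then have p0: "0 \<le> p" using y2 by (simp add: p_def)
  have "2 * Jw (1/2 + (y - x) / 2) - Q (1/2 - x) \<le> N"
  proof -
    have "1/2 + (y - x) / 2 < 1" using x by (simp add: field_simps)
    then show ?thesis using Jw_le_parabola[of "1/2 + (y - x) / 2"] x by (simp add: N_def \<beta>_def)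
  qed
  also have "N \<le> sqrt (D + (Jw (1/2 + y))\<^sup>2)"
  proof (cases "N \<le> p")
    case True
    also have "p \<le> Jw (1/2 + y)" by (rule pJ)
    also have "\<dots> \<le> sqrt (D + (Jw (1/2 + y))\<^sup>2)" by (rule real_le_rsqrt) (simp add: D_def)
    finally show ?thesis .
  next
    case False
    have NT: "N - p \<le> T"
    proof -
      have "T - (N - p) = x * ((\<beta> - q3/6 - 65/1000) + 44/1000 * y - 1/20 * x) + 2/3 * (q3 * x^3)"
        unfolding T_def N_def p_def D_def Q_centered by (simp add: field_simps power2_eq_square power3_eq_cube)
      moreover have "0 \<le> x * ((\<beta> - q3/6 - 65/1000) + 44/1000 * y - 1/20 * x)"
        using x \<beta> q3_bounds by (intro mult_nonneg_nonneg) auto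
      moreover have "0 \<le> q3 * x^3" using x q3_bounds by simp
      ultimately show ?thesis by linarith
    qed
    with False have T0: "0 < T" by linarith
    define v z where "v = 363/1000 * y - 2914/1000 * y^2" and "z = 1972/1000 * y + 986/1000 * x - 65/1000"
    have v1: "v \<le> 114/10000"
    proof -
      have "0 \<le> 2914/1000 * (y - 363/5828)\<^sup>2" by simp
      also have "\<dots> = 2914/1000 * y^2 - 363/1000 * y + 363/1000 * 363/11656"
        by (simp add: field_simps power2_eq_square)
      finally show ?thesis by (simp add: v_def)
    qed
    have v2: "- 344/10000 \<le> v"
    proof -
      have "y^2 \<le> 3/16 * y" using mult_right_mono[OF x(3), of y] x by (simp add: power2_eq_square)
      then show ?thesis using x unfolding v_def by linarith
    qed
    have S: "2 * p + T \<le> 1 + v + x * z"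
    proof -
      have "2 * \<beta> * y \<le> 363/1000 * y" using \<beta> x by (intro mult_right_mono) auto
      moreover have "1 + v + x * z = 1 + 363/1000 * y - 39/10 * y^2 + T"
        by (simp add: v_def z_def T_def D_def field_simps power2_eq_square)
      ultimately show ?thesis by (simp add: p_def)
    qed
    have D0: "0 \<le> D" by (simp add: D_def)
    have a: "T * (1 + v) \<le> D - x * (627/10000)"
    proof -
      have "D * (986/1000 * (1 + v)) \<le> D * 1" using v1 D0 by (intro mult_left_mono) auto
      moreover have "x * (627/10000) \<le> x * (65/1000 * (1 + v))" using v2 x by (intro mult_left_mono) auto
      moreover have "T * (1 + v) = D * (986/1000 * (1 + v)) - x * (65/1000 * (1 + v))"
        by (simp add: T_def field_simps)
      ultimately show ?thesis by linarith
    qed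
    have b: "T * z \<le> 627/10000"
    proof (cases "z \<le> 0")
      case True
      then have "T * z \<le> 0" using T0 by (intro mult_nonneg_nonpos) auto
      then show ?thesis by simp
    next
      case False
      have "D \<le> (3/8) * (x + 3/16)" unfolding D_def power2_eq_square using x by (intro mult_mono) auto
      then have "T \<le> 1266/10000" using x by (simp add: T_def)
      moreover have "z \<le> 49/100" using x by (simp add: z_def)
      ultimately have "T * z \<le> 1266/10000 * (49/100)" using T0 False by (intro mult_mono) auto
      then show ?thesis by simp
    qed
    have "T * (2 * p + T) \<le> T * (1 + v + x * z)" using S T0 by (intro mult_left_mono) auto
    also have "\<dots> = T * (1 + v) + x * (T * z)" by (simp add: algebra_simps)
    also have "\<dots> \<le> D" using a mult_left_mono[OF b x(1)] by linarith
    finally have TD: "T * (2 * p + T) \<le> D" .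
    have "N\<^sup>2 \<le> (p + T)\<^sup>2" using NT False p0 by (intro power_mono) auto
    also have "\<dots> = p\<^sup>2 + T * (2 * p + T)" by (simp add: power2_eq_square algebra_simps)
    also have "\<dots> \<le> (Jw (1/2 + y))\<^sup>2 + D"
      using TD power_mono[OF pJ p0, of 2] by simp
    finally show ?thesis by (intro real_le_rsqrt) simp
  qed
  finally show ?thesis by (simp add: D_def)
qed

section \<open>Concavity of the three branches\<close>

abbreviation Bw :: "real \<Rightarrow> real" where "Bw \<equiv> B (29/32)"

lemma L_quarter: "L (1/4) = sqrt 2 / 4"
  using L_power[of 2] by (simp add: power2_eq_square)

lemma Bw_L: "x \<le> 1/4 \<Longrightarrow> Bw x = L x"
  by (simp add: B_def)

lemma Bw_Q: "1/4 \<le> x \<Longrightarrow> x \<le> 1/2 \<Longrightarrow> Bw x = Q x"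
proof (cases "x = 1/4")
  case True
  show ?thesis unfolding True by (simp add: B_def L_quarter Q_quarter)
qed (auto simp: B_def)

lemma Bw_J: "1/2 \<le> x \<Longrightarrow> Bw x = Jw x"
proof (cases "x = 1/2")
  case True
  show ?thesis unfolding True by (simp add: B_def Jw_half Q_half)
qed (auto simp: B_def)

text \<open>The parabola of \<open>Jw_le_parabola\<close> with its slope rounded up.\<close>
definition J_majorant :: "real \<Rightarrow> real" where
  "J_majorant m = 1/2 + 1815/10000 * (m - 1/2) - 241/125 * (m - 1/2)\<^sup>2"

text \<open>Since the kink at \<open>1/2\<close> is convex, the middle value may be bounded by the larger of
  two smooth functions, and a rectangle need not be cut where the midpoint crosses
  \<open>1/2\<close>.\<close>
lemma Bw_le_max:
  assumes "1/4 \<le> m" "m \<le> 3/4"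
  shows "Bw m \<le> max (Q m) (J_majorant m)"
proof (cases "m \<le> 1/2")
  case True
  then show ?thesis using assms by (simp add: Bw_Q)
next
  case False
  have "dJ (1/2) * (m - 1/2) \<le> 1815/10000 * (m - 1/2)"
    using dJ_half_bounds False by (intro mult_right_mono) auto
  then have "Jw m \<le> J_majorant m"
    using Jw_le_parabola[of m] False assms unfolding J_majorant_def by linarith
  then show ?thesis using False by (simp add: Bw_J)
qed

text \<open>Continuity at the end points is enough, which matters for \<open>L\<close> at 0 and
  \<open>J\<close> at 1, where the derivatives are infinite.\<close>
lemma concave_on_of_deriv2:
  fixes f f' f'' :: "real \<Rightarrow> real"
  assumes cont: "continuous_on {a..b} f"
    and f: "\<And>x. a < x \<Longrightarrow> x < b \<Longrightarrow> (f has_real_derivative f' x) (at x)"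
    and f': "\<And>x. a < x \<Longrightarrow> x < b \<Longrightarrow> (f' has_real_derivative f'' x) (at x)"
    and neg: "\<And>x. a < x \<Longrightarrow> x < b \<Longrightarrow> f'' x \<le> 0"
  shows "concave_on {a..b} f"
  unfolding concave_on_def
proof (rule convex_on_linorderI)
  fix t x y :: real
  assume t: "0 < t" "t < 1" and xy: "x \<in> {a..b}" "y \<in> {a..b}" "x < y"
  define z where "z = (1 - t) * x + t * y"
  have z1: "z - x = t * (y - x)" and z2: "y - z = (1 - t) * (y - x)"
    by (simp_all add: z_def algebra_simps)
  have "0 < z - x" "0 < y - z" unfolding z1 z2 using t xy by simp_all
  then have z: "x < z" "z < y" by simp_all
  have mv: "\<exists>p. u < p \<and> p < v \<and> f v - f u = f' p * (v - u)" if uv: "x \<le> u" "u < v" "v \<le> y" for u v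
  proof -
    obtain p where "p \<in> {u<..<v}" "f v - f u = (*) (f' p) (v - u)"
    proof (rule mvt[of u v f "\<lambda>p. (*) (f' p)"])
      show "continuous_on {u..v} f" by (rule continuous_on_subset[OF cont]) (use uv xy in auto)
      show "(f has_derivative (*) (f' p)) (at p)" if "u < p" "p < v" for p
        using f[of p] that uv xy by (simp add: has_field_derivative_def)
    qed (use uv in auto)
    then show ?thesis by auto
  qed
  obtain p where p: "x < p" "p < z" "f z - f x = f' p * (z - x)" using mv[of x z] z by auto
  obtain q where q: "z < q" "q < y" "f y - f z = f' q * (y - z)" using mv[of z y] z by auto
  have "f' q \<le> f' p"
  proof (rule DERIV_nonpos_imp_nonincreasing[where f = f'])
    fix u assume "p \<le> u" "u \<le> q"
    then show "\<exists>d. (f' has_real_derivative d) (at u) \<and> d \<le> 0"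
      using f'[of u] neg[of u] p q xy by (intro exI[of _ "f'' u"]) auto
  qed (use p q in auto)
  then have "f' q * (t * ((1 - t) * (y - x))) \<le> f' p * (t * ((1 - t) * (y - x)))"
    using t xy by (intro mult_right_mono) auto
  then have "t * (f y - f z) \<le> (1 - t) * (f z - f x)"
    unfolding p(3) q(3) z1 z2 by (simp only: ac_simps)
  then have "(1 - t) * f x + t * f y \<le> f z" by (simp add: algebra_simps)
  then show "- f ((1 - t) *\<^sub>R x + t *\<^sub>R y) \<le> (1 - t) * - f x + t * - f y"
    by (simp add: z_def)
qed simp

lemma concave_on_nonneg:
  fixes f :: "real \<Rightarrow> real"
  assumes "concave_on {a..b} f" "0 \<le> f a" "0 \<le> f b" "a \<le> x" "x \<le> b"
  shows "0 \<le> f x"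
proof (cases "a = b")
  case True then show ?thesis using assms by auto
next
  case False
  define t where "t = (x - a) / (b - a)"
  have t: "0 \<le> t" "t \<le> 1" using assms False by (auto simp: t_def field_simps)
  have "t * (b - a) = x - a" using False by (simp add: t_def)
  then have x: "(1 - t) *\<^sub>R a + t *\<^sub>R b = x" by (simp add: algebra_simps)
  have "(1 - t) * f a + t * f b \<le> f ((1 - t) *\<^sub>R a + t *\<^sub>R b)"
    using concave_onD[OF assms(1) t, of a b] assms by auto
  moreover have "0 \<le> (1 - t) * f a + t * f b" using t assms by simp
  ultimately show ?thesis unfolding x by linarith
qed

text \<open>The added square has second derivative \<open>47/20\<close>, which is the most that the middle
  term \<open>- 2 * g ((x + y) / 2)\<close> contributes to the second derivative of the defect (see
  \<open>concave_minus_mid\<close>).\<close>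
lemma concave_L: "concave_on {0..1/4} (\<lambda>x. L x + 47/40 * x\<^sup>2)"
proof (rule concave_on_of_deriv2)
  define k where "k = 1 / ln (2::real)"
  have k: "36/25 \<le> k" "0 < k" "k * ln 2 = 1" using ln2_bounds by (auto simp: k_def field_simps)
  define l where "l x = - k * ln x" for x :: real
  have Ll: "L x = x * sqrt (l x)" if "0 < x" for x
    using that by (simp add: L_eq l_def k_def log_def ln_div)
  have l2: "2 \<le> l x" if "0 < x" "x \<le> 1/4" for x
  proof -
    have "ln x \<le> ln (1/4)" using that by (subst ln_le_cancel_iff) auto
    also have "ln (1/4) = - 2 * ln (2::real)" using ln_realpow[of 2 2] by (simp add: ln_div)
    finally have "k * ln x \<le> k * (- 2 * ln 2)" using k by (intro mult_left_mono) auto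
    then show ?thesis using k(3) by (simp add: l_def)
  qed
  have Dl: "(l has_real_derivative - k / x) (at x)" if "0 < x" for x
    unfolding l_def[abs_def] using that by (auto intro!: derivative_eq_intros)
  define f' where "f' x = sqrt (l x) - k/2 * inverse (sqrt (l x)) + 47/20 * x" for x
  define d where "d x = (- k / x) * (1 / (2 * sqrt (l x)))" for x
  define f'' where "f'' x = d x - k/2 * (- (inverse (sqrt (l x)) * d x * inverse (sqrt (l x)))) + 47/20" for x
  show "continuous_on {0..1/4} (\<lambda>x. L x + 47/40 * x\<^sup>2)"
  proof (intro continuous_intros)
    show "continuous_on {0..1/4} L"
      unfolding continuous_on_eq_continuous_within
    proof
      fix x :: real assume x: "x \<in> {0..1/4}"
      show "continuous (at x within {0..1/4}) L"
      proof (cases "x = 0")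
        case True
        have "((\<lambda>x::real. x * sqrt (log 2 (1 / x))) \<longlongrightarrow> 0) (at_right 0)" by real_asymp
        moreover have "\<forall>\<^sub>F x in at_right 0. x * sqrt (log 2 (1 / x)) = L x"
          using eventually_at_right_less[of "0::real"] by eventually_elim (simp add: L_eq)
        ultimately have "(L \<longlongrightarrow> 0) (at_right 0)" by (rule Lim_transform_eventually)
        moreover have "at 0 within {0..1/4} = at_right (0::real)" by (rule at_within_Icc_at_right) simp
        ultimately show ?thesis by (simp add: True continuous_within)
      next
        case False
        with x have x0: "0 < x" by simp
        have "isCont (\<lambda>x. x * sqrt (l x)) x"
          by (rule isCont_mult[OF continuous_ident isCont_o2[OF DERIV_isCont[OF Dl[OF x0]] isCont_real_sqrt]])
        moreover have "\<forall>\<^sub>F u in nhds x. L u = u * sqrt (l u)"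
          using eventually_nhds_in_open[of "{0<..}" x] x0 by (auto elim: eventually_mono simp: Ll)
        ultimately have "isCont L x" using isCont_cong[of L "\<lambda>u. u * sqrt (l u)" x] by blast
        then show ?thesis by (rule continuous_at_imp_continuous_at_within)
      qed
    qed
  qed
  fix x :: real assume x: "0 < x" "x < 1/4"
  have lx: "2 \<le> l x" using l2 x by simp
  define u where "u = sqrt (l x)"
  have u: "0 < u" "u * u = l x" using lx by (simp_all add: u_def)
  have Ds: "((\<lambda>x. sqrt (l x)) has_real_derivative d x) (at x)"
    using DERIV_chain2[OF DERIV_real_sqrt[of "l x"] Dl[OF x(1)]] lx by (simp add: d_def field_simps)
  have "((\<lambda>x. x * sqrt (l x) + 47/40 * x\<^sup>2) has_real_derivative (1 * sqrt (l x) + d x * x) + 47/40 * (2 * x)) (at x)"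
    by (intro DERIV_add DERIV_mult DERIV_ident Ds DERIV_cmult) (auto intro!: derivative_eq_intros)
  moreover have "d x * x = - (k/2 * inverse (sqrt (l x)))"
    using x u by (simp add: d_def u_def[symmetric] field_simps)
  ultimately have D1: "((\<lambda>x. x * sqrt (l x) + 47/40 * x\<^sup>2) has_real_derivative f' x) (at x)"
    by (simp add: f'_def)
  have "\<forall>\<^sub>F t in nhds x. L t + 47/40 * t\<^sup>2 = t * sqrt (l t) + 47/40 * t\<^sup>2"
    using eventually_nhds_in_open[of "{0<..}" x] x by (auto elim: eventually_mono simp: Ll)
  then show "((\<lambda>x. L x + 47/40 * x\<^sup>2) has_real_derivative f' x) (at x)"
    by (rule DERIV_cong_ev[OF refl _ refl, THEN iffD2, OF _ D1])
  have "sqrt (l x) \<noteq> 0" using u by (simp add: u_def)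
  then have "((\<lambda>x. inverse (sqrt (l x))) has_real_derivative
      - (inverse (sqrt (l x)) * d x * inverse (sqrt (l x)))) (at x)"
    by (rule DERIV_inverse'[OF Ds])
  then show "(f' has_real_derivative f'' x) (at x)"
    unfolding f'_def[abs_def] f''_def
    by (intro DERIV_add DERIV_diff DERIV_cmult Ds) (auto intro!: derivative_eq_intros)
  show "f'' x \<le> 0"
  proof -
    have "1 + (l x - 2) * ln 2 \<le> exp ((l x - 2) * ln 2)" by (rule exp_ge_add_one_self)
    moreover have "(l x - 2) * (2/3) \<le> (l x - 2) * ln 2" using ln2_bounds lx by (intro mult_left_mono) auto
    moreover have "exp ((l x - 2) * ln 2) = 1 / (4 * x)"
    proof -
      have "l x * ln 2 = - ln x" using k(3) by (simp add: l_def)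
      moreover have "2 * ln 2 = ln (4::real)" using ln_realpow[of 2 2] by simp
      ultimately have e: "(l x - 2) * ln 2 = - ln (4 * x)" using x by (simp add: algebra_simps ln_mult)
      show ?thesis unfolding e using x by (simp add: exp_minus inverse_eq_divide)
    qed
    ultimately have "1 + (l x - 2) * (2/3) \<le> 1 / (4 * x)" by linarith
    moreover have "(l x - 2) * (2/3) = 2/3 * l x - 4/3" "1 / x = 4 * (1 / (4 * x))" by simp_all
    ultimately have xl: "2 * l x \<le> 1 / x" using lx by linarith
    have "169/100 \<le> u + 18/25 / u"
    proof -
      have "0 \<le> (u - 845/1000)\<^sup>2" by simp
      then have "169/100 * u \<le> u * u + 18/25" by (simp add: power2_eq_square algebra_simps)
      then show ?thesis using u by (simp add: field_simps)
    qed
    moreover have "18/25 / u \<le> k / 2 / u" using k u by (intro divide_right_mono) auto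
    ultimately have "36/25 * (169/100) \<le> k * (u + k / 2 / u)" using k by (intro mult_mono) auto
    also have "\<dots> = k * (2 * l x) * (1 / (2 * u) + k / (4 * l x * u))"
      using u lx by (simp add: field_simps flip: u(2))
    also have "\<dots> \<le> k * (1 / x) * (1 / (2 * u) + k / (4 * l x * u))"
      using xl k u lx by (intro mult_right_mono mult_left_mono) auto
    also have "\<dots> = - (d x - k/2 * (- (inverse u * d x * inverse u)))"
      using u lx x by (simp add: d_def u_def[symmetric] field_simps flip: u(2))
    finally show ?thesis by (simp add: f''_def u_def)
  qed
qed

lemma DERIV_Q: "(Q has_real_derivative q3/6 + 4 * (1/2 - x) - 2 * q3 * (1/2 - x)\<^sup>2) (at x)"
proof -
  have eq: "Q = (\<lambda>x. 1/2 - q3/6 * (1/2 - x) - 2 * (1/2 - x)^2 + 2/3 * q3 * (1/2 - x)^3)"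
  proof
    fix x show "Q x = 1/2 - q3/6 * (1/2 - x) - 2 * (1/2 - x)^2 + 2/3 * q3 * (1/2 - x)^3"
      using Q_centered[of "1/2 - x"] by simp
  qed
  have u: "((\<lambda>x::real. 1/2 - x) has_real_derivative - 1) (at x)" by (auto intro!: derivative_eq_intros)
  have "((\<lambda>x. 1/2 - q3/6 * (1/2 - x) - 2 * (1/2 - x)^2 + 2/3 * q3 * (1/2 - x)^3) has_real_derivative
      0 - q3/6 * (- 1) - 2 * (2 * (- 1 * (1/2 - x) ^ (2 - 1))) + 2/3 * q3 * (3 * (- 1 * (1/2 - x) ^ (3 - 1)))) (at x)"
    using DERIV_power[OF u, of 2] DERIV_power[OF u, of 3]
    by (intro DERIV_add DERIV_diff DERIV_const DERIV_cmult u)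
      (simp_all only: of_nat_numeral One_nat_def numeral_2_eq_2[symmetric])
  then have "((\<lambda>x. 1/2 - q3/6 * (1/2 - x) - 2 * (1/2 - x)^2 + 2/3 * q3 * (1/2 - x)^3) has_real_derivative
      q3/6 + 4 * (1/2 - x) - 2 * q3 * (1/2 - x)\<^sup>2) (at x)"
    by (rule DERIV_cong) simp
  then show ?thesis by (simp only: eq)
qed

lemma DERIV_Q':
  "((\<lambda>x. q3/6 + 4 * (1/2 - x) - 2 * q3 * (1/2 - x)\<^sup>2) has_real_derivative - 4 + 4 * q3 * (1/2 - x)) (at x)"
proof -
  have u: "((\<lambda>x::real. 1/2 - x) has_real_derivative - 1) (at x)" by (auto intro!: derivative_eq_intros)
  have "((\<lambda>x. q3/6 + 4 * (1/2 - x) - 2 * q3 * (1/2 - x)\<^sup>2) has_real_derivative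
      0 + 4 * (- 1) - 2 * q3 * (2 * (- 1 * (1/2 - x) ^ (2 - 1)))) (at x)"
    using DERIV_power[OF u, of 2]
    by (intro DERIV_add DERIV_diff DERIV_const DERIV_cmult u) (simp_all only: of_nat_numeral One_nat_def)
  then show ?thesis by (rule DERIV_cong) (simp add: algebra_simps)
qed

lemma DERIV_quadratic: "((\<lambda>x. a * x\<^sup>2) has_real_derivative 2 * a * x) (at (x::real))"
  and DERIV_linear: "((\<lambda>x. a * x) has_real_derivative a) (at (x::real))"
  by (auto intro!: derivative_eq_intros)

lemma concave_Q: "concave_on {1/4..1/2} (\<lambda>x. Q x + 47/40 * x\<^sup>2)"
proof (rule concave_on_of_deriv2)
  show "continuous_on {1/4..1/2} (\<lambda>x. Q x + 47/40 * x\<^sup>2)"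
    unfolding Q_eq by (intro continuous_intros)
  fix x :: real assume x: "1/4 < x" "x < 1/2"
  show "((\<lambda>x. Q x + 47/40 * x\<^sup>2) has_real_derivative
      q3/6 + 4 * (1/2 - x) - 2 * q3 * (1/2 - x)\<^sup>2 + 47/20 * x) (at x)"
    using DERIV_add[OF DERIV_Q DERIV_quadratic[of "47/40"]] by simp
  show "((\<lambda>x. q3/6 + 4 * (1/2 - x) - 2 * q3 * (1/2 - x)\<^sup>2 + 47/20 * x) has_real_derivative
      - 4 + 4 * q3 * (1/2 - x) + 47/20) (at x)"
    by (rule DERIV_add[OF DERIV_Q' DERIV_linear])
  have "q3 * (1/2 - x) \<le> 1 * (1/4)" using q3_bounds x by (intro mult_mono) auto
  then show "- 4 + 4 * q3 * (1/2 - x) + 47/20 \<le> 0" by simp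
qed

text \<open>The term with \<open>e\<close> is subtracted in the places where \<open>s * J\<close> alone is not
  concave enough.\<close>
lemma concave_Jw:
  assumes y: "1/2 \<le> y1" "y2 \<le> 1"
    and le: "\<And>y. y1 < y \<Longrightarrow> y < y2 \<Longrightarrow> (47/20 - 2 * e) * Jw y \<le> s * kappa"
  shows "concave_on {y1..y2} (\<lambda>y. s * Jw y - e * (y - c)\<^sup>2 + 47/40 * y\<^sup>2)"
proof (rule concave_on_of_deriv2)
  show "continuous_on {y1..y2} (\<lambda>y. s * Jw y - e * (y - c)\<^sup>2 + 47/40 * y\<^sup>2)"
    by (intro continuous_intros continuous_on_subset[OF continuous_Jw]) (use y in auto)
  fix x assume x: "y1 < x" "x < y2"
  have lin: "((\<lambda>y. y - c) has_real_derivative 1) (at x)" by (auto intro!: derivative_eq_intros)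
  have sq: "((\<lambda>y. e * (y - c)\<^sup>2) has_real_derivative 2 * e * (x - c)) (at x)"
    using DERIV_chain2[OF DERIV_quadratic lin] by simp
  have lin2: "((\<lambda>y. 2 * e * (y - c)) has_real_derivative 2 * e) (at x)"
    using DERIV_cmult[OF lin, of "2 * e"] by simp
  have "3/32 < x" "x < 1" using x y by auto
  note J = DERIV_cmult[OF DERIV_Jw[OF this], of s] and J' = DERIV_cmult[OF DERIV_dJ[OF this], of s]
  show "((\<lambda>y. s * Jw y - e * (y - c)\<^sup>2 + 47/40 * y\<^sup>2) has_real_derivative
      s * dJ x - 2 * e * (x - c) + 47/20 * x) (at x)"
    using DERIV_add[OF DERIV_diff[OF J sq] DERIV_quadratic[of "47/40"]] by simp
  show "((\<lambda>x. s * dJ x - 2 * e * (x - c) + 47/20 * x) has_real_derivative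
      s * (- kappa / Jw x) - 2 * e + 47/20) (at x)"
    by (rule DERIV_add[OF DERIV_diff[OF J' lin2] DERIV_linear])
  have "0 < Jw x" using x y by (intro Jw_pos) auto
  then show "s * (- kappa / Jw x) - 2 * e + 47/20 \<le> 0"
    using le[OF x] by (simp add: field_simps)
qed

lemma concave_minus_mid:
  assumes g: "g = Q \<or> g = J_majorant" and yz: "1/2 \<le> a + y" "b + y \<le> 3/2"
  shows "concave_on {a..b} (\<lambda>x. - 2 * g ((x + y) / 2) - 47/40 * x\<^sup>2)"
proof -
  obtain g' g'' where D: "\<And>x. (g has_real_derivative g' x) (at x)" "\<And>x. (g' has_real_derivative g'' x) (at x)"
    and lb: "\<And>x. 1/4 \<le> x \<Longrightarrow> x \<le> 3/4 \<Longrightarrow> - 47/10 \<le> g'' x"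
  proof -
    have q: "- 47/10 \<le> - 4 + 4 * q3 * (1/2 - x)" if "1/4 \<le> x" "x \<le> 3/4" for x
    proof -
      have "q3 * (x - 1/2) \<le> 6864/10000 * (1/4)"
      proof (cases "x \<le> 1/2")
        case True
        then have "q3 * (x - 1/2) \<le> 0" using q3_bounds by (intro mult_nonneg_nonpos) auto
        then show ?thesis by simp
      next
        case False
        then show ?thesis using q3_bounds that by (intro mult_mono) auto
      qed
      then show ?thesis by (simp add: algebra_simps)
    qed
    have j: "(J_majorant has_real_derivative 1815/10000 - 482/125 * (x - 1/2)) (at x)"
      "((\<lambda>x. 1815/10000 - 482/125 * (x - 1/2)) has_real_derivative - 482/125) (at x)" for x :: real
      unfolding J_majorant_def[abs_def] by (auto intro!: derivative_eq_intros)
    from g show thesis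
    proof
      assume "g = Q" then show thesis using that[OF _ DERIV_Q'] DERIV_Q q by auto
    next
      assume "g = J_majorant" then show thesis using that[OF _ j(2)] j(1) by auto
    qed
  qed
  have mid: "((\<lambda>x. (x + y) / 2) has_real_derivative 1/2) (at x)" for x
    by (auto intro!: derivative_eq_intros)
  have D1: "((\<lambda>x. g ((x + y) / 2)) has_real_derivative g' ((x + y) / 2) * (1/2)) (at x)" for x
    by (rule DERIV_chain2[OF D(1) mid])
  have D2: "((\<lambda>x. g' ((x + y) / 2)) has_real_derivative g'' ((x + y) / 2) * (1/2)) (at x)" for x
    by (rule DERIV_chain2[OF D(2) mid])
  show ?thesis
  proof (rule concave_on_of_deriv2)
    show d1: "((\<lambda>x. - 2 * g ((x + y) / 2) - 47/40 * x\<^sup>2) has_real_derivative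
        - g' ((x + y) / 2) - 47/20 * x) (at x)" for x
      using DERIV_diff[OF DERIV_cmult[OF D1, of "- 2"] DERIV_quadratic[of "47/40"]] by simp
    show "continuous_on {a..b} (\<lambda>x. - 2 * g ((x + y) / 2) - 47/40 * x\<^sup>2)"
      by (rule continuous_at_imp_continuous_on) (use DERIV_isCont[OF d1] in blast)
    show "((\<lambda>x. - g' ((x + y) / 2) - 47/20 * x) has_real_derivative
        - (g'' ((x + y) / 2) * (1/2)) - 47/20) (at x)" for x
      by (rule DERIV_diff[OF DERIV_minus[OF D2] DERIV_linear])
    fix x assume "a < x" "x < b"
    then have "- 47/10 \<le> g'' ((x + y) / 2)" using yz by (intro lb) auto
    then show "- (g'' ((x + y) / 2) * (1/2)) - 47/20 \<le> 0" by simp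
  qed
qed

section \<open>Rectangles\<close>

definition two_point_at :: "real \<Rightarrow> real \<Rightarrow> bool" where
  "two_point_at x y \<longleftrightarrow>
    (\<exists>c s. supporting c s \<and> 2 * Bw ((x + y) / 2) \<le> c * (y - x) + s * Bw y + Bw x)"

lemma concave_on_affine: "concave_on {a..b} (\<lambda>x::real. p * x + q)"
  by (rule concave_on_of_deriv2[where f' = "\<lambda>_. p" and f'' = "\<lambda>_. 0"])
    (auto intro!: derivative_eq_intros continuous_intros)

lemma separately_concave_nonneg:
  fixes F :: "real \<Rightarrow> real \<Rightarrow> real"
  assumes "\<And>y. y1 \<le> y \<Longrightarrow> y \<le> y2 \<Longrightarrow> concave_on {x1..x2} (\<lambda>x. F x y)"
    and "\<And>x. x \<in> {x1, x2} \<Longrightarrow> concave_on {y1..y2} (\<lambda>y. F x y)"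
    and "0 \<le> F x1 y1" "0 \<le> F x1 y2" "0 \<le> F x2 y1" "0 \<le> F x2 y2"
    and "x1 \<le> x" "x \<le> x2" "y1 \<le> y" "y \<le> y2"
  shows "0 \<le> F x y"
proof (rule concave_on_nonneg[where f = "\<lambda>x. F x y"])
  show "0 \<le> F x1 y" "0 \<le> F x2 y"
    by (rule concave_on_nonneg[OF assms(2)]; use assms in simp)+
qed (use assms in auto)

lemma concave_on_cong:
  fixes f g :: "real \<Rightarrow> real"
  assumes "concave_on {a..b} f" and eq: "\<And>x. x \<in> {a..b} \<Longrightarrow> g x = f x"
  shows "concave_on {a..b} g"
  unfolding concave_on_def
proof (rule convex_onI)
  fix t x y :: real
  assume t: "0 < t" "t < 1" and xy: "x \<in> {a..b}" "y \<in> {a..b}"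
  then have "(1 - t) *\<^sub>R x + t *\<^sub>R y \<in> {a..b}" by (intro convexD) auto
  then show "- g ((1 - t) *\<^sub>R x + t *\<^sub>R y) \<le> (1 - t) * - g x + t * - g y"
    using concave_onD[OF assms(1), of t x y] t xy eq by auto
qed auto

text \<open>An interval on the left of \<open>1/2\<close> that does not contain the kink at \<open>1/4\<close>
  in its interior.\<close>
definition within_branch :: "real \<Rightarrow> real \<Rightarrow> bool" where
  "within_branch a b \<longleftrightarrow> 0 \<le> a \<and> b \<le> 1/2 \<and> (b \<le> 1/4 \<or> 1/4 \<le> a)"

lemma concave_Bw: "within_branch a b \<Longrightarrow> concave_on {a..b} (\<lambda>x. Bw x + 47/40 * x\<^sup>2)"
proof -
  assume "within_branch a b"
  then consider "0 \<le> a" "b \<le> 1/4" | "1/4 \<le> a" "b \<le> 1/2" by (auto simp: within_branch_def)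
  then show ?thesis
  proof cases
    case 1
    then have "concave_on {a..b} (\<lambda>x. L x + 47/40 * x\<^sup>2)"
      using 1 convex_on_subset[OF concave_L[unfolded concave_on_def]] by (auto simp: concave_on_def)
    then show ?thesis by (rule concave_on_cong) (use 1 in \<open>auto simp: Bw_L\<close>)
  next
    case 2
    then have "concave_on {a..b} (\<lambda>x. Q x + 47/40 * x\<^sup>2)"
      using 2 convex_on_subset[OF concave_Q[unfolded concave_on_def]] by (auto simp: concave_on_def)
    then show ?thesis by (rule concave_on_cong) (use 2 in \<open>auto simp: Bw_Q\<close>)
  qed
qed

text \<open>For each majorant \<open>g\<close> of the middle value, the defect is separately concave, so its
  minimum is at a corner. Subtracting \<open>e * (y - ym)\<^sup>2\<close>, with \<open>ym\<close>
  the centre of the interval for \<open>y\<close>, restores concavity in \<open>y\<close> where it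
  just fails, and costs the same amount at all corners.\<close>
lemma two_point_rectangle:
  assumes br: "within_branch x1 x2" and supp: "supporting c s"
    and y12: "1/2 \<le> y1" "y2 \<le> 1"
    and cur: "\<And>y. y1 < y \<Longrightarrow> y < y2 \<Longrightarrow> (47/20 - 2 * e) * Jw y \<le> s * kappa" and e: "0 \<le> e"
    and l: "l1 \<le> Bw x1" "l2 \<le> Bw x2" and j: "j1 \<le> Jw y1" "j2 \<le> Jw y2"
    and Q: "2 * Q ((x1 + y1) / 2) \<le> c * (y1 - x1) + s * j1 - e * ((y2 - y1) / 2)\<^sup>2 + l1"
      "2 * Q ((x1 + y2) / 2) \<le> c * (y2 - x1) + s * j2 - e * ((y2 - y1) / 2)\<^sup>2 + l1"
      "2 * Q ((x2 + y1) / 2) \<le> c * (y1 - x2) + s * j1 - e * ((y2 - y1) / 2)\<^sup>2 + l2"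
      "2 * Q ((x2 + y2) / 2) \<le> c * (y2 - x2) + s * j2 - e * ((y2 - y1) / 2)\<^sup>2 + l2"
    and J_majorant: "2 * J_majorant ((x1 + y1) / 2) \<le> c * (y1 - x1) + s * j1 - e * ((y2 - y1) / 2)\<^sup>2 + l1"
      "2 * J_majorant ((x1 + y2) / 2) \<le> c * (y2 - x1) + s * j2 - e * ((y2 - y1) / 2)\<^sup>2 + l1"
      "2 * J_majorant ((x2 + y1) / 2) \<le> c * (y1 - x2) + s * j1 - e * ((y2 - y1) / 2)\<^sup>2 + l2"
      "2 * J_majorant ((x2 + y2) / 2) \<le> c * (y2 - x2) + s * j2 - e * ((y2 - y1) / 2)\<^sup>2 + l2"
    and xy: "x1 \<le> x" "x \<le> x2" "y1 \<le> y" "y \<le> y2"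
  shows "two_point_at x y"
proof -
  have x12: "0 \<le> x1" "x2 \<le> 1/2" using br by (auto simp: within_branch_def)
  have s0: "0 \<le> s" using supp by (simp add: supporting_def)
  define ym where "ym = (y1 + y2) / 2"
  have ym: "(y1 - ym)\<^sup>2 = ((y2 - y1) / 2)\<^sup>2" "(y2 - ym)\<^sup>2 = ((y2 - y1) / 2)\<^sup>2"
    by (simp_all add: ym_def power2_eq_square field_simps)
  have key: "2 * g ((x + y) / 2) \<le> c * (y - x) + s * Jw y + Bw x"
    if g: "g = Q \<or> g = J_majorant"
      and c11: "2 * g ((x1 + y1) / 2) \<le> c * (y1 - x1) + s * j1 - e * ((y2 - y1) / 2)\<^sup>2 + l1"
      and c12: "2 * g ((x1 + y2) / 2) \<le> c * (y2 - x1) + s * j2 - e * ((y2 - y1) / 2)\<^sup>2 + l1"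
      and c21: "2 * g ((x2 + y1) / 2) \<le> c * (y1 - x2) + s * j1 - e * ((y2 - y1) / 2)\<^sup>2 + l2"
      and c22: "2 * g ((x2 + y2) / 2) \<le> c * (y2 - x2) + s * j2 - e * ((y2 - y1) / 2)\<^sup>2 + l2" for g
  proof -
    define F where "F x y = c * (y - x) + (s * Jw y - e * (y - ym)\<^sup>2) + Bw x - 2 * g ((x + y) / 2)" for x y
    have sj: "s * j1 \<le> s * Jw y1" "s * j2 \<le> s * Jw y2" using s0 j by (auto intro: mult_left_mono)
    have "0 \<le> F x y"
    proof (rule separately_concave_nonneg[where F = F, OF _ _ _ _ _ _ xy])
      fix v assume v: "y1 \<le> v" "v \<le> y2"
      have "concave_on {x1..x2} (\<lambda>x. (Bw x + 47/40 * x\<^sup>2) + (- 2 * g ((x + v) / 2) - 47/40 * x\<^sup>2)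
          + (- c * x + (c * v + (s * Jw v - e * (v - ym)\<^sup>2))))"
        by (intro concave_on_add concave_Bw br concave_minus_mid[OF g] concave_on_affine)
          (use v y12 x12 in auto)
      then show "concave_on {x1..x2} (\<lambda>x. F x v)" by (simp add: F_def algebra_simps)
    next
      fix u assume "u \<in> {x1, x2}"
      then have u: "0 \<le> u" "u \<le> 1/2" using x12 xy by auto
      have "concave_on {y1..y2} (\<lambda>y. (s * Jw y - e * (y - ym)\<^sup>2 + 47/40 * y\<^sup>2)
          + (- 2 * g ((y + u) / 2) - 47/40 * y\<^sup>2) + (c * y + (Bw u - c * u)))"
        by (intro concave_on_add concave_Jw[OF y12 cur] concave_minus_mid[OF g] concave_on_affine)
          (use u y12 in auto)
      then show "concave_on {y1..y2} (\<lambda>y. F u y)" by (simp add: F_def algebra_simps)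
    qed (use c11 c12 c21 c22 sj l ym in \<open>simp_all add: F_def\<close>)
    moreover have "0 \<le> e * (y - ym)\<^sup>2" using e by simp
    ultimately show ?thesis by (simp add: F_def)
  qed
  have "2 * max (Q ((x + y) / 2)) (J_majorant ((x + y) / 2)) \<le> c * (y - x) + s * Jw y + Bw x"
    using key[OF _ Q] key[OF _ J_majorant] by (simp add: max_def)
  moreover have "Bw ((x + y) / 2) \<le> max (Q ((x + y) / 2)) (J_majorant ((x + y) / 2))"
    using xy x12 y12 by (intro Bw_le_max) auto
  moreover have "Bw y = Jw y" using xy y12 by (intro Bw_J) auto
  ultimately show ?thesis unfolding two_point_at_def using supp by (intro exI[of _ c] exI[of _ s]) auto
qed

text \<open>At rational points this is a rational linear form in \<open>sqrt 2\<close>, so that corner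
  conditions become linear arithmetic.\<close>
lemma Q_split_sqrt2: "Q x = 2/3 * x * (1 - x) * (12 * x - 3) + sqrt 2 * (2/3 * x * (1 - x) * (4 - 8 * x))"
  by (simp add: Q_eq field_simps)

lemma Bw_values:
  "0 \<le> Bw 0" "1/8 \<le> Bw (1/16)" "2165/10000 \<le> Bw (1/8)" "2911/10000 \<le> Bw (3/16)"
  "35355/100000 \<le> Bw (1/4)"
  "Q (1/4) \<le> Bw (1/4)" "Q (3/8) \<le> Bw (3/8)" "Q (7/16) \<le> Bw (7/16)" "Q (1/2) \<le> Bw (1/2)"
proof -
  show "0 \<le> Bw 0" by (simp add: Bw_L)
  have "sqrt 4 = (2::real)" by (rule real_sqrt_unique) auto
  then show "1/8 \<le> Bw (1/16)" using L_power[of 4] by (simp add: Bw_L)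
  have "1732/1000 \<le> sqrt (3::real)" by (rule real_le_rsqrt) (simp add: power_divide)
  then show "2165/10000 \<le> Bw (1/8)" using L_power[of 3] by (simp add: Bw_L)
  have "41 = log 2 (2 ^ 41)" by (subst log_nat_power) auto
  also have "\<dots> \<le> log 2 ((16/3) ^ 17)" by (subst log_le_cancel_iff) (auto simp: power_divide)
  also have "\<dots> = 17 * log 2 (16/3)" by (subst log_nat_power) auto
  finally have "41/17 \<le> log 2 (16/3)" by simp
  then have "2911/10000 * (16/3) \<le> sqrt (log 2 (16/3))"
    by (intro real_le_rsqrt) (simp add: power2_eq_square)
  then show "2911/10000 \<le> Bw (3/16)" by (simp add: Bw_L L_eq)
  show "35355/100000 \<le> Bw (1/4)" using sqrt2_bounds by (simp add: Bw_L L_quarter)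
  show "Q (1/4) \<le> Bw (1/4)" "Q (3/8) \<le> Bw (3/8)" "Q (7/16) \<le> Bw (7/16)" "Q (1/2) \<le> Bw (1/2)"
    by (simp_all add: Bw_Q)
qed

lemma Jw_ge_quadratic:
  assumes "1/2 \<le> y" "y \<le> 11/16"
  shows "1/2 + 1812/10000 * (y - 1/2) - 39/20 * (y - 1/2)\<^sup>2 \<le> Jw y"
proof -
  have "1812/10000 * (y - 1/2) \<le> dJ (1/2) * (y - 1/2)"
    using dJ_half_bounds assms by (intro mult_right_mono) auto
  with Jw_ge_parabola[OF assms] show ?thesis by linarith
qed

lemma Jw_more_values:
  "504185/1000000 \<le> Jw (11/20)" "49862/100000 \<le> Jw (3/5)" "487148/1000000 \<le> Jw (16/25)"
  using Jw_ge_quadratic[of "11/20"] Jw_ge_quadratic[of "3/5"] Jw_ge_quadratic[of "16/25"]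
  by (simp_all add: power2_eq_square)

lemma Jw_concavity_margin:
  assumes "61/100 \<le> s" "1/2 \<le> y" "y < 1"
  shows "(47/20 - 2 * 0) * Jw y \<le> s * kappa"
proof -
  have "47/20 * Jw y \<le> 47/20 * (50425/100000)" using Jw_le[of y] assms by (intro mult_left_mono) auto
  also have "\<dots> \<le> 61/100 * (19449/10000)" by simp
  also have "\<dots> \<le> s * kappa" using assms kappa_bounds by (intro mult_mono) auto
  finally show ?thesis by simp
qed

text \<open>For the slope \<open>sqrt 2 - 1\<close>. The parabola above \<open>J\<close> decreases beyond its
  vertex, so its value \<open>b\<close> at \<open>1/2 + a\<close> bounds \<open>J\<close> from there
  on.\<close>
lemma Jw_concavity_margin_wide:
  assumes y: "1/2 + a \<le> y" "y < 1" "1815/10000 \<le> 482/125 * a"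
    and b: "1/2 + 1815/10000 * a - 241/125 * a\<^sup>2 \<le> b" and eb: "e \<le> 47/40" "(47/20 - 2 * e) * b \<le> 41421/100000 * (19449/10000)"
  shows "(47/20 - 2 * e) * Jw y \<le> (sqrt 2 - 1) * kappa"
proof -
  define v where "v = y - 1/2"
  have a0: "0 \<le> a" using y(3) by simp
  have v: "a \<le> v" using y by (simp add: v_def)
  have "dJ (1/2) * v \<le> 1815/10000 * v" using dJ_half_bounds v a0 by (intro mult_right_mono) auto
  then have "Jw y \<le> 1/2 + 1815/10000 * v - 241/125 * v\<^sup>2"
    using Jw_le_parabola[of y] y a0 unfolding v_def by linarith
  also have "\<dots> = 1/2 + 1815/10000 * a - 241/125 * a\<^sup>2 - (v - a) * (241/125 * (v + a) - 1815/10000)"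
    by (simp add: field_simps power2_eq_square)
  also have "\<dots> \<le> b"
  proof -
    have "0 \<le> (v - a) * (241/125 * (v + a) - 1815/10000)" using v y(3) by (intro mult_nonneg_nonneg) auto
    with b show ?thesis by linarith
  qed
  finally have "(47/20 - 2 * e) * Jw y \<le> (47/20 - 2 * e) * b" using eb by (intro mult_left_mono) auto
  also note eb(2)
  also have "41421/100000 * (19449/10000) \<le> (sqrt 2 - 1) * kappa"
    using sqrt2_bounds kappa_bounds by (intro mult_mono) auto
  finally show ?thesis .
qed

text \<open>The following rectangles use pairs \<open>(c, s)\<close> on the unit circle, rounded inwards. Each
  pair is close to the direction of \<open>(y - x, B y)\<close> at an inner point and was found by
  maximising the smallest corner value.\<close>
lemma tangent_rectangle_1: "two_point_at x y" if "1/16 \<le> x" "x \<le> 1/8" "1/2 \<le> y" "y \<le> 3/5"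
proof -
  have s: "supporting (147/200) (339/500)" by (rule supporting_unit_disc) (simp_all add: power2_eq_square)
  show ?thesis
    by (rule two_point_rectangle[OF _ s _ _ Jw_concavity_margin, where ?x1.0 = "1/16" and ?x2.0 = "1/8" and ?y1.0 = "1/2" and ?y2.0 = "3/5"
        and ?l1.0 = "1/8" and ?l2.0 = "2165/10000" and ?j1.0 = "1/2" and ?j2.0 = "49862/100000"])
    (use that sqrt2_bounds Bw_values(2) Bw_values(3) Jw_half Jw_more_values(2) in \<open>simp_all add: within_branch_def Q_split_sqrt2 J_majorant_def power2_eq_square\<close>)
qed

lemma tangent_rectangle_2: "two_point_at x y" if "1/8 \<le> x" "x \<le> 1/4" "1/2 \<le> y" "y \<le> 11/20"
proof -
  have s: "supporting (121/250) (7/8)" by (rule supporting_unit_disc) (simp_all add: power2_eq_square)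
  show ?thesis
    by (rule two_point_rectangle[OF _ s _ _ Jw_concavity_margin, where ?x1.0 = "1/8" and ?x2.0 = "1/4" and ?y1.0 = "1/2" and ?y2.0 = "11/20"
        and ?l1.0 = "2165/10000" and ?l2.0 = "35355/100000" and ?j1.0 = "1/2" and ?j2.0 = "504185/1000000"])
    (use that sqrt2_bounds Bw_values(3) Bw_values(5) Jw_half Jw_more_values(1) in \<open>simp_all add: within_branch_def Q_split_sqrt2 J_majorant_def power2_eq_square\<close>)
qed

lemma tangent_rectangle_3: "two_point_at x y" if "1/8 \<le> x" "x \<le> 1/4" "11/20 \<le> y" "y \<le> 3/5"
proof -
  have s: "supporting (113/200) (33/40)" by (rule supporting_unit_disc) (simp_all add: power2_eq_square)
  show ?thesis
    by (rule two_point_rectangle[OF _ s _ _ Jw_concavity_margin, where ?x1.0 = "1/8" and ?x2.0 = "1/4" and ?y1.0 = "11/20" and ?y2.0 = "3/5"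
        and ?l1.0 = "2165/10000" and ?l2.0 = "35355/100000" and ?j1.0 = "504185/1000000" and ?j2.0 = "49862/100000"])
    (use that sqrt2_bounds Bw_values(3) Bw_values(5) Jw_more_values(1) Jw_more_values(2) in \<open>simp_all add: within_branch_def Q_split_sqrt2 J_majorant_def power2_eq_square\<close>)
qed

lemma tangent_rectangle_4: "two_point_at x y" if "1/8 \<le> x" "x \<le> 3/16" "3/5 \<le> y" "y \<le> 11/16"
proof -
  have s: "supporting (731/1000) (341/500)" by (rule supporting_unit_disc) (simp_all add: power2_eq_square)
  show ?thesis
    by (rule two_point_rectangle[OF _ s _ _ Jw_concavity_margin, where ?x1.0 = "1/8" and ?x2.0 = "3/16" and ?y1.0 = "3/5" and ?y2.0 = "11/16"
        and ?l1.0 = "2165/10000" and ?l2.0 = "2911/10000" and ?j1.0 = "49862/100000" and ?j2.0 = "4655/10000"])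
    (use that sqrt2_bounds Bw_values(3) Bw_values(4) Jw_more_values(2) Jw_values(1) in \<open>simp_all add: within_branch_def Q_split_sqrt2 J_majorant_def power2_eq_square\<close>)
qed

lemma tangent_rectangle_5: "two_point_at x y" if "3/16 \<le> x" "x \<le> 1/4" "3/5 \<le> y" "y \<le> 16/25"
proof -
  have s: "supporting (121/200) (199/250)" by (rule supporting_unit_disc) (simp_all add: power2_eq_square)
  show ?thesis
    by (rule two_point_rectangle[OF _ s _ _ Jw_concavity_margin, where ?x1.0 = "3/16" and ?x2.0 = "1/4" and ?y1.0 = "3/5" and ?y2.0 = "16/25"
        and ?l1.0 = "2911/10000" and ?l2.0 = "35355/100000" and ?j1.0 = "49862/100000" and ?j2.0 = "487148/1000000"])
    (use that sqrt2_bounds Bw_values(4) Bw_values(5) Jw_more_values(2) Jw_more_values(3) in \<open>simp_all add: within_branch_def Q_split_sqrt2 J_majorant_def power2_eq_square\<close>)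
qed

lemma tangent_rectangle_6: "two_point_at x y" if "3/16 \<le> x" "x \<le> 1/4" "16/25 \<le> y" "y \<le> 11/16"
proof -
  have s: "supporting (667/1000) (149/200)" by (rule supporting_unit_disc) (simp_all add: power2_eq_square)
  show ?thesis
    by (rule two_point_rectangle[OF _ s _ _ Jw_concavity_margin, where ?x1.0 = "3/16" and ?x2.0 = "1/4" and ?y1.0 = "16/25" and ?y2.0 = "11/16"
        and ?l1.0 = "2911/10000" and ?l2.0 = "35355/100000" and ?j1.0 = "487148/1000000" and ?j2.0 = "4655/10000"])
    (use that sqrt2_bounds Bw_values(4) Bw_values(5) Jw_more_values(3) Jw_values(1) in \<open>simp_all add: within_branch_def Q_split_sqrt2 J_majorant_def power2_eq_square\<close>)
qed

lemma tangent_rectangle_7: "two_point_at x y" if "3/16 \<le> x" "x \<le> 1/4" "11/16 \<le> y" "y \<le> 3/4"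
proof -
  have s: "supporting (147/200) (339/500)" by (rule supporting_unit_disc) (simp_all add: power2_eq_square)
  show ?thesis
    by (rule two_point_rectangle[OF _ s _ _ Jw_concavity_margin, where ?x1.0 = "3/16" and ?x2.0 = "1/4" and ?y1.0 = "11/16" and ?y2.0 = "3/4"
        and ?l1.0 = "2911/10000" and ?l2.0 = "35355/100000" and ?j1.0 = "4655/10000" and ?j2.0 = "4223/10000"])
    (use that sqrt2_bounds Bw_values(4) Bw_values(5) Jw_values(1) Jw_values(2) in \<open>simp_all add: within_branch_def Q_split_sqrt2 J_majorant_def power2_eq_square\<close>)
qed

lemma tangent_rectangle_8: "two_point_at x y" if "1/4 \<le> x" "x \<le> 3/8" "11/16 \<le> y" "y \<le> 3/4"
proof -
  have s: "supporting (673/1000) (739/1000)" by (rule supporting_unit_disc) (simp_all add: power2_eq_square)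
  show ?thesis
    by (rule two_point_rectangle[OF _ s _ _ Jw_concavity_margin, where ?x1.0 = "1/4" and ?x2.0 = "3/8" and ?y1.0 = "11/16" and ?y2.0 = "3/4"
        and ?l1.0 = "(Q (1/4))" and ?l2.0 = "(Q (3/8))" and ?j1.0 = "4655/10000" and ?j2.0 = "4223/10000"])
    (use that sqrt2_bounds Bw_values(6) Bw_values(7) Jw_values(1) Jw_values(2) in \<open>simp_all add: within_branch_def Q_split_sqrt2 J_majorant_def power2_eq_square\<close>)
qed

lemma tangent_rectangle_9: "two_point_at x y" if "3/8 \<le> x" "x \<le> 7/16" "11/16 \<le> y" "y \<le> 3/4"
proof -
  have s: "supporting (533/1000) (423/500)" by (rule supporting_unit_disc) (simp_all add: power2_eq_square)
  show ?thesis
    by (rule two_point_rectangle[OF _ s _ _ Jw_concavity_margin, where ?x1.0 = "3/8" and ?x2.0 = "7/16" and ?y1.0 = "11/16" and ?y2.0 = "3/4"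
        and ?l1.0 = "(Q (3/8))" and ?l2.0 = "(Q (7/16))" and ?j1.0 = "4655/10000" and ?j2.0 = "4223/10000"])
    (use that sqrt2_bounds Bw_values(7) Bw_values(8) Jw_values(1) Jw_values(2) in \<open>simp_all add: within_branch_def Q_split_sqrt2 J_majorant_def power2_eq_square\<close>)
qed

lemma tangent_rectangle_10: "two_point_at x y" if "7/16 \<le> x" "x \<le> 1/2" "11/16 \<le> y" "y \<le> 3/4"
proof -
  have s: "supporting (431/1000) (451/500)" by (rule supporting_unit_disc) (simp_all add: power2_eq_square)
  show ?thesis
    by (rule two_point_rectangle[OF _ s _ _ Jw_concavity_margin, where ?x1.0 = "7/16" and ?x2.0 = "1/2" and ?y1.0 = "11/16" and ?y2.0 = "3/4"
        and ?l1.0 = "(Q (7/16))" and ?l2.0 = "(Q (1/2))" and ?j1.0 = "4655/10000" and ?j2.0 = "4223/10000"])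
    (use that sqrt2_bounds Bw_values(8) Bw_values(9) Jw_values(1) Jw_values(2) in \<open>simp_all add: within_branch_def Q_split_sqrt2 J_majorant_def power2_eq_square\<close>)
qed

lemma tangent_rectangle_11: "two_point_at x y" if "1/4 \<le> x" "x \<le> 3/8" "3/4 \<le> y" "y \<le> 7/8"
proof -
  have s: "supporting (773/1000) (317/500)" by (rule supporting_unit_disc) (simp_all add: power2_eq_square)
  show ?thesis
    by (rule two_point_rectangle[OF _ s _ _ Jw_concavity_margin, where ?x1.0 = "1/4" and ?x2.0 = "3/8" and ?y1.0 = "3/4" and ?y2.0 = "7/8"
        and ?l1.0 = "(Q (1/4))" and ?l2.0 = "(Q (3/8))" and ?j1.0 = "4223/10000" and ?j2.0 = "2783/10000"])
    (use that sqrt2_bounds Bw_values(6) Bw_values(7) Jw_values(2) Jw_values(4) in \<open>simp_all add: within_branch_def Q_split_sqrt2 J_majorant_def power2_eq_square\<close>)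
qed

lemma tangent_rectangle_12: "two_point_at x y" if "3/8 \<le> x" "x \<le> 1/2" "3/4 \<le> y" "y \<le> 13/16"
proof -
  have s: "supporting (117/200) (811/1000)" by (rule supporting_unit_disc) (simp_all add: power2_eq_square)
  show ?thesis
    by (rule two_point_rectangle[OF _ s _ _ Jw_concavity_margin, where ?x1.0 = "3/8" and ?x2.0 = "1/2" and ?y1.0 = "3/4" and ?y2.0 = "13/16"
        and ?l1.0 = "(Q (3/8))" and ?l2.0 = "(Q (1/2))" and ?j1.0 = "4223/10000" and ?j2.0 = "3609/10000"])
    (use that sqrt2_bounds Bw_values(7) Bw_values(9) Jw_values(2) Jw_values(3) in \<open>simp_all add: within_branch_def Q_split_sqrt2 J_majorant_def power2_eq_square\<close>)
qed

lemma tangent_rectangle_13: "two_point_at x y" if "3/8 \<le> x" "x \<le> 1/2" "13/16 \<le> y" "y \<le> 7/8"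
proof -
  have s: "supporting (681/1000) (183/250)" by (rule supporting_unit_disc) (simp_all add: power2_eq_square)
  show ?thesis
    by (rule two_point_rectangle[OF _ s _ _ Jw_concavity_margin, where ?x1.0 = "3/8" and ?x2.0 = "1/2" and ?y1.0 = "13/16" and ?y2.0 = "7/8"
        and ?l1.0 = "(Q (3/8))" and ?l2.0 = "(Q (1/2))" and ?j1.0 = "3609/10000" and ?j2.0 = "2783/10000"])
    (use that sqrt2_bounds Bw_values(7) Bw_values(9) Jw_values(3) Jw_values(4) in \<open>simp_all add: within_branch_def Q_split_sqrt2 J_majorant_def power2_eq_square\<close>)
qed

text \<open>The following rectangles use the pair \<open>(1, sqrt 2 - 1)\<close>, which is the better one when
  \<open>y\<close> is large compared with \<open>x\<close>. One of them has the corner \<open>(0,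
  1)\<close>, where there is equality.\<close>
lemma chord_rectangle_1: "two_point_at x y" if "1/4 \<le> x" "x \<le> 1/2" "7/8 \<le> y" "y \<le> 1"
  by (rule two_point_rectangle[OF _ supporting_one _ _ Jw_concavity_margin_wide[of "3/8" _ "297/1000" 0], where ?x1.0 = "1/4" and ?x2.0 = "1/2" and ?y1.0 = "7/8" and ?y2.0 = "1"
        and ?l1.0 = "(Q (1/4))" and ?l2.0 = "(Q (1/2))" and ?j1.0 = "2783/10000" and ?j2.0 = "0"])
    (use that sqrt2_bounds Bw_values(6) Bw_values(9) Jw_values(4) Jw_one in \<open>simp_all add: within_branch_def Q_split_sqrt2 J_majorant_def power2_eq_square
        diff_divide_distrib add_divide_distrib\<close>)

lemma chord_rectangle_2: "two_point_at x y" if "0 \<le> x" "x \<le> 1/4" "7/8 \<le> y" "y \<le> 1"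
  by (rule two_point_rectangle[OF _ supporting_one _ _ Jw_concavity_margin_wide[of "3/8" _ "297/1000" 0], where ?x1.0 = "0" and ?x2.0 = "1/4" and ?y1.0 = "7/8" and ?y2.0 = "1"
        and ?l1.0 = "0" and ?l2.0 = "35355/100000" and ?j1.0 = "2783/10000" and ?j2.0 = "0"])
    (use that sqrt2_bounds Bw_values(1) Bw_values(5) Jw_values(4) Jw_one in \<open>simp_all add: within_branch_def Q_split_sqrt2 J_majorant_def power2_eq_square
        diff_divide_distrib add_divide_distrib\<close>)

lemma chord_rectangle_3: "two_point_at x y" if "0 \<le> x" "x \<le> 1/4" "3/4 \<le> y" "y \<le> 7/8"
  by (rule two_point_rectangle[OF _ supporting_one _ _ Jw_concavity_margin_wide[of "1/4" _ "425/1000" "1/4"], where ?x1.0 = "0" and ?x2.0 = "1/4" and ?y1.0 = "3/4" and ?y2.0 = "7/8"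
        and ?l1.0 = "0" and ?l2.0 = "35355/100000" and ?j1.0 = "4223/10000" and ?j2.0 = "2783/10000"])
    (use that sqrt2_bounds Bw_values(1) Bw_values(5) Jw_values(2) Jw_values(4) in \<open>simp_all add: within_branch_def Q_split_sqrt2 J_majorant_def power2_eq_square
        diff_divide_distrib add_divide_distrib\<close>)

lemma chord_rectangle_4: "two_point_at x y" if "0 \<le> x" "x \<le> 3/16" "11/16 \<le> y" "y \<le> 3/4"
  by (rule two_point_rectangle[OF _ supporting_one _ _ Jw_concavity_margin_wide[of "3/16" _ "4663/10000" "1/3"], where ?x1.0 = "0" and ?x2.0 = "3/16" and ?y1.0 = "11/16" and ?y2.0 = "3/4"
        and ?l1.0 = "0" and ?l2.0 = "2911/10000" and ?j1.0 = "4655/10000" and ?j2.0 = "4223/10000"])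
    (use that sqrt2_bounds Bw_values(1) Bw_values(4) Jw_values(1) Jw_values(2) in \<open>simp_all add: within_branch_def Q_split_sqrt2 J_majorant_def power2_eq_square
        diff_divide_distrib add_divide_distrib\<close>)

section \<open>Strips, and the two-point inequality\<close>

lemma Q_shift:
  "Q (1/2 - (d - v)) = Q (1/2 - d) + (q3/6 + 4 * d - 2 * q3 * d\<^sup>2) * v - 2 * (1 - q3 * d) * v\<^sup>2 - 2/3 * q3 * v^3"
  unfolding Q_centered by (simp add: field_simps power2_eq_square power3_eq_cube)

text \<open>On a vertical line \<open>x = x0\<close>, with \<open>J\<close> replaced by the parabola below it,
  the defect is a cubic in \<open>y - y0\<close>; the hypotheses say that its coefficients are
  nonnegative.\<close>
lemma strip_edge:
  fixes x0 y0 y l s d :: real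
  assumes y0: "1/2 \<le> y0" "y0 \<le> y" "y \<le> 11/16" and s: "0 \<le> s" and d: "d = 1/2 - (x0 + y0) / 2"
    and A0: "2 * Q (1/2 - d) \<le> y0 - x0 + s * (1/2 + 1812/10000 * (y0 - 1/2) - 39/20 * (y0 - 1/2)\<^sup>2) + l"
    and A1: "q3/6 + 4 * d - 2 * q3 * d\<^sup>2 \<le> 1 + s * (1812/10000 - 39/10 * (y0 - 1/2))"
    and A2: "39/20 * s \<le> 1 - q3 * d"
  shows "2 * Q ((x0 + y) / 2) \<le> y - x0 + s * Jw y + l"
proof -
  define u where "u = y - y0"
  have u: "0 \<le> u" "y = y0 + u" using y0 by (auto simp: u_def)
  have m: "(x0 + y) / 2 = 1/2 - (d - u/2)" by (simp add: d u field_simps)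
  have 1: "(q3/6 + 4 * d - 2 * q3 * d\<^sup>2) * u \<le> (1 + s * (1812/10000 - 39/10 * (y0 - 1/2))) * u"
    using A1 u by (intro mult_right_mono)
  have 2: "39/20 * s * u\<^sup>2 \<le> (1 - q3 * d) * u\<^sup>2" using A2 by (intro mult_right_mono) auto
  have 3: "0 \<le> q3 * u^3" using q3_bounds u by simp
  have "2 * Q ((x0 + y) / 2) = 2 * Q (1/2 - d) + (q3/6 + 4 * d - 2 * q3 * d\<^sup>2) * u - (1 - q3 * d) * u\<^sup>2 - 1/6 * (q3 * u^3)"
    unfolding m Q_shift by (simp add: field_simps power2_eq_square power3_eq_cube)
  also have "\<dots> \<le> (y0 - x0 + s * (1/2 + 1812/10000 * (y0 - 1/2) - 39/20 * (y0 - 1/2)\<^sup>2) + l)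
      + (1 + s * (1812/10000 - 39/10 * (y0 - 1/2))) * u - 39/20 * s * u\<^sup>2"
    using A0 1 2 3 by linarith
  also have "\<dots> = y - x0 + s * (1/2 + 1812/10000 * (y - 1/2) - 39/20 * (y - 1/2)\<^sup>2) + l"
    by (simp add: u(2) field_simps power2_eq_square)
  also have "\<dots> \<le> y - x0 + s * Jw y + l"
    using mult_left_mono[OF Jw_ge_quadratic s, of y] y0 by simp
  finally show ?thesis .
qed

text \<open>For the pair \<open>(1, sqrt 2 - 1)\<close> and \<open>y\<close> close to \<open>1/2\<close>,
  concavity in \<open>y\<close> fails, and at \<open>(0, 1/2)\<close> there is equality. Concavity
  in \<open>x\<close> still reduces the claim to the two edges \<open>x = 0\<close> and \<open>x =
  xs\<close>.\<close>
lemma strip: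
  assumes xs: "xs \<le> 1/4" and x: "0 \<le> x" "x \<le> xs" and y: "1/2 \<le> y" "y \<le> 11/16"
    and edge: "2 * Q ((xs + y) / 2) \<le> y - xs + (sqrt 2 - 1) * Jw y + Bw xs"
  shows "two_point_at x y"
proof -
  have edge0: "2 * Q ((0 + y) / 2) \<le> y - 0 + (sqrt 2 - 1) * Jw y + 0"
    by (rule strip_edge[where ?y0.0 = "1/2" and ?x0.0 = 0 and d = "1/4"])
      (use y sqrt2_bounds in \<open>simp_all add: Q_split_sqrt2 q3_def power2_eq_square field_simps\<close>)
  define F where "F x = y - x + (sqrt 2 - 1) * Jw y + Bw x - 2 * Q ((x + y) / 2)" for x
  have "concave_on {0..xs} (\<lambda>x. (Bw x + 47/40 * x\<^sup>2) + (- 2 * Q ((x + y) / 2) - 47/40 * x\<^sup>2)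
      + (- 1 * x + (y + (sqrt 2 - 1) * Jw y)))"
    by (intro concave_on_add concave_Bw concave_minus_mid concave_on_affine)
      (use y xs x in \<open>auto simp: within_branch_def\<close>)
  then have conc: "concave_on {0..xs} F" by (simp add: F_def[abs_def] algebra_simps)
  have "0 \<le> F x"
    by (rule concave_on_nonneg[OF conc]) (use x edge edge0 in \<open>auto simp: F_def Bw_L\<close>)
  moreover have "Bw ((x + y) / 2) = Q ((x + y) / 2)" using x xs y by (intro Bw_Q) auto
  moreover have "Bw y = Jw y" using y by (intro Bw_J) auto
  ultimately show ?thesis
    unfolding two_point_at_def F_def
    by (intro exI[of _ 1] exI[of _ "sqrt 2 - 1"] conjI supporting_one) auto
qed

lemma strip_1: "two_point_at x y" if "0 \<le> x" "x \<le> 1/16" "1/2 \<le> y" "y \<le> 3/5"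
proof (rule strip[where xs = "1/16"])
  show "2 * Q ((1/16 + y) / 2) \<le> y - 1/16 + (sqrt 2 - 1) * Jw y + Bw (1/16)"
    by (rule strip_edge[where ?y0.0 = "1/2" and ?x0.0 = "1/16" and d = "7/32"])
      (use that sqrt2_bounds Bw_values in \<open>simp_all add: Q_split_sqrt2 q3_def power2_eq_square field_simps\<close>)
qed (use that in auto)

lemma strip_2: "two_point_at x y" if "0 \<le> x" "x \<le> 1/8" "3/5 \<le> y" "y \<le> 11/16"
proof (rule strip[where xs = "1/8"])
  show "2 * Q ((1/8 + y) / 2) \<le> y - 1/8 + (sqrt 2 - 1) * Jw y + Bw (1/8)"
    by (rule strip_edge[where ?y0.0 = "3/5" and ?x0.0 = "1/8" and d = "11/80"])
      (use that sqrt2_bounds Bw_values in \<open>simp_all add: Q_split_sqrt2 q3_def power2_eq_square field_simps\<close>)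
qed (use that in auto)

lemma Bw_nonneg:
  assumes "0 \<le> x" "x \<le> 1" shows "0 \<le> Bw x"
proof -
  have L: "0 \<le> L x" if "0 \<le> x" "x \<le> 1/2" for x
    using that by (cases "x = 0") (auto simp: L_eq zero_le_log_cancel_iff)
  consider "x \<le> 1/4" | "1/4 \<le> x" "x \<le> 1/2" | "1/2 \<le> x" "x < 1" | "x = 1" using assms by linarith
  then show ?thesis
  proof cases
    case 1 then show ?thesis using L[of x] assms by (simp add: Bw_L)
  next
    case 2 then show ?thesis using L[of x] L_vs_Q(2)[of x] by (simp add: Bw_Q)
  next
    case 3 then show ?thesis using Jw_pos[of x] by (simp add: Bw_J)
  next
    case 4 then show ?thesis by (simp add: Bw_J Jw_one)
  qed
qed

lemma two_point_at_of_sqrt: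
  assumes "x \<le> y" "0 \<le> y" "y \<le> 1"
    and "2 * Bw ((x + y) / 2) \<le> sqrt ((y - x)\<^sup>2 + (Bw y)\<^sup>2) + Bw x"
  shows "two_point_at x y"
  using supporting_of_sqrt[of "y - x" "Bw y" "2 * Bw ((x + y) / 2) - Bw x"] assms Bw_nonneg[of y]
  unfolding two_point_at_def by (auto simp: algebra_simps)

lemma two_point_lower:
  assumes "0 \<le> x" "x \<le> y" "y \<le> 1/2"
  shows "two_point_at x y"
proof (rule two_point_at_of_sqrt)
  show "2 * Bw ((x + y) / 2) \<le> sqrt ((y - x)\<^sup>2 + (Bw y)\<^sup>2) + Bw x"
  proof (cases "(x + y) / 2 \<le> 1/4")
    case True
    then have x: "x \<le> 1/4" using assms by simp
    have "0 \<le> L y" using assms by (cases "y = 0") (auto simp: L_eq zero_le_log_cancel_iff)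
    moreover have "L y \<le> Bw y"
      using L_vs_Q(2)[of y] assms by (cases "y \<le> 1/4") (auto simp: Bw_L Bw_Q)
    ultimately have "(L y)\<^sup>2 \<le> (Bw y)\<^sup>2" by (intro power_mono)
    then have "sqrt ((y - x)\<^sup>2 + (L y)\<^sup>2) \<le> sqrt ((y - x)\<^sup>2 + (Bw y)\<^sup>2)" by simp
    then show ?thesis using L_two_point[OF assms] Bw_L[OF True] Bw_L[OF x] by linarith
  next
    case False
    define d h where "d = 1/2 - (x + y) / 2" and "h = (y - x) / 2"
    have dh: "0 \<le> h" "h \<le> d" "d \<le> 1/4" "1/2 - d = (x + y) / 2" "1/2 - (d + h) = x" "1/2 - (d - h) = y"
      using assms False by (auto simp: d_def h_def field_simps)
    have "(2 * Q ((x + y) / 2) - Q x)\<^sup>2 \<le> (Q y)\<^sup>2 + 4 * h\<^sup>2"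
      using Q_two_point[OF dh(1-3)] unfolding dh(4-6) .
    also have "4 * h\<^sup>2 = (y - x)\<^sup>2" by (simp add: h_def power_divide)
    finally have "2 * Q ((x + y) / 2) - Q x \<le> sqrt ((y - x)\<^sup>2 + (Q y)\<^sup>2)"
      by (intro real_le_rsqrt) simp
    moreover have "Q x \<le> Bw x"
      using L_vs_Q(1)[of x] assms by (cases "x \<le> 1/4") (auto simp: Bw_L Bw_Q)
    moreover have "Bw ((x + y) / 2) = Q ((x + y) / 2)" "Bw y = Q y"
      using assms False by (auto intro!: Bw_Q)
    ultimately show ?thesis by simp
  qed
qed (use assms in auto)

lemma two_point_upper:
  assumes "1/2 \<le> x" "x \<le> y" "y \<le> 1"
  shows "two_point_at x y"
proof (rule two_point_at_of_sqrt)
  have "2 * Jw ((x + y) / 2) - Jw x \<le> sqrt ((y - x)\<^sup>2 + (Jw y)\<^sup>2)"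
    using Jw_two_point[OF assms] by (rule real_le_rsqrt)
  then show "2 * Bw ((x + y) / 2) \<le> sqrt ((y - x)\<^sup>2 + (Bw y)\<^sup>2) + Bw x"
    using assms by (simp add: Bw_J)
qed (use assms in auto)

lemma two_point_near_half:
  assumes "1/4 \<le> x" "x \<le> 1/2" "1/2 \<le> y" "y \<le> 11/16"
  shows "two_point_at x y"
proof (rule two_point_at_of_sqrt)
  show "2 * Bw ((x + y) / 2) \<le> sqrt ((y - x)\<^sup>2 + (Bw y)\<^sup>2) + Bw x"
  proof (cases "(x + y) / 2 \<le> 1/2")
    case True
    define d e where "d = 1/2 - (x + y) / 2" and "e = y - 1/2"
    have de: "0 \<le> d" "2 * d + e \<le> 1/4" "0 \<le> e" "e \<le> 3/16" "1/2 - d = (x + y) / 2"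
      "1/2 - (2 * d + e) = x" "2 * (d + e) = y - x" "1/2 + e = y"
      using assms True by (auto simp: d_def e_def field_simps)
    have "2 * Q ((x + y) / 2) - Q x \<le> sqrt ((y - x)\<^sup>2 + (Jw y)\<^sup>2)"
      using Q_J_two_point_low[OF de(1-4)] unfolding de(5-8) by (rule real_le_rsqrt)
    moreover have "Bw ((x + y) / 2) = Q ((x + y) / 2)" using True assms by (intro Bw_Q) auto
    ultimately show ?thesis using assms by (simp add: Bw_Q Bw_J)
  next
    case False
    define u v where "u = 1/2 - x" and "v = y - 1/2"
    have uv: "0 \<le> u" "u \<le> v" "v \<le> 3/16" "1/2 + (v - u) / 2 = (x + y) / 2" "1/2 - u = x"
      "u + v = y - x" "1/2 + v = y"
      using assms False by (auto simp: u_def v_def field_simps)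
    have "2 * Jw ((x + y) / 2) - Q x \<le> sqrt ((y - x)\<^sup>2 + (Jw y)\<^sup>2)"
      using Q_J_two_point_high[OF uv(1-3)] unfolding uv(4-7) .
    moreover have "Bw ((x + y) / 2) = Jw ((x + y) / 2)" using False by (intro Bw_J) auto
    ultimately show ?thesis using assms by (simp add: Bw_Q Bw_J)
  qed
qed (use assms in auto)

theorem two_point_inequality:
  assumes "0 \<le> x" "x \<le> y" "y \<le> 1"
  shows "two_point_at x y"
proof -
  consider "y \<le> 1/2" | "1/2 \<le> x" | "1/4 \<le> x" "x \<le> 1/2" "1/2 \<le> y" | "x \<le> 1/4" "1/2 \<le> y"
    using assms by linarith
  then show ?thesis
  proof cases
    case 1 then show ?thesis using two_point_lower assms by auto
  next
    case 2 then show ?thesis using two_point_upper assms by auto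
  next
    case 3
    consider "y \<le> 11/16" | "11/16 \<le> y" "y \<le> 3/4" | "3/4 \<le> y" "y \<le> 7/8" | "7/8 \<le> y" by linarith
    then show ?thesis
    proof cases
      case 1 then show ?thesis using two_point_near_half 3 by auto
    next
      case 2
      consider "x \<le> 3/8" | "3/8 \<le> x" "x \<le> 7/16" | "7/16 \<le> x" by linarith
      then show ?thesis using tangent_rectangle_8 tangent_rectangle_9 tangent_rectangle_10 2 3 by cases auto
    next
      case h: 3
      consider "x \<le> 3/8" | "3/8 \<le> x" "y \<le> 13/16" | "3/8 \<le> x" "13/16 \<le> y" by linarith
      then show ?thesis using tangent_rectangle_11 tangent_rectangle_12 tangent_rectangle_13 h 3 by cases auto
    next
      case 4 then show ?thesis using chord_rectangle_1 3 assms by auto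
    qed
  next
    case 4
    consider "y \<le> 3/5" | "3/5 \<le> y" "y \<le> 11/16" | "11/16 \<le> y" "y \<le> 3/4" | "3/4 \<le> y" "y \<le> 7/8" | "7/8 \<le> y"
      by linarith
    then show ?thesis
    proof cases
      case 1
      consider "x \<le> 1/16" | "1/16 \<le> x" "x \<le> 1/8" | "1/8 \<le> x" "y \<le> 11/20" | "1/8 \<le> x" "11/20 \<le> y" by linarith
      then show ?thesis using strip_1 tangent_rectangle_1 tangent_rectangle_2 tangent_rectangle_3 1 4 assms by cases auto
    next
      case 2
      consider "x \<le> 1/8" | "1/8 \<le> x" "x \<le> 3/16" | "3/16 \<le> x" "y \<le> 16/25" | "3/16 \<le> x" "16/25 \<le> y" by linarith
      then show ?thesis using strip_2 tangent_rectangle_4 tangent_rectangle_5 tangent_rectangle_6 2 4 assms by cases auto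
    next
      case 3
      consider "x \<le> 3/16" | "3/16 \<le> x" by linarith
      then show ?thesis using chord_rectangle_4 tangent_rectangle_7 3 4 assms by cases auto
    next
      case h: 4 then show ?thesis using chord_rectangle_3 4 assms by auto
    next
      case h: 5 then show ?thesis using chord_rectangle_2 4 assms by auto
    qed
  qed
qed

theorem mainTheorem6:
  fixes n :: nat and A :: "bool list set"
  assumes "n \<ge> 1" and "A \<subseteq> cube n"
  shows "cube_expectation n (\<lambda>x. sqrt (real (boundary_degree n A x))) \<ge> B (29 / 32) (cube_measure n A)"
proof (rule cube_two_point_induction[OF _ _ _ assms(2)])
  show "B (29/32) 0 = 0" by (simp add: Bw_L)
  show "B (29/32) 1 = 0" by (simp add: Bw_J Jw_one)
  show "\<exists>c s. supporting c s \<and> 2 * Bw ((x + y) / 2) \<le> c * (y - x) + s * Bw y + Bw x"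
    if "0 \<le> x" "x \<le> y" "y \<le> 1" for x y
    using two_point_inequality[OF that] by (simp add: two_point_at_def)
qed

end
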